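(* Let $(M^{2n},\omega)$ be a compact symplectic manifold with smooth boundary $\partial M$, let $(\omega,J,g)$ be a compatible triple on $M$, and for $k\le n$ let $\pi:\Omega^k\to P^k$ be the primitive projection. Then for $k<n$ the map $\pi$ restricts to maps $$\pi:\Omega^k_D\to P^k_{D_+},\qquad \pi:\Omega^k_{JD}\to P^k_{N_-}.$$ That is, for $k<n$ and $\eta\in\Omega^k$: if $\eta\in D$ then $\pi(\eta)\in D_+$, and if $\eta\in JD$ then $\pi(\eta)\in N_-$.
   Context: $\Omega^k$ is the space of smooth $k$-forms on $M$. $L\eta=\omega\wedge\eta$ is the Lefschetz operator and $\Lambda$ its dual, normalized so that $[\Lambda,L]=H$, where $H$ acts on $k$-forms as multiplication by $n-k$. $d^\Lambda=d\Lambda-\Lambda d$. $P^k=\{\eta\in\Omega^k:\Lambda\eta=0\}$ is the space of primitive $k$-forms. For $k\le n$ each $\eta\in\Omega^k$ is uniquely $\eta=p+\omega\wedge\beta$ with $p\in P^k$ and $\beta\in\Omega^{k-2}$; the primitive projection is $\pi(\eta)=p$. For $B\in P^k$ one has uniquely $dB=B_{k+1}+L B_{k-1}$ with $B_{k+1}\in P^{k+1}$, $B_{k-1}\in P^{k-1}$ (with $B_{k+1}=0$ if $k=n$); define $\partial_+B=B_{k+1}$, $\partial_-B=B_{k-1}$. A superscript $*$ denotes the formal adjoint with respect to the $L^2$ inner product of $g$ (for $\partial_-$, $\partial_-^*:P^{k}\to P^{k+1}$). Let $\rho$ be a boundary defining function: $\rho<0$ on the interior of $M$, $\rho=0$ exactly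 on $\partial M$, $|\nabla\rho|=1$ on $\partial M$. Boundary conditions: $\eta\in D$ iff $d(\rho\eta)|_{\partial M}=0$; $\eta\in JD$ iff $d^{\Lambda*}(\rho\eta)|_{\partial M}=0$; $\eta\in D_+$ iff $\partial_+(\rho\eta)|_{\partial M}=0$; $\eta\in N_-$ iff $\partial_-^*(\rho\eta)|_{\partial M}=0$. Here $|_{\partial M}$ means evaluating the form at points of $\partial M$ (not pulling it back). A subscript on a space denotes the subspace of forms satisfying that condition. *)

theory Defs
  imports "HOL-Analysis.Analysis" "HOL-Library.Function_Algebras"
begin

section \<open>Exterior algebra of a Euclidean space\<close>

text \<open>
  A possibly inhomogeneous element of the exterior algebra of the dual of \<open>'v\<close> is a
  function on lists of vectors whose restriction to the lists of each fixed length is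
  multilinear and alternating. A homogeneous element of degree \<open>k\<close> vanishes on
  lists of any other length. Degrees are integers, so that there is only the zero
  form in negative degree. The linear structure is the pointwise one from
  \<open>Function_Algebras\<close>.
\<close>

definition alternating :: "('v::real_vector list \<Rightarrow> real) \<Rightarrow> bool" where
  "alternating \<alpha> \<longleftrightarrow>
     (\<forall>us vs. linear (\<lambda>x. \<alpha> (us @ x # vs))) \<and>
     (\<forall>us vs ws x. \<alpha> (us @ x # vs @ x # ws) = 0)"

definition alt_forms :: "int \<Rightarrow> ('v::real_vector list \<Rightarrow> real) set" where
  "alt_forms k = {\<alpha>. alternating \<alpha> \<and> (\<forall>vs. int (length vs) \<noteq> k \<longrightarrow> \<alpha> vs = 0)}"

text \<open>
  The shuffle formula without normalizing factor, so \<open>(\<alpha> \<and> \<beta>)(u, v) =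
  \<alpha>(u) \<beta>(v) - \<alpha>(v) \<beta>(u)\<close> on covectors. The exponent counts the inversions of the
  shuffle that lists the positions in \<open>I\<close> first.
\<close>

definition wedge ::
  "('v list \<Rightarrow> real) \<Rightarrow> ('v list \<Rightarrow> real) \<Rightarrow> 'v list \<Rightarrow> real" where
  "wedge \<alpha> \<beta> vs =
     (\<Sum>I\<in>Pow {..<length vs}.
        (-1) ^ card {(i, j). i \<in> I \<and> j < i \<and> j \<notin> I} * \<alpha> (nths vs I) * \<beta> (nths vs (- I)))"

definition orthonormal_frame ::
  "(real ^ 'm \<Rightarrow> real ^ 'm \<Rightarrow> real) \<Rightarrow> (real ^ 'm) list \<Rightarrow> bool" where
  "orthonormal_frame h es \<longleftrightarrow> length es = CARD('m) \<and>
     (\<forall>i<length es. \<forall>j<length es. h (es ! i) (es ! j) = (if i = j then 1 else 0))"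

text \<open>
  The inner product induced by \<open>h\<close> on the exterior algebra, in which the products
  \<open>e\<^sup>i \<and> \<dots> \<and> e\<^sup>j\<close> with increasing indices, taken from the coframe dual to an orthonormal frame,
  are orthonormal. It does not depend on the frame.
\<close>

definition ext_inner ::
  "(real ^ 'm \<Rightarrow> real ^ 'm \<Rightarrow> real) \<Rightarrow>
   ((real ^ 'm) list \<Rightarrow> real) \<Rightarrow> ((real ^ 'm) list \<Rightarrow> real) \<Rightarrow> real" where
  "ext_inner h \<alpha> \<beta> =
     (let es = SOME es. orthonormal_frame h es
      in \<Sum>I\<in>Pow {..<CARD('m)}. \<alpha> (nths es I) * \<beta> (nths es I))"

text \<open>
  The dual of \<open>\<gamma> \<mapsto> w \<and> \<gamma>\<close> with respect to \<open>h\<close>. For the symplectic form \<open>w\<close> and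
  the metric \<open>h\<close> of a compatible triple in dimension \<open>2n\<close> one has
  \<open>\<bar>w\<bar>\<^sup>2 = n\<close>, and \<open>[\<Lambda>, L]\<close> is multiplication by \<open>n - k\<close> in degree \<open>k\<close>.
\<close>

definition dual_lefschetz_pt ::
  "((real ^ 'm) list \<Rightarrow> real) \<Rightarrow> (real ^ 'm \<Rightarrow> real ^ 'm \<Rightarrow> real) \<Rightarrow>
   ((real ^ 'm) list \<Rightarrow> real) \<Rightarrow> (real ^ 'm) list \<Rightarrow> real" where
  "dual_lefschetz_pt w h \<alpha> =
     (THE \<beta>. alternating \<beta> \<and>
        (\<forall>\<gamma>. alternating \<gamma> \<longrightarrow> ext_inner h \<beta> \<gamma> = ext_inner h \<alpha> (wedge w \<gamma>)))"


section \<open>Smooth manifolds with boundary\<close>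

text \<open>For open \<open>S\<close> this says that \<open>f\<close> is of class \<open>C\<^sup>k\<close> on \<open>S\<close>.\<close>

primrec Ck_on ::
  "nat \<Rightarrow> ('v::euclidean_space \<Rightarrow> 'w::real_normed_vector) \<Rightarrow> 'v set \<Rightarrow> bool" where
  "Ck_on 0 = (\<lambda>f S. continuous_on S f)"
| "Ck_on (Suc k) = (\<lambda>f S. (\<forall>x\<in>S. f differentiable (at x)) \<and>
     (\<forall>v. Ck_on k (\<lambda>x. frechet_derivative f (at x) v) S))"

text \<open>On a set that need not be open, smooth means locally extendable to a smooth function.\<close>

definition smooth_on ::
  "'v set \<Rightarrow> ('v::euclidean_space \<Rightarrow> 'w::real_normed_vector) \<Rightarrow> bool" where
  "smooth_on S f \<longleftrightarrow>
     (\<forall>x\<in>S. \<exists>U F. open U \<and> x \<in> U \<and> (\<forall>k. Ck_on k F U) \<and> (\<forall>y\<in>S \<inter> U. F y = f y))"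

definition bdry_coord :: "'m::finite" where
  "bdry_coord = (SOME i. True)"

definition half_space :: "(real ^ 'm::finite) set" where
  "half_space = {x. 0 \<le> x $ bdry_coord}"

text \<open>A chart is its domain together with a map that is only relevant on that domain.\<close>

type_synonym ('a, 'm) chart = "'a set \<times> ('a \<Rightarrow> real ^ 'm)"

type_synonym ('a, 'm) atlas = "('a, 'm) chart set"

abbreviation chart_dom :: "('a, 'm::finite) chart \<Rightarrow> 'a set" where
  "chart_dom c \<equiv> fst c"

abbreviation chart_img :: "('a, 'm::finite) chart \<Rightarrow> (real ^ 'm) set" where
  "chart_img c \<equiv> snd c ` fst c"

abbreviation chart_inv :: "('a, 'm::finite) chart \<Rightarrow> real ^ 'm \<Rightarrow> 'a" where
  "chart_inv c \<equiv> inv_into (fst c) (snd c)"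

definition manifold_with_boundary :: "'a topology \<Rightarrow> ('a, 'm::finite) atlas \<Rightarrow> bool" where
  "manifold_with_boundary X A \<longleftrightarrow>
     Hausdorff_space X \<and> second_countable X \<and> (\<Union>c\<in>A. chart_dom c) = topspace X \<and>
     (\<forall>c\<in>A. openin X (chart_dom c) \<and>
        openin (top_of_set half_space) (chart_img c) \<and>
        homeomorphic_map (subtopology X (chart_dom c)) (top_of_set (chart_img c)) (snd c)) \<and>
     (\<forall>c\<in>A. \<forall>c'\<in>A. smooth_on (snd c ` (chart_dom c \<inter> chart_dom c')) (snd c' \<circ> chart_inv c))"

definition mfd_boundary :: "('a, 'm::finite) atlas \<Rightarrow> 'a set" where
  "mfd_boundary A = {p. \<exists>c\<in>A. p \<in> chart_dom c \<and> snd c p $ bdry_coord = 0}"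

text \<open>
  Derivative of the change of coordinates from \<open>c\<close> to \<open>c'\<close>. Also at boundary points the
  derivative within the relatively open subset of the half space is unique.
\<close>

definition transition_deriv ::
  "('a, 'm::finite) chart \<Rightarrow> ('a, 'm) chart \<Rightarrow> 'a \<Rightarrow> real ^ 'm \<Rightarrow> real ^ 'm" where
  "transition_deriv c c' p =
     frechet_derivative (snd c' \<circ> chart_inv c)
       (at (snd c p) within snd c ` (chart_dom c \<inter> chart_dom c'))"

definition smooth_function :: "('a, 'm::finite) atlas \<Rightarrow> ('a \<Rightarrow> real) \<Rightarrow> bool" where
  "smooth_function A f \<longleftrightarrow> (\<forall>c\<in>A. smooth_on (chart_img c) (f \<circ> chart_inv c))"


section \<open>Tensor fields\<close>

text \<open>
  A tensor at a point is given by its expressions in all charts around that point, which are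
  related by the derivatives of the coordinate changes. Thus \<open>\<eta> p c vs\<close> is the value of the form
  \<open>\<eta>\<close> at \<open>p\<close> on the tangent vectors with components \<open>vs\<close> in the chart \<open>c\<close>; by
  convention it is zero if \<open>c\<close> is not a chart around \<open>p\<close>.
\<close>

type_synonym ('a, 'm) form = "'a \<Rightarrow> ('a, 'm) chart \<Rightarrow> (real ^ 'm) list \<Rightarrow> real"

type_synonym ('a, 'm) metric = "'a \<Rightarrow> ('a, 'm) chart \<Rightarrow> real ^ 'm \<Rightarrow> real ^ 'm \<Rightarrow> real"

type_synonym ('a, 'm) endo = "'a \<Rightarrow> ('a, 'm) chart \<Rightarrow> real ^ 'm \<Rightarrow> real ^ 'm"

definition Omega :: "('a, 'm::finite) atlas \<Rightarrow> int \<Rightarrow> ('a, 'm) form set" where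
  "Omega A k = {\<eta>.
     (\<forall>p c. \<not> (c \<in> A \<and> p \<in> chart_dom c) \<longrightarrow> \<eta> p c = 0) \<and>
     (\<forall>c\<in>A. \<forall>p\<in>chart_dom c. \<eta> p c \<in> alt_forms k) \<and>
     (\<forall>c\<in>A. \<forall>c'\<in>A. \<forall>p\<in>chart_dom c \<inter> chart_dom c'. \<forall>vs.
        \<eta> p c' (map (transition_deriv c c' p) vs) = \<eta> p c vs) \<and>
     (\<forall>c\<in>A. \<forall>vs. smooth_on (chart_img c) (\<lambda>x. \<eta> (chart_inv c x) c vs))}"

definition riemannian_metric :: "('a, 'm::finite) atlas \<Rightarrow> ('a, 'm) metric \<Rightarrow> bool" where
  "riemannian_metric A g \<longleftrightarrow>
     (\<forall>c\<in>A. \<forall>p\<in>chart_dom c.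
        bilinear (g p c) \<and> (\<forall>u v. g p c u v = g p c v u) \<and> (\<forall>u. u \<noteq> 0 \<longrightarrow> 0 < g p c u u)) \<and>
     (\<forall>c\<in>A. \<forall>c'\<in>A. \<forall>p\<in>chart_dom c \<inter> chart_dom c'. \<forall>u v.
        g p c' (transition_deriv c c' p u) (transition_deriv c c' p v) = g p c u v) \<and>
     (\<forall>c\<in>A. \<forall>u v. smooth_on (chart_img c) (\<lambda>x. g (chart_inv c x) c u v))"

definition almost_complex :: "('a, 'm::finite) atlas \<Rightarrow> ('a, 'm) endo \<Rightarrow> bool" where
  "almost_complex A J \<longleftrightarrow>
     (\<forall>c\<in>A. \<forall>p\<in>chart_dom c. linear (J p c) \<and> (\<forall>u. J p c (J p c u) = - u)) \<and>
     (\<forall>c\<in>A. \<forall>c'\<in>A. \<forall>p\<in>chart_dom c \<inter> chart_dom c'. \<forall>u.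
        J p c' (transition_deriv c c' p u) = transition_deriv c c' p (J p c u)) \<and>
     (\<forall>c\<in>A. \<forall>u. smooth_on (chart_img c) (\<lambda>x. J (chart_inv c x) c u))"

definition ext_d :: "('a, 'm::finite) atlas \<Rightarrow> ('a, 'm) form \<Rightarrow> ('a, 'm) form" where
  "ext_d A \<eta> = (\<lambda>p c vs.
     if c \<in> A \<and> p \<in> chart_dom c
     then \<Sum>i<length vs. (-1) ^ i *
            frechet_derivative (\<lambda>x. \<eta> (chart_inv c x) c (nths vs (- {i})))
              (at (snd c p) within chart_img c) (vs ! i)
     else 0)"

definition fun_scale :: "('a \<Rightarrow> real) \<Rightarrow> ('a, 'm::finite) form \<Rightarrow> ('a, 'm) form" where
  "fun_scale f \<eta> = (\<lambda>p c vs. f p * \<eta> p c vs)"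

text \<open>Vanishing at the points of the boundary, not vanishing of the pullback to the boundary.\<close>

definition zero_on_boundary :: "('a, 'm::finite) atlas \<Rightarrow> ('a, 'm) form \<Rightarrow> bool" where
  "zero_on_boundary A \<eta> \<longleftrightarrow> (\<forall>p\<in>mfd_boundary A. \<eta> p = 0)"

definition interior_supported ::
  "'a topology \<Rightarrow> ('a, 'm::finite) atlas \<Rightarrow> ('a, 'm) form \<Rightarrow> bool" where
  "interior_supported X A \<eta> \<longleftrightarrow>
     compactin X (X closure_of {p \<in> topspace X. \<eta> p \<noteq> 0}) \<and>
     X closure_of {p \<in> topspace X. \<eta> p \<noteq> 0} \<inter> mfd_boundary A = {}"


section \<open>The \<open>L\<^sup>2\<close> inner product and formal adjoints\<close>

definition riemannian_volume ::
  "'a topology \<Rightarrow> ('a, 'm::finite) atlas \<Rightarrow> ('a, 'm) metric \<Rightarrow> 'a measure" where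
  "riemannian_volume X A g =
     (THE \<mu>. space \<mu> = topspace X \<and> sets \<mu> = sigma_sets (topspace X) {U. openin X U} \<and>
        (\<forall>c\<in>A. \<forall>B\<in>sets \<mu>. B \<subseteq> chart_dom c \<longrightarrow>
           emeasure \<mu> B =
             (\<integral>\<^sup>+x\<in>snd c ` B. ennreal (sqrt (det
                (\<chi> i j. g (chart_inv c x) c (axis i 1) (axis j 1)))) \<partial>lborel)))"

definition form_inner ::
  "('a, 'm::finite) atlas \<Rightarrow> ('a, 'm) metric \<Rightarrow> ('a, 'm) form \<Rightarrow> ('a, 'm) form \<Rightarrow> 'a \<Rightarrow> real" where
  "form_inner A g \<eta> \<zeta> p =
     (let c = SOME c. c \<in> A \<and> p \<in> chart_dom c in ext_inner (g p c) (\<eta> p c) (\<zeta> p c))"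

definition L2_inner ::
  "'a topology \<Rightarrow> ('a, 'm::finite) atlas \<Rightarrow> ('a, 'm) metric \<Rightarrow>
   ('a, 'm) form \<Rightarrow> ('a, 'm) form \<Rightarrow> real" where
  "L2_inner X A g \<eta> \<zeta> = (\<integral>p. form_inner A g \<eta> \<zeta> p \<partial>riemannian_volume X A g)"

text \<open>
  \<open>S\<close> is the formal adjoint of the operator \<open>T\<close> from \<open>V\<close> to \<open>W\<close>, tested
  against forms supported in the interior. For the differential operators used below a formal adjoint
  exists by integration by parts, and its values on \<open>W\<close> are unique because forms are smooth
  up to the boundary. A condition on the formal adjoint is therefore stated as: some formal adjoint
  \<open>S\<close> satisfies it.
\<close>

definition is_formal_adjoint ::
  "'a topology \<Rightarrow> ('a, 'm::finite) atlas \<Rightarrow> ('a, 'm) metric \<Rightarrow>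
   ('a, 'm) form set \<Rightarrow> ('a, 'm) form set \<Rightarrow>
   (('a, 'm) form \<Rightarrow> ('a, 'm) form) \<Rightarrow> (('a, 'm) form \<Rightarrow> ('a, 'm) form) \<Rightarrow> bool" where
  "is_formal_adjoint X A g V W T S \<longleftrightarrow>
     (\<forall>\<eta>\<in>W. S \<eta> \<in> V) \<and>
     (\<forall>u\<in>V. \<forall>\<eta>\<in>W. interior_supported X A u \<longrightarrow>
        L2_inner X A g (T u) \<eta> = L2_inner X A g u (S \<eta>))"


section \<open>Symplectic structures and primitive forms\<close>

definition symplectic_form :: "('a, 'm::finite) atlas \<Rightarrow> ('a, 'm) form \<Rightarrow> bool" where
  "symplectic_form A \<omega> \<longleftrightarrow> \<omega> \<in> Omega A 2 \<and> ext_d A \<omega> = 0 \<and>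
     (\<forall>c\<in>A. \<forall>p\<in>chart_dom c. \<forall>u. (\<forall>v. \<omega> p c [u, v] = 0) \<longrightarrow> u = 0)"

definition compatible_triple ::
  "('a, 'm::finite) atlas \<Rightarrow> ('a, 'm) form \<Rightarrow> ('a, 'm) endo \<Rightarrow> ('a, 'm) metric \<Rightarrow> bool" where
  "compatible_triple A \<omega> J g \<longleftrightarrow>
     symplectic_form A \<omega> \<and> almost_complex A J \<and> riemannian_metric A g \<and>
     (\<forall>c\<in>A. \<forall>p\<in>chart_dom c. \<forall>u v. g p c u v = \<omega> p c [u, J p c v])"

definition lefschetz :: "('a, 'm::finite) form \<Rightarrow> ('a, 'm) form \<Rightarrow> ('a, 'm) form" where
  "lefschetz \<omega> \<eta> = (\<lambda>p c. wedge (\<omega> p c) (\<eta> p c))"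

definition dual_lefschetz ::
  "('a, 'm::finite) atlas \<Rightarrow> ('a, 'm) form \<Rightarrow> ('a, 'm) metric \<Rightarrow>
   ('a, 'm) form \<Rightarrow> ('a, 'm) form" where
  "dual_lefschetz A \<omega> g \<eta> = (\<lambda>p c.
     if c \<in> A \<and> p \<in> chart_dom c then dual_lefschetz_pt (\<omega> p c) (g p c) (\<eta> p c) else 0)"

definition d_Lambda ::
  "('a, 'm::finite) atlas \<Rightarrow> ('a, 'm) form \<Rightarrow> ('a, 'm) metric \<Rightarrow>
   ('a, 'm) form \<Rightarrow> ('a, 'm) form" where
  "d_Lambda A \<omega> g \<eta> =
     ext_d A (dual_lefschetz A \<omega> g \<eta>) - dual_lefschetz A \<omega> g (ext_d A \<eta>)"

definition primitive_forms ::
  "('a, 'm::finite) atlas \<Rightarrow> ('a, 'm) form \<Rightarrow> ('a, 'm) metric \<Rightarrow> int \<Rightarrow> ('a, 'm) form set" where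
  "primitive_forms A \<omega> g k = {\<eta> \<in> Omega A k. dual_lefschetz A \<omega> g \<eta> = 0}"

definition prim_proj ::
  "('a, 'm::finite) atlas \<Rightarrow> ('a, 'm) form \<Rightarrow> ('a, 'm) metric \<Rightarrow> int \<Rightarrow>
   ('a, 'm) form \<Rightarrow> ('a, 'm) form" where
  "prim_proj A \<omega> g k \<eta> =
     (THE p. p \<in> primitive_forms A \<omega> g k \<and> (\<exists>\<beta>\<in>Omega A (k - 2). \<eta> = p + lefschetz \<omega> \<beta>))"

definition d_decomposition ::
  "('a, 'm::finite) atlas \<Rightarrow> ('a, 'm) form \<Rightarrow> ('a, 'm) metric \<Rightarrow> int \<Rightarrow>
   ('a, 'm) form \<Rightarrow> ('a, 'm) form \<Rightarrow> ('a, 'm) form \<Rightarrow> bool" where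
  "d_decomposition A \<omega> g k B B1 B2 \<longleftrightarrow>
     B1 \<in> primitive_forms A \<omega> g (k + 1) \<and> B2 \<in> primitive_forms A \<omega> g (k - 1) \<and>
     (2 * k = int CARD('m) \<longrightarrow> B1 = 0) \<and>
     ext_d A B = B1 + lefschetz \<omega> B2"

definition d_plus ::
  "('a, 'm::finite) atlas \<Rightarrow> ('a, 'm) form \<Rightarrow> ('a, 'm) metric \<Rightarrow> int \<Rightarrow>
   ('a, 'm) form \<Rightarrow> ('a, 'm) form" where
  "d_plus A \<omega> g k B = (THE B1. \<exists>B2. d_decomposition A \<omega> g k B B1 B2)"

definition d_minus ::
  "('a, 'm::finite) atlas \<Rightarrow> ('a, 'm) form \<Rightarrow> ('a, 'm) metric \<Rightarrow> int \<Rightarrow>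
   ('a, 'm) form \<Rightarrow> ('a, 'm) form" where
  "d_minus A \<omega> g k B = (THE B2. \<exists>B1. d_decomposition A \<omega> g k B B1 B2)"


section \<open>Boundary conditions\<close>

text \<open>\<open>w\<close> in the last clause is the gradient of \<open>\<rho>\<close>, expressed in the chart \<open>c\<close>.\<close>

definition boundary_defining ::
  "'a topology \<Rightarrow> ('a, 'm::finite) atlas \<Rightarrow> ('a, 'm) metric \<Rightarrow> ('a \<Rightarrow> real) \<Rightarrow> bool" where
  "boundary_defining X A g \<rho> \<longleftrightarrow> smooth_function A \<rho> \<and>
     (\<forall>p\<in>topspace X - mfd_boundary A. \<rho> p < 0) \<and>
     (\<forall>p\<in>mfd_boundary A. \<rho> p = 0) \<and>
     (\<forall>c\<in>A. \<forall>p\<in>chart_dom c \<inter> mfd_boundary A.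
        \<exists>w. (\<forall>v. g p c w v =
               frechet_derivative (\<rho> \<circ> chart_inv c) (at (snd c p) within chart_img c) v) \<and>
            sqrt (g p c w w) = 1)"

definition Omega_D ::
  "('a, 'm::finite) atlas \<Rightarrow> ('a \<Rightarrow> real) \<Rightarrow> int \<Rightarrow> ('a, 'm) form set" where
  "Omega_D A \<rho> k = {\<eta> \<in> Omega A k. zero_on_boundary A (ext_d A (fun_scale \<rho> \<eta>))}"

definition Omega_JD ::
  "'a topology \<Rightarrow> ('a, 'm::finite) atlas \<Rightarrow> ('a, 'm) form \<Rightarrow> ('a, 'm) metric \<Rightarrow>
   ('a \<Rightarrow> real) \<Rightarrow> int \<Rightarrow> ('a, 'm) form set" where
  "Omega_JD X A \<omega> g \<rho> k = {\<eta> \<in> Omega A k.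
     \<exists>S. is_formal_adjoint X A g (Omega A (k + 1)) (Omega A k) (d_Lambda A \<omega> g) S \<and>
         zero_on_boundary A (S (fun_scale \<rho> \<eta>))}"

definition P_Dplus ::
  "('a, 'm::finite) atlas \<Rightarrow> ('a, 'm) form \<Rightarrow> ('a, 'm) metric \<Rightarrow>
   ('a \<Rightarrow> real) \<Rightarrow> int \<Rightarrow> ('a, 'm) form set" where
  "P_Dplus A \<omega> g \<rho> k = {B \<in> primitive_forms A \<omega> g k.
     zero_on_boundary A (d_plus A \<omega> g k (fun_scale \<rho> B))}"

definition P_Nminus ::
  "'a topology \<Rightarrow> ('a, 'm::finite) atlas \<Rightarrow> ('a, 'm) form \<Rightarrow> ('a, 'm) metric \<Rightarrow>
   ('a \<Rightarrow> real) \<Rightarrow> int \<Rightarrow> ('a, 'm) form set" where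
  "P_Nminus X A \<omega> g \<rho> k = {B \<in> primitive_forms A \<omega> g k.
     \<exists>S. is_formal_adjoint X A g (primitive_forms A \<omega> g (k + 1)) (primitive_forms A \<omega> g k)
           (d_minus A \<omega> g (k + 1)) S \<and>
         zero_on_boundary A (S (fun_scale \<rho> B))}"

end

(*
  Write \<eta> = B + L\<beta> with B = \<pi>(\<eta>).

  If d(\<rho>\<eta>) vanishes at a boundary point, then there 0 = \<partial>\<^sub>+(\<rho>B) + L(\<partial>\<^sub>-(\<rho>B) + d(\<rho>\<beta>)), because L commutes
  with d; primitive forms are orthogonal to the image of L, so \<partial>\<^sub>+(\<rho>B) = 0.

  For the adjoints, d\<^sup>\<Lambda>u = -(n - k) \<partial>\<^sub>-u for primitive u of degree k + 1. Hence, up to this factor, \<pi> after an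
  adjoint of d\<^sup>\<Lambda> is an adjoint of \<partial>\<^sub>-, and its value at \<rho>B can be read off at \<rho>\<eta>, since \<rho>\<eta> - \<rho>B = L(\<rho>\<beta>) is
  orthogonal to the primitive forms \<partial>\<^sub>-u.

  That the projections and \<partial>\<^sub>+, \<partial>\<^sub>- exist on smooth forms rests on the sl(2) relation for \<Lambda> and L, on the
  smoothness of \<Lambda> (contraction with the inverse of \<omega>), and on \<pi> being an explicit polynomial in L and \<Lambda>.
*)
theory Submission
  imports Defs
begin

section \<open>Contraction and the wedge product\<close>

text \<open>That \<open>dB\<close> has only two components for primitive \<open>B\<close> of degree
  \<open>j\<close> is a count of powers of \<open>L\<close>. The power \<open>L^(n-j+1)\<close>
  kills \<open>B\<close>, hence also \<open>dB\<close>, because \<open>d\<close> and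
  \<open>L\<close> commute; injectivity of powers of \<open>L\<close> (hard Lefschetz) then leaves
  no room for a third component. This is expressed as \<Lambda>(\<Lambda>(dB)) = 0, after which
  \<open>\<partial>\<^sub>-B\<close> is a constant multiple of \<Lambda>(dB). The argument takes
  place in one tangent space at a time, where the inner product is positive.

  Forms are functions on lists of vectors, so the exterior algebra is developed by induction on the
  argument list: contraction with the head is an antiderivation of the wedge product, and it turns
  the formula for \<open>d\<close> into a recursion.

  At boundary points all derivatives are one-sided. Their uniqueness comes from the shape of the
  half space, their smoothness and symmetry from local smooth extensions.

  The bound \<open>k < n\<close> makes \<open>n - k\<close> invertible, and it keeps degree
  \<open>k + 1\<close>, where \<open>\<partial>\<^sub>-\<close> and the adjoints live, within the
  range in which \<open>d\<close> of a primitive form decomposes.\<close>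

definition contract :: "'v \<Rightarrow> ('v list \<Rightarrow> real) \<Rightarrow> 'v list \<Rightarrow> real" where
  "contract v \<alpha> vs = \<alpha> (v # vs)"

text \<open>The grade involution. It supplies the sign of the antiderivation rule without mention of
  a degree, so that the rule also holds for inhomogeneous forms.\<close>

definition grade_inv :: "('v list \<Rightarrow> real) \<Rightarrow> 'v list \<Rightarrow> real" where
  "grade_inv \<alpha> vs = (-1) ^ length vs * \<alpha> vs"

definition fscale :: "real \<Rightarrow> ('b \<Rightarrow> real) \<Rightarrow> 'b \<Rightarrow> real" where
  "fscale r \<alpha> vs = r * \<alpha> vs"

text \<open>Subsets are sorted by whether they contain \<open>0\<close>, the position of the head of
  a list. This turns sums over sublists into recursions over the list.\<close>

lemma sum_Pow_lessThan_Suc: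
  fixes F :: "nat set \<Rightarrow> 'b::comm_monoid_add"
  shows "(\<Sum>I\<in>Pow {..<Suc m}. F I) =
    (\<Sum>I\<in>Pow {..<m}. F (Suc ` I)) + (\<Sum>I\<in>Pow {..<m}. F (insert 0 (Suc ` I)))"
proof -
  have eq: "Pow {..<Suc m} = (`) Suc ` Pow {..<m} \<union> (\<lambda>I. insert 0 (Suc ` I)) ` Pow {..<m}"
    unfolding lessThan_Suc_eq_insert_0 Pow_insert image_Pow_surj[OF refl, symmetric]
    by (simp add: image_image)
  have disj: "(`) Suc ` Pow {..<m} \<inter> (\<lambda>I. insert 0 (Suc ` I)) ` Pow {..<m} = {}"
    by auto
  have inj1: "inj_on ((`) Suc) (Pow {..<m})"
    by (simp add: inj_on_def inj_image_eq_iff)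
  have "Suc ` I = Suc ` K" if "insert 0 (Suc ` I) = insert 0 (Suc ` K)" for I K
    using that by (metis Diff_insert_absorb image_iff nat.distinct(1))
  then have inj2: "inj_on (\<lambda>I. insert 0 (Suc ` I)) (Pow {..<m})"
    by (metis (no_types, lifting) inj_Suc inj_image_eq_iff inj_onI)
  show ?thesis
    unfolding eq by (subst sum.union_disjoint) (auto simp: sum.reindex[OF inj1] sum.reindex[OF inj2] disj)
qed

lemma wedge_Nil [simp]: "wedge \<alpha> \<beta> [] = \<alpha> [] * \<beta> []"
  by (simp add: wedge_def)

text \<open>The antiderivation rule for contraction with \<open>v\<close>. If \<open>v\<close> goes
  to the first factor, position \<open>0\<close> takes part in no inversion. If it goes to the
  second, it forms an inversion with every element of \<open>I\<close>, and the resulting sign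
  \<open>(-1) ^ card I\<close> is absorbed by \<open>grade_inv \<alpha>\<close>.\<close>

lemma wedge_Cons:
  "wedge \<alpha> \<beta> (v # vs) =
     wedge (contract v \<alpha>) \<beta> vs + wedge (grade_inv \<alpha>) (contract v \<beta>) vs"
proof -
  let ?inv = "\<lambda>I. {(i, j). i \<in> I \<and> j < i \<and> j \<notin> (I :: nat set)}"
  have card0: "card (?inv (insert 0 (Suc ` I))) = card (?inv I)" for I
  proof -
    have "?inv (insert 0 (Suc ` I)) = map_prod Suc Suc ` ?inv I"
      by (auto simp: image_iff less_Suc_eq_0_disj) (metis Suc_less_eq not0_implies_Suc)
    then show ?thesis
      by (simp only:) (rule card_image, auto simp: inj_on_def)
  qed
  have card1: "card (?inv (Suc ` I)) = card (?inv I) + card I" if "I \<subseteq> {..<m}" for I m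
  proof -
    have fin: "finite I" using that finite_subset by blast
    have "?inv I \<subseteq> I \<times> {..<m}" using that by force
    then have fin2: "finite (?inv I)"
      by (rule finite_subset) (use fin in auto)
    have "?inv (Suc ` I) = map_prod Suc Suc ` ?inv I \<union> (\<lambda>i. (Suc i, 0)) ` I"
      by (auto simp: image_iff less_Suc_eq_0_disj) (metis Suc_less_eq not0_implies_Suc)
    moreover have "map_prod Suc Suc ` ?inv I \<inter> (\<lambda>i. (Suc i, 0)) ` I = {}"
      by auto
    moreover have "card ((\<lambda>i. (Suc i, 0::nat)) ` I) = card I"
      by (rule card_image) (simp add: inj_on_def)
    moreover have "card (map_prod Suc Suc ` ?inv I) = card (?inv I)"
      by (rule card_image) (auto simp: inj_on_def)
    ultimately show ?thesis
      using fin fin2 by (simp add: card_Un_disjoint)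
  qed
  have n1: "nths (v # vs) (Suc ` I) = nths vs I"
    and n2: "nths (v # vs) (- Suc ` I) = v # nths vs (- I)"
    and n3: "nths (v # vs) (insert 0 (Suc ` I)) = v # nths vs I"
    and n4: "nths (v # vs) (- insert 0 (Suc ` I)) = nths vs (- I)" for I
    by (auto simp: nths_Cons image_iff Collect_neg_eq intro!: arg_cong[of _ _ "nths vs"])
  have len: "length (nths vs I) = card I" if "I \<subseteq> {..<length vs}" for I
    using that by (auto simp: length_nths intro!: arg_cong[of _ _ card])
  show ?thesis
    unfolding wedge_def list.size add_0_right add_Suc_right sum_Pow_lessThan_Suc n1 n2 n3 n4 card0
    by (subst add.commute, rule arg_cong2[of _ _ _ _ "(+)"]; rule sum.cong)
      (auto simp: contract_def grade_inv_def card1 len power_add)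
qed

section \<open>Alternating multilinear functions\<close>

definition multilin :: "('v::real_vector list \<Rightarrow> real) \<Rightarrow> bool" where
  "multilin \<alpha> \<longleftrightarrow> (\<forall>us vs. linear (\<lambda>x. \<alpha> (us @ x # vs)))"

lemma alternating_multilin: "alternating \<alpha> \<Longrightarrow> multilin \<alpha>"
  by (simp add: alternating_def multilin_def)

lemma multilin_linear: "multilin \<alpha> \<Longrightarrow> linear (\<lambda>x. \<alpha> (us @ x # vs))"
  by (simp add: multilin_def)

lemma adjacent_swap:
  assumes lin: "multilin \<alpha>" and adj: "\<And>us vs x. \<alpha> (us @ x # x # vs) = 0"
  shows "\<alpha> (us @ x # y # vs) = - \<alpha> (us @ y # x # vs)"
proof -
  have 1: "linear (\<lambda>z. \<alpha> (us @ z # (x + y) # vs))" "linear (\<lambda>z. \<alpha> (us @ x # z # vs))"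
       "linear (\<lambda>z. \<alpha> (us @ y # z # vs))"
    using multilin_linear[OF lin, of us] multilin_linear[OF lin, of "us @ [x]"]
      multilin_linear[OF lin, of "us @ [y]"] by auto
  have "0 = \<alpha> (us @ (x + y) # (x + y) # vs)" by (simp only: adj)
  also have "\<dots> = \<alpha> (us @ x # x # vs) + \<alpha> (us @ x # y # vs) +
      (\<alpha> (us @ y # x # vs) + \<alpha> (us @ y # y # vs))"
    by (simp only: linear_add[OF 1(1)] linear_add[OF 1(2)] linear_add[OF 1(3)])
  finally show ?thesis by (simp add: adj)
qed

text \<open>Equal arguments at a distance are brought together by exchanging neighbours. In
  inductions over lists only the adjacent case has to be checked.\<close>

lemma alternating_iff_adjacent:
  "alternating \<alpha> \<longleftrightarrow> multilin \<alpha> \<and> (\<forall>us vs x. \<alpha> (us @ x # x # vs) = 0)"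
proof safe
  assume "alternating \<alpha>"
  then show "multilin \<alpha>" and "\<alpha> (us @ x # x # vs) = 0" for us vs x
    unfolding alternating_def multilin_def by (simp, metis append_Nil)
next
  assume lin: "multilin \<alpha>" and adj: "\<forall>us vs x. \<alpha> (us @ x # x # vs) = 0"
  note swap = adjacent_swap[OF lin adj[rule_format]]
  have "\<alpha> (us @ x # vs @ x # ws) = 0" for us x vs ws
  proof (induction vs arbitrary: us)
    case Nil
    then show ?case using adj by simp
  next
    case (Cons v vs)
    have "\<alpha> (us @ x # (v # vs) @ x # ws) = - \<alpha> ((us @ [v]) @ x # vs @ x # ws)"
      using swap[of us x v "vs @ x # ws"] by simp
    then show ?case using Cons.IH[of "us @ [v]"] by simp
  qed
  then show "alternating \<alpha>"
    using lin by (simp add: alternating_def multilin_def)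
qed

lemma alternatingI:
  "multilin \<alpha> \<Longrightarrow> (\<And>us vs x. \<alpha> (us @ x # x # vs) = 0) \<Longrightarrow> alternating \<alpha>"
  by (simp add: alternating_iff_adjacent)

lemma alternating_adjacent: "alternating \<alpha> \<Longrightarrow> \<alpha> (us @ x # x # vs) = 0"
  by (simp add: alternating_iff_adjacent)

lemma alternating_swap:
  "alternating \<alpha> \<Longrightarrow> \<alpha> (us @ x # y # vs) = - \<alpha> (us @ y # x # vs)"
  by (rule adjacent_swap) (auto simp: alternating_iff_adjacent)

lemma contract_apply: "contract v \<alpha> vs = \<alpha> (v # vs)"
  by (rule contract_def)

lemma contract_Nil_Cons [simp]: "contract v \<alpha> [] = \<alpha> [v]" "contract v \<alpha> (x # vs) = \<alpha> (v # x # vs)"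
  by (simp_all add: contract_def)

lemma contract_add: "contract v (\<alpha> + \<beta>) = contract v \<alpha> + contract v \<beta>"
  and contract_uminus: "contract v (- \<alpha>) = - contract v \<alpha>"
  and contract_zero: "contract v 0 = 0"
  and contract_grade_inv: "contract v (grade_inv \<alpha>) = - grade_inv (contract v \<alpha>)"
  by (auto simp: fun_eq_iff grade_inv_def fscale_def contract_def algebra_simps)

lemma grade_inv_grade_inv [simp]: "grade_inv (grade_inv \<alpha>) = \<alpha>"
  by (simp add: fun_eq_iff grade_inv_def flip: mult.assoc power_mult_distrib)

lemma sum_fun_apply: "sum f I x = (\<Sum>i\<in>I. f i x)"
  by (induction I rule: infinite_finite_induct) auto

lemma wedge_add_left: "wedge (\<alpha> + \<alpha>') \<beta> = wedge \<alpha> \<beta> + wedge \<alpha>' \<beta>"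
  and wedge_add_right: "wedge \<alpha> (\<beta> + \<beta>') = wedge \<alpha> \<beta> + wedge \<alpha> \<beta>'"
  and wedge_diff_left: "wedge (\<alpha> - \<alpha>') \<beta> = wedge \<alpha> \<beta> - wedge \<alpha>' \<beta>"
  and wedge_diff_right: "wedge \<alpha> (\<beta> - \<beta>') = wedge \<alpha> \<beta> - wedge \<alpha> \<beta>'"
  and wedge_uminus_left: "wedge (- \<alpha>) \<beta> = - wedge \<alpha> \<beta>"
  and wedge_uminus_right: "wedge \<alpha> (- \<beta>) = - wedge \<alpha> \<beta>"
  and wedge_fscale_left: "wedge (fscale r \<alpha>) \<beta> = fscale r (wedge \<alpha> \<beta>)"
  and wedge_fscale_right: "wedge \<alpha> (fscale r \<beta>) = fscale r (wedge \<alpha> \<beta>)"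
  and wedge_zero_left [simp]: "wedge 0 \<beta> = 0"
  and wedge_zero_right [simp]: "wedge \<alpha> 0 = 0"
  by (simp_all add: fun_eq_iff wedge_def fscale_def sum_distrib_left
      flip: sum.distrib sum_subtractf sum_negf)
     (auto intro!: sum.cong simp: algebra_simps)

lemma contract_wedge:
  "contract v (wedge \<alpha> \<beta>) = wedge (contract v \<alpha>) \<beta> + wedge (grade_inv \<alpha>) (contract v \<beta>)"
  by (simp add: fun_eq_iff contract_def wedge_Cons)

lemma multilin_contract: "multilin \<alpha> \<Longrightarrow> multilin (contract v \<alpha>)"
  unfolding multilin_def contract_def by (simp flip: append_Cons)

lemma linear_mult_const: "linear f \<Longrightarrow> linear (\<lambda>x. c * f x)" for f :: "'v::real_vector \<Rightarrow> real"
  by (simp add: linear_iff algebra_simps)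

lemma multilin_grade_inv: "multilin \<alpha> \<Longrightarrow> multilin (grade_inv \<alpha>)"
  unfolding multilin_def grade_inv_def length_append list.size
  by (intro allI linear_mult_const) blast

lemma alternating_contract: "alternating \<alpha> \<Longrightarrow> alternating (contract v \<alpha>)"
  using alternating_adjacent[of \<alpha> "v # us" for us]
  by (intro alternatingI) (auto simp: alternating_multilin multilin_contract contract_def)

lemma alternating_grade_inv: "alternating \<alpha> \<Longrightarrow> alternating (grade_inv \<alpha>)"
  by (intro alternatingI)
    (auto simp: alternating_multilin multilin_grade_inv grade_inv_def alternating_adjacent)

lemma alternating_zero [simp]: "alternating 0"
  and alternating_add: "alternating \<alpha> \<Longrightarrow> alternating \<beta> \<Longrightarrow> alternating (\<alpha> + \<beta>)"
  and alternating_diff: "alternating \<alpha> \<Longrightarrow> alternating \<beta> \<Longrightarrow> alternating (\<alpha> - \<beta>)"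
  and alternating_uminus: "alternating \<alpha> \<Longrightarrow> alternating (- \<alpha>)"
  and alternating_fscale: "alternating \<alpha> \<Longrightarrow> alternating (fscale r \<alpha>)"
  by (auto simp: alternating_def fscale_def linear_zero
      intro: linear_compose_add linear_compose_sub linear_compose_neg linear_mult_const)

lemma multilin_add: "multilin \<alpha> \<Longrightarrow> multilin \<beta> \<Longrightarrow> multilin (\<alpha> + \<beta>)"
  by (auto simp: multilin_def intro: linear_compose_add)

lemma alternating_sum: "(\<And>i. i \<in> I \<Longrightarrow> alternating (f i)) \<Longrightarrow> alternating (sum f I)"
  by (induction I rule: infinite_finite_induct) (auto intro: alternating_add)

lemma linear_contract:
  assumes "multilin \<alpha>"
  shows "contract (x + y) \<alpha> = contract x \<alpha> + contract y \<alpha>"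
    and "contract (r *\<^sub>R x) \<alpha> = fscale r (contract x \<alpha>)"
  using multilin_linear[OF assms, of "[]"]
  by (auto simp: fun_eq_iff linear_iff fscale_def contract_def)

lemma multilin_wedge:
  assumes "multilin \<alpha>" "multilin \<beta>"
  shows "multilin (wedge \<alpha> \<beta>)"
proof -
  have "linear (\<lambda>x. wedge \<alpha> \<beta> (us @ x # vs))" for us vs
    using assms
  proof (induction us arbitrary: \<alpha> \<beta>)
    case Nil
    then show ?case
      unfolding linear_iff
      by (auto simp: wedge_Cons linear_contract[OF multilin_grade_inv] linear_contract wedge_add_left wedge_add_right
          wedge_fscale_left wedge_fscale_right fscale_def algebra_simps)
  next
    case (Cons u us)
    show ?case
      using Cons.IH[of "contract u \<alpha>" \<beta>] Cons.IH[of "grade_inv \<alpha>" "contract u \<beta>"] Cons.prems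
      by (auto simp: wedge_Cons multilin_contract multilin_grade_inv intro!: linear_compose_add)
  qed
  then show ?thesis by (simp add: multilin_def)
qed

lemma contract_contract_self: "alternating \<alpha> \<Longrightarrow> contract x (contract x \<alpha>) = 0"
  using alternating_adjacent[of \<alpha> "[]"] by (auto simp: fun_eq_iff contract_def)

lemma contract_contract_swap:
  "alternating \<alpha> \<Longrightarrow> contract x (contract y \<alpha>) = - contract y (contract x \<alpha>)"
proof
  assume "alternating \<alpha>"
  then show "contract x (contract y \<alpha>) vs = (- contract y (contract x \<alpha>)) vs" for vs
    unfolding contract_def uminus_apply by (rule alternating_swap[of \<alpha> "[]", unfolded append_Nil])
qed

text \<open>Contracting twice with \<open>x\<close> leaves only the two mixed terms, which cancel
  because \<open>contract\<close> and \<open>grade_inv\<close> anticommute. Arguments in front of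
  the repeated pair merely replace the two factors, hence the generalization over
  \<open>\<alpha>\<close> and \<open>\<beta>\<close>.\<close>

lemma alternating_wedge:
  assumes "alternating \<alpha>" "alternating \<beta>"
  shows "alternating (wedge \<alpha> \<beta>)"
proof (rule alternatingI)
  show "multilin (wedge \<alpha> \<beta>)"
    using assms by (simp add: alternating_multilin multilin_wedge)
  show "wedge \<alpha> \<beta> (us @ x # x # vs) = 0" for us x vs
    using assms
  proof (induction us arbitrary: \<alpha> \<beta>)
    case Nil
    then show ?case
      by (simp add: wedge_Cons contract_contract_self contract_grade_inv wedge_uminus_left)
  next
    case (Cons u us)
    then show ?case
      by (simp add: wedge_Cons alternating_contract alternating_grade_inv)
  qed
qed

section \<open>Homogeneous forms\<close>

lemma alt_formsI:
  "alternating \<alpha> \<Longrightarrow> (\<And>vs. int (length vs) \<noteq> k \<Longrightarrow> \<alpha> vs = 0) \<Longrightarrow> \<alpha> \<in> alt_forms k"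
  by (simp add: alt_forms_def)

lemma alt_forms_alternating: "\<alpha> \<in> alt_forms k \<Longrightarrow> alternating \<alpha>"
  and alt_forms_length: "\<alpha> \<in> alt_forms k \<Longrightarrow> int (length vs) \<noteq> k \<Longrightarrow> \<alpha> vs = 0"
  by (simp_all add: alt_forms_def)

lemma alt_forms_negative: "\<alpha> \<in> alt_forms k \<Longrightarrow> k < 0 \<Longrightarrow> \<alpha> = 0"
  by (auto simp: alt_forms_def fun_eq_iff)

lemma alt_forms_contract: "\<alpha> \<in> alt_forms k \<Longrightarrow> contract v \<alpha> \<in> alt_forms (k - 1)"
  by (auto simp: alt_forms_def alternating_contract) (simp add: contract_def)

lemma alt_forms_zero [simp]: "0 \<in> alt_forms k"
  and alt_forms_add: "\<alpha> \<in> alt_forms k \<Longrightarrow> \<beta> \<in> alt_forms k \<Longrightarrow> \<alpha> + \<beta> \<in> alt_forms k"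
  and alt_forms_diff: "\<alpha> \<in> alt_forms k \<Longrightarrow> \<beta> \<in> alt_forms k \<Longrightarrow> \<alpha> - \<beta> \<in> alt_forms k"
  and alt_forms_uminus: "\<alpha> \<in> alt_forms k \<Longrightarrow> - \<alpha> \<in> alt_forms k"
  and alt_forms_fscale: "\<alpha> \<in> alt_forms k \<Longrightarrow> fscale r \<alpha> \<in> alt_forms k"
  by (auto simp: alt_forms_def alternating_add alternating_diff alternating_uminus
      alternating_fscale, simp add: fscale_def)

lemma alt_forms_grade_inv: "\<alpha> \<in> alt_forms k \<Longrightarrow> grade_inv \<alpha> \<in> alt_forms k"
  by (auto simp: alt_forms_def alternating_grade_inv) (simp add: grade_inv_def)

lemma alt_forms_sum: "(\<And>i. i \<in> I \<Longrightarrow> f i \<in> alt_forms k) \<Longrightarrow> sum f I \<in> alt_forms k"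
  by (induction I rule: infinite_finite_induct) (auto intro: alt_forms_add)

lemma alt_forms_wedge:
  assumes "\<alpha> \<in> alt_forms j" "\<beta> \<in> alt_forms k"
  shows "wedge \<alpha> \<beta> \<in> alt_forms (j + k)"
proof (rule alt_formsI)
  show "alternating (wedge \<alpha> \<beta>)"
    using assms alt_forms_alternating alternating_wedge by blast
  show "wedge \<alpha> \<beta> vs = 0" if "int (length vs) \<noteq> j + k" for vs
    using assms that
  proof (induction vs arbitrary: \<alpha> \<beta> j k)
    case Nil
    then have "\<alpha> [] = 0 \<or> \<beta> [] = 0"
      using alt_forms_length[of \<alpha> j "[]"] alt_forms_length[of \<beta> k "[]"] by (cases "j = 0") auto
    then show ?case by auto
  next
    case (Cons v vs)
    have "wedge (contract v \<alpha>) \<beta> vs = 0"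
      by (rule Cons.IH[OF alt_forms_contract[OF Cons.prems(1)] Cons.prems(2)]) (use Cons.prems in simp)
    moreover have "wedge (grade_inv \<alpha>) (contract v \<beta>) vs = 0"
      by (rule Cons.IH[OF alt_forms_grade_inv[OF Cons.prems(1)] alt_forms_contract[OF Cons.prems(2)]])
        (use Cons.prems in simp)
    ultimately show ?case by (simp add: wedge_Cons)
  qed
qed

lemma grade_inv_alt_forms:
  "\<alpha> \<in> alt_forms (int k) \<Longrightarrow> grade_inv \<alpha> = fscale ((-1) ^ k) \<alpha>"
  by (auto simp: alt_forms_def fun_eq_iff grade_inv_def fscale_def)

lemma wedge_alt_forms_0:
  assumes "\<alpha> \<in> alt_forms 0"
  shows "wedge \<alpha> \<beta> = fscale (\<alpha> []) \<beta>"
proof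
  fix vs
  have [simp]: "contract v \<alpha> = 0" for v
    using alt_forms_negative[OF alt_forms_contract[OF assms]] by simp
  have [simp]: "grade_inv \<alpha> = \<alpha>"
    using grade_inv_alt_forms[of \<alpha> 0] assms by (simp add: fscale_def fun_eq_iff)
  show "wedge \<alpha> \<beta> vs = fscale (\<alpha> []) \<beta> vs"
    by (induction vs arbitrary: \<beta>) (simp_all add: wedge_Cons fscale_def contract_apply)
qed

lemma wedge_map: "wedge \<alpha> \<beta> (map f vs) = wedge (\<lambda>us. \<alpha> (map f us)) (\<lambda>us. \<beta> (map f us)) vs"
  by (simp add: wedge_def nths_map)

text \<open>As simplification rules these also rewrite unapplied sums of forms into abstractions.\<close>

declare plus_fun_apply [simp del] zero_fun_apply [simp del] minus_apply [simp del] uminus_apply [simp del]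

lemmas fun_apply = plus_fun_apply zero_fun_apply minus_apply uminus_apply

section \<open>Forms in terms of a spanning list of vectors\<close>

lemma alternating_move_front:
  assumes "alternating \<alpha>"
  shows "\<alpha> (us @ x # vs) = (-1) ^ length us * \<alpha> (x # us @ vs)"
proof (induction us arbitrary: vs rule: rev_induct)
  case Nil
  then show ?case by simp
next
  case (snoc u us)
  have "\<alpha> ((us @ [u]) @ x # vs) = - \<alpha> (us @ x # u # vs)"
    using alternating_swap[OF assms, of us u x vs] by simp
  then show ?case using snoc[of "u # vs"] by simp
qed

text \<open>The list \<open>us\<close> collects the arguments already reduced to
  \<open>span B\<close>. Each further argument splits into a part in \<open>span B\<close> and a
  multiple of \<open>e\<close>. The latter moves to the front and is absorbed into
  \<open>contract e \<beta>\<close>, which satisfies the same hypotheses because contracting it with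
  \<open>e\<close> again gives zero.\<close>

lemma alternating_eq_0_insert:
  assumes "alternating \<beta>"
    and "\<And>us. set us \<subseteq> span B \<Longrightarrow> \<beta> us = 0"
    and "\<And>us. set us \<subseteq> span B \<Longrightarrow> \<beta> (e # us) = 0"
    and "set us \<subseteq> span B" "set vs \<subseteq> span (insert e B)"
  shows "\<beta> (us @ vs) = 0"
  using assms
proof (induction vs arbitrary: us \<beta>)
  case Nil
  then show ?case by simp
next
  case (Cons v vs)
  then obtain r where r: "v - r *\<^sub>R e \<in> span B"
    by (auto simp: span_breakdown_eq)
  have lin: "linear (\<lambda>x. \<beta> (us @ x # vs))"
    using Cons.prems(1) alternating_multilin multilin_linear by blast
  have "\<beta> (us @ v # vs) = \<beta> (us @ ((v - r *\<^sub>R e) + r *\<^sub>R e) # vs)" by simp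
  also have "\<dots> = \<beta> (us @ (v - r *\<^sub>R e) # vs) + r * \<beta> (us @ e # vs)"
    by (simp only: linear_add[OF lin] linear_scale[OF lin] real_scaleR_def)
  also have "\<beta> (us @ (v - r *\<^sub>R e) # vs) = 0"
    using Cons.IH[of \<beta> "us @ [v - r *\<^sub>R e]"] Cons.prems r by simp
  also have "\<beta> (us @ e # vs) = (-1) ^ length us * contract e \<beta> (us @ vs)"
    using alternating_move_front[OF Cons.prems(1)] by (simp add: contract_apply)
  also have "contract e \<beta> (us @ vs) = 0"
  proof (rule Cons.IH)
    show "contract e \<beta> (e # us) = 0" for us
      using alternating_adjacent[OF Cons.prems(1), of "[]"] by simp
  qed (use Cons.prems in \<open>auto simp: alternating_contract\<close>, simp add: contract_apply)
  finally show ?case by simp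
qed

lemma alternating_eq_0_nths:
  assumes "alternating \<beta>" and "\<And>I. I \<subseteq> {..<length es} \<Longrightarrow> \<beta> (nths es I) = 0"
    and "set vs \<subseteq> span (set es)"
  shows "\<beta> vs = 0"
  using assms
proof (induction es arbitrary: \<beta> vs)
  case Nil
  show ?case
  proof (cases vs)
    case Nil
    then show ?thesis using Nil.prems(2)[of "{}"] by simp
  next
    case (Cons v us)
    then have "v = 0" using Nil.prems(3) by simp
    then show ?thesis
      using Cons linear_0[OF multilin_linear[OF alternating_multilin[OF Nil.prems(1)], of "[]" us]]
      by simp
  qed
next
  case (Cons e es)
  have n1: "nths (e # es) (Suc ` I) = nths es I"
    and n2: "nths (e # es) (insert 0 (Suc ` I)) = e # nths es I" for I
    by (auto simp: nths_Cons image_iff intro!: arg_cong[of _ _ "nths es"])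
  have "\<beta> ([] @ vs) = 0"
  proof (rule alternating_eq_0_insert[of \<beta> "set es" e])
    show "\<beta> us = 0" if "set us \<subseteq> span (set es)" for us
    proof (rule Cons.IH[OF Cons.prems(1) _ that])
      show "\<beta> (nths es I) = 0" if "I \<subseteq> {..<length es}" for I
        using Cons.prems(2)[of "Suc ` I"] that by (auto simp: n1)
    qed
    show "\<beta> (e # us) = 0" if "set us \<subseteq> span (set es)" for us
      unfolding contract_apply[symmetric]
    proof (rule Cons.IH[OF alternating_contract[OF Cons.prems(1)] _ that])
      show "contract e \<beta> (nths es I) = 0" if "I \<subseteq> {..<length es}" for I
        using Cons.prems(2)[of "insert 0 (Suc ` I)"] that by (auto simp: n2 contract_apply)
    qed
  qed (use Cons.prems in auto)
  then show ?case by simp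
qed

lemma contract_lincomb:
  assumes "multilin \<alpha>"
  shows "contract (\<Sum>i\<in>I. c i *\<^sub>R v i) \<alpha> = (\<Sum>i\<in>I. fscale (c i) (contract (v i) \<alpha>))"
proof
  fix vs
  interpret linear "\<lambda>x. \<alpha> (x # vs)" using multilin_linear[OF assms, of "[]"] by simp
  show "contract (\<Sum>i\<in>I. c i *\<^sub>R v i) \<alpha> vs = (\<Sum>i\<in>I. fscale (c i) (contract (v i) \<alpha>)) vs"
    by (simp add: contract_apply sum_fun_apply fscale_def sum scale)
qed

text \<open>The operator on the left is the degree operator. Peeling off one argument produces one
  copy of \<open>\<gamma>\<close> by the frame identity and the same operator applied to
  \<open>contract v \<gamma>\<close>; the sign from \<open>grade_inv\<close> and the sign from
  exchanging two contractions cancel.\<close>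

lemma sum_wedge_contract:
  assumes "alternating \<gamma>" and \<xi>: "\<And>i. i \<in> I \<Longrightarrow> \<xi> i \<in> alt_forms 1"
    and frame: "\<And>v. (\<Sum>i\<in>I. \<xi> i [v] *\<^sub>R b i) = v"
  shows "(\<Sum>i\<in>I. wedge (\<xi> i) (contract (b i) \<gamma>)) vs = real (length vs) * \<gamma> vs"
  using assms(1)
proof (induction vs arbitrary: \<gamma>)
  case Nil
  then show ?case
    using \<xi> by (auto simp: sum_fun_apply alt_forms_def fun_apply intro!: sum.neutral)
next
  case (Cons v vs)
  have "wedge (\<xi> i) (contract (b i) \<gamma>) (v # vs) =
      fscale (\<xi> i [v]) (contract (b i) \<gamma>) vs + wedge (\<xi> i) (contract (b i) (contract v \<gamma>)) vs"
    if "i \<in> I" for i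
  proof -
    have "contract v (\<xi> i) \<in> alt_forms 0"
      using alt_forms_contract[OF \<xi>[OF that]] by simp
    moreover have "grade_inv (\<xi> i) = - \<xi> i"
      using grade_inv_alt_forms[of "\<xi> i" 1] \<xi>[OF that] by (simp add: fscale_def fun_eq_iff fun_apply)
    ultimately show ?thesis
      by (simp add: wedge_Cons wedge_alt_forms_0 wedge_uminus_left wedge_uminus_right
          contract_contract_swap[OF Cons.prems, of v])
  qed
  then have "(\<Sum>i\<in>I. wedge (\<xi> i) (contract (b i) \<gamma>)) (v # vs) =
      (\<Sum>i\<in>I. fscale (\<xi> i [v]) (contract (b i) \<gamma>)) vs +
      (\<Sum>i\<in>I. wedge (\<xi> i) (contract (b i) (contract v \<gamma>))) vs"
    by (simp add: sum_fun_apply sum.distrib fun_apply)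
  also have "(\<Sum>i\<in>I. fscale (\<xi> i [v]) (contract (b i) \<gamma>)) = contract v \<gamma>"
    using contract_lincomb[OF alternating_multilin[OF Cons.prems], of "\<lambda>i. \<xi> i [v]" b I]
    by (simp add: frame)
  finally show ?case
    using Cons.IH[OF alternating_contract[OF Cons.prems], of v]
    by (simp add: contract_apply algebra_simps)
qed

text \<open>The sum in \<open>ext_inner\<close> for an arbitrary list, which can therefore be
  computed by recursion over that list.\<close>

definition frame_inner ::
  "'v list \<Rightarrow> ('v list \<Rightarrow> real) \<Rightarrow> ('v list \<Rightarrow> real) \<Rightarrow> real" where
  "frame_inner es \<alpha> \<beta> = (\<Sum>I\<in>Pow {..<length es}. \<alpha> (nths es I) * \<beta> (nths es I))"

lemma frame_inner_Nil: "frame_inner [] \<alpha> \<beta> = \<alpha> [] * \<beta> []"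
  by (simp add: frame_inner_def)

lemma frame_inner_Cons:
  "frame_inner (e # es) \<alpha> \<beta> = frame_inner es \<alpha> \<beta> + frame_inner es (contract e \<alpha>) (contract e \<beta>)"
proof -
  have n1: "nths (e # es) (Suc ` I) = nths es I"
    and n2: "nths (e # es) (insert 0 (Suc ` I)) = e # nths es I" for I
    by (auto simp: nths_Cons image_iff intro!: arg_cong[of _ _ "nths es"])
  show ?thesis
    unfolding frame_inner_def list.size add_0_right add_Suc_right sum_Pow_lessThan_Suc n1 n2 contract_apply
    by simp
qed

lemma frame_inner_add_left: "frame_inner es (\<alpha> + \<alpha>') \<beta> = frame_inner es \<alpha> \<beta> + frame_inner es \<alpha>' \<beta>"
  and frame_inner_add_right: "frame_inner es \<alpha> (\<beta> + \<beta>') = frame_inner es \<alpha> \<beta> + frame_inner es \<alpha> \<beta>'"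
  and frame_inner_diff_left: "frame_inner es (\<alpha> - \<alpha>') \<beta> = frame_inner es \<alpha> \<beta> - frame_inner es \<alpha>' \<beta>"
  and frame_inner_diff_right: "frame_inner es \<alpha> (\<beta> - \<beta>') = frame_inner es \<alpha> \<beta> - frame_inner es \<alpha> \<beta>'"
  and frame_inner_uminus_left: "frame_inner es (- \<alpha>) \<beta> = - frame_inner es \<alpha> \<beta>"
  and frame_inner_fscale_left: "frame_inner es (fscale r \<alpha>) \<beta> = r * frame_inner es \<alpha> \<beta>"
  and frame_inner_fscale_right: "frame_inner es \<alpha> (fscale r \<beta>) = r * frame_inner es \<alpha> \<beta>"
  and frame_inner_zero_left [simp]: "frame_inner es 0 \<beta> = 0"
  and frame_inner_zero_right [simp]: "frame_inner es \<alpha> 0 = 0"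
  by (simp_all add: frame_inner_def fscale_def sum_distrib_left algebra_simps fun_apply
      sum.distrib sum_subtractf sum_negf)

lemma frame_inner_sum_left: "frame_inner es (sum f I) \<beta> = (\<Sum>i\<in>I. frame_inner es (f i) \<beta>)"
  by (induction I rule: infinite_finite_induct) (simp_all add: frame_inner_add_left)

lemma frame_inner_self_ge_0: "0 \<le> frame_inner es \<alpha> \<alpha>"
  by (simp add: frame_inner_def sum_nonneg)

lemma frame_inner_self_eq_0:
  assumes "alternating \<alpha>" "span (set es) = UNIV" "frame_inner es \<alpha> \<alpha> = 0"
  shows "\<alpha> = 0"
proof
  fix vs
  have "\<alpha> (nths es I) = 0" if "I \<subseteq> {..<length es}" for I
    using assms(3) that by (simp add: frame_inner_def sum_nonneg_eq_0_iff)
  then show "\<alpha> vs = 0 vs"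
    using alternating_eq_0_nths[OF assms(1), of es vs] assms(2) by (simp add: fun_apply)
qed

text \<open>The adjoint of exterior multiplication by a covector is contraction with the dual
  vector. No metric occurs: \<open>frame_inner\<close> treats \<open>es\<close> as orthonormal by
  its very definition.\<close>

lemma frame_inner_wedge_1:
  assumes "distinct es" "alternating \<alpha>" "\<xi> \<in> alt_forms 1"
  shows "frame_inner es \<alpha> (wedge \<xi> \<gamma>) = (\<Sum>e\<in>set es. \<xi> [e] * frame_inner es (contract e \<alpha>) \<gamma>)"
  using assms(1,2)
proof (induction es arbitrary: \<alpha> \<gamma>)
  case Nil
  then show ?case
    using alt_forms_length[OF assms(3), of "[]"] by (simp add: frame_inner_Nil)
next
  case (Cons e es)
  have "contract e \<xi> \<in> alt_forms 0"
    using alt_forms_contract[OF assms(3)] by simp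
  moreover have "grade_inv \<xi> = - \<xi>"
    using grade_inv_alt_forms[of \<xi> 1] assms(3) by (simp add: fscale_def fun_eq_iff fun_apply)
  ultimately have c: "contract e (wedge \<xi> \<gamma>) = fscale (\<xi> [e]) \<gamma> - wedge \<xi> (contract e \<gamma>)"
    by (simp add: contract_wedge wedge_alt_forms_0 wedge_uminus_left)
  have c1: "frame_inner (e # es) (contract u \<alpha>) \<gamma> =
      frame_inner es (contract u \<alpha>) \<gamma> - frame_inner es (contract u (contract e \<alpha>)) (contract e \<gamma>)" for u
    unfolding frame_inner_Cons contract_contract_swap[OF Cons.prems(2), of e u] frame_inner_uminus_left
    by simp
  have "frame_inner (e # es) \<alpha> (wedge \<xi> \<gamma>) =
      (\<Sum>u\<in>set es. \<xi> [u] * frame_inner es (contract u \<alpha>) \<gamma>) + \<xi> [e] * frame_inner es (contract e \<alpha>) \<gamma>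
      - (\<Sum>u\<in>set es. \<xi> [u] * frame_inner es (contract u (contract e \<alpha>)) (contract e \<gamma>))"
    using Cons.prems
    by (simp add: frame_inner_Cons c Cons.IH alternating_contract frame_inner_diff_right
        frame_inner_fscale_right)
  also have "\<dots> = (\<Sum>u\<in>set (e # es). \<xi> [u] * frame_inner (e # es) (contract u \<alpha>) \<gamma>)"
    using Cons.prems
    by (simp add: c1 contract_contract_self sum_subtractf right_diff_distrib)
  finally show ?case .
qed

text \<open>Each unordered pair of frame vectors occurs twice in the double sum, with equal
  contributions since both \<open>w\<close> and the double contraction change sign; this is the
  origin of \<open>1 / 2\<close>. In the induction the pairs containing the new vector
  \<open>e\<close> give the middle term of \<open>lhs\<close>.\<close>

lemma frame_inner_wedge_2:
  assumes "distinct es" "alternating \<alpha>" "w \<in> alt_forms 2"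
  shows "frame_inner es \<alpha> (wedge w \<gamma>) =
    (1 / 2) * (\<Sum>u\<in>set es. \<Sum>v\<in>set es. w [u, v] * frame_inner es (contract v (contract u \<alpha>)) \<gamma>)"
  using assms(1,2)
proof (induction es arbitrary: \<alpha> \<gamma>)
  case Nil
  then show ?case
    using alt_forms_length[OF assms(3), of "[]"] by (simp add: frame_inner_Nil)
next
  case (Cons e es)
  note alt = Cons.prems(2)
  have w_alt: "alternating w" using assms(3) by (rule alt_forms_alternating)
  have e1: "contract e w \<in> alt_forms 1"
    using alt_forms_contract[OF assms(3)] by simp
  have "grade_inv w = w"
    using grade_inv_alt_forms[of w 2] assms(3) by (simp add: fscale_def fun_eq_iff fun_apply)
  then have c: "contract e (wedge w \<gamma>) = wedge (contract e w) \<gamma> + wedge w (contract e \<gamma>)"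
    by (simp add: contract_wedge)
  have w0: "w [e, e] = 0" using alternating_adjacent[OF w_alt, of "[]" e "[]"] by simp
  have w1: "w [u, e] = - w [e, u]" for u
    using alternating_swap[OF w_alt, of "[]" u e "[]"] by simp
  have swap: "contract e (contract u \<beta>) = - contract u (contract e \<beta>)" if "alternating \<beta>" for u \<beta>
    by (rule contract_contract_swap[OF that])
  let ?I = "frame_inner es"
  have swap': "frame_inner es (contract e (contract u \<alpha>)) \<delta> =
      - frame_inner es (contract u (contract e \<alpha>)) \<delta>" for u \<delta>
    unfolding contract_contract_swap[OF alt, of e u] frame_inner_uminus_left ..
  have s1: "contract e (contract v (contract u \<alpha>)) = contract v (contract u (contract e \<alpha>))" for u v
    unfolding swap[OF alternating_contract[OF alt], of v u] swap[OF alt, of u]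
    by (simp add: contract_uminus)
  have s2: "contract e (contract u (contract e \<alpha>)) = 0" for u
    unfolding swap[OF alternating_contract[OF alt], of u e] contract_contract_self[OF alt]
    by (simp add: contract_zero)
  have c2: "frame_inner (e # es) (contract v (contract u \<alpha>)) \<gamma> = ?I (contract v (contract u \<alpha>)) \<gamma> +
      ?I (contract v (contract u (contract e \<alpha>))) (contract e \<gamma>)" for u v
    unfolding frame_inner_Cons s1 ..
  have lhs: "frame_inner (e # es) \<alpha> (wedge w \<gamma>) =
     (1 / 2) * (\<Sum>u\<in>set es. \<Sum>v\<in>set es. w [u, v] * ?I (contract v (contract u \<alpha>)) \<gamma>) +
     (\<Sum>u\<in>set es. w [e, u] * ?I (contract u (contract e \<alpha>)) \<gamma>) +
     (1 / 2) * (\<Sum>u\<in>set es. \<Sum>v\<in>set es. w [u, v] * ?I (contract v (contract u (contract e \<alpha>))) (contract e \<gamma>))"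
    using Cons.prems e1
    by (simp add: frame_inner_Cons c frame_inner_add_right Cons.IH alternating_contract
        frame_inner_wedge_1)
  have rhs: "(\<Sum>u\<in>set (e # es). \<Sum>v\<in>set (e # es).
       w [u, v] * frame_inner (e # es) (contract v (contract u \<alpha>)) \<gamma>) =
     (\<Sum>v\<in>set es. w [e, v] * ?I (contract v (contract e \<alpha>)) \<gamma>) +
     (\<Sum>u\<in>set es. w [e, u] * ?I (contract u (contract e \<alpha>)) \<gamma>) +
     (\<Sum>u\<in>set es. \<Sum>v\<in>set es. w [u, v] * (?I (contract v (contract u \<alpha>)) \<gamma> +
         ?I (contract v (contract u (contract e \<alpha>))) (contract e \<gamma>)))"
  proof -
    have 1: "w [u, e] * ?I (contract e (contract u \<alpha>)) \<gamma> = w [e, u] * ?I (contract u (contract e \<alpha>)) \<gamma>" for u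
      unfolding w1[of u] swap'[of u \<gamma>] by simp
    show ?thesis
      using Cons.prems(1)
      by (simp add: c2 w0 s2 contract_contract_self[OF alt] contract_zero sum.distrib 1)
  qed
  show ?case
    unfolding lhs rhs by (simp add: distrib_left sum.distrib sum_distrib_left)
qed

section \<open>Hermitian linear algebra\<close>

text \<open>
  The primitive projection in degree \<open>k\<close> is \<open>\<Sum>\<^sub>r c\<^sub>r L\<^sup>r \<Lambda>\<^sup>r\<close>; the recursion for \<open>c\<^sub>r\<close> makes the terms of
  \<open>\<Lambda> (\<Sum>\<^sub>r c\<^sub>r L\<^sup>r \<Lambda>\<^sup>r \<alpha>)\<close> telescope.
\<close>

primrec proj_coeff :: "nat \<Rightarrow> int \<Rightarrow> nat \<Rightarrow> real" where
  "proj_coeff n k 0 = 1"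
| "proj_coeff n k (Suc r) = - proj_coeff n k r / ((real r + 1) * (real n - real_of_int k + real r + 2))"

text \<open>What a compatible triple amounts to at one point, in the coordinates of one
  chart.\<close>

locale hermitian_space =
  fixes w :: "(real ^ 'm::finite) list \<Rightarrow> real"
    and h :: "real ^ 'm \<Rightarrow> real ^ 'm \<Rightarrow> real"
    and J :: "real ^ 'm \<Rightarrow> real ^ 'm"
    and n :: nat
  assumes w: "w \<in> alt_forms 2"
    and h_bilinear: "bilinear h" and h_sym: "h u v = h v u" and h_pos: "u \<noteq> 0 \<Longrightarrow> 0 < h u u"
    and J_linear: "linear J" and J_J: "J (J u) = - u"
    and h_eq: "h u v = w [u, J v]"
    and card_m: "CARD('m) = 2 * n"
begin

lemma h_sum_left: "h (\<Sum>i\<in>I. c i *\<^sub>R x i) v = (\<Sum>i\<in>I. c i * h (x i) v)"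
proof -
  interpret linear "\<lambda>x. h x v" using h_bilinear by (simp add: bilinear_def)
  show ?thesis by (simp add: sum scale)
qed

lemma h_diff_left: "h (x - y) v = h x v - h y v"
  and h_scale_left: "h (r *\<^sub>R x) v = r * h x v"
  and h_scale_right: "h v (r *\<^sub>R x) = r * h v x"
  and h_uminus_left: "h (- x) v = - h x v"
  using bilinear_lsub[OF h_bilinear] bilinear_rsub[OF h_bilinear] bilinear_lmul[OF h_bilinear]
    bilinear_rmul[OF h_bilinear] bilinear_lneg[OF h_bilinear] by auto

lemma w_swap: "w [u, v] = - w [v, u]"
  using alternating_swap[OF alt_forms_alternating[OF w], of "[]" u v "[]"] by simp

lemma w_eq: "w [u, v] = h (J u) v"
proof -
  have "h v (J u) = w [v, J (J u)]" by (rule h_eq)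
  also have "\<dots> = - w [v, u]"
    using linear_neg[OF multilin_linear[OF alternating_multilin[OF alt_forms_alternating[OF w]], of "[v]" "[]"], of u]
    by (simp add: J_J)
  finally show ?thesis using w_swap[of u v] h_sym by simp
qed

section \<open>Orthonormal sets and frames\<close>

definition orthonormal :: "(real ^ 'm) set \<Rightarrow> bool" where
  "orthonormal E \<longleftrightarrow> finite E \<and> (\<forall>e\<in>E. \<forall>f\<in>E. h e f = (if e = f then 1 else 0))"

lemma h_orthonormal_sum:
  assumes "orthonormal E" "f \<in> E"
  shows "h (\<Sum>e\<in>E. c e *\<^sub>R e) f = c f"
proof -
  have "h (\<Sum>e\<in>E. c e *\<^sub>R e) f = (\<Sum>e\<in>E. if e = f then c e else 0)"
    unfolding h_sum_left by (rule sum.cong) (use assms in \<open>auto simp: orthonormal_def\<close>)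
  then show ?thesis using assms by (simp add: orthonormal_def)
qed

lemma orthonormal_independent:
  assumes "orthonormal E"
  shows "independent E"
proof (rule independent_if_scalars_zero)
  show "finite E" using assms by (simp add: orthonormal_def)
  show "f x = 0" if "(\<Sum>x\<in>E. f x *\<^sub>R x) = 0" "x \<in> E" for f x
    using h_orthonormal_sum[OF assms that(2), of f] that(1) bilinear_lzero[OF h_bilinear] by simp
qed

lemma orthonormal_extend:
  assumes "orthonormal E" "x \<notin> span E"
  obtains y where "y \<notin> E" "orthonormal (insert y E)"
proof -
  \<comment> \<open>A Gram-Schmidt step: \<open>z\<close> is \<open>x\<close> minus its orthogonal
    projection to \<open>span E\<close>, and \<open>y\<close> is \<open>z\<close>
    normalized.\<close>
  define z where "z = x - (\<Sum>e\<in>E. h x e *\<^sub>R e)"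
  have "(\<Sum>e\<in>E. h x e *\<^sub>R e) \<in> span E"
    by (intro span_sum span_scale span_base)
  then have "z \<noteq> 0" using assms(2) by (auto simp: z_def)
  then have pos: "0 < h z z" by (rule h_pos)
  have orth: "h z e = 0" if "e \<in> E" for e
    unfolding z_def h_diff_left h_orthonormal_sum[OF assms(1) that] by simp
  define y where "y = (1 / sqrt (h z z)) *\<^sub>R z"
  have "h y y = 1"
    using pos by (simp add: y_def h_scale_left h_scale_right flip: power2_eq_square)
  moreover have "h y e = 0" "h e y = 0" if "e \<in> E" for e
    using orth[OF that] h_sym by (simp_all add: y_def h_scale_left h_scale_right)
  ultimately have "y \<notin> E" "orthonormal (insert y E)"
    using assms(1) by (auto simp: orthonormal_def)
  then show ?thesis using that by blast
qed

lemma orthonormal_exists: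
  assumes "k \<le> CARD('m)"
  shows "\<exists>E. orthonormal E \<and> card E = k"
  using assms
proof (induction k)
  case 0
  show ?case by (intro exI[of _ "{}"]) (simp add: orthonormal_def)
next
  case (Suc k)
  then obtain E where E: "orthonormal E" "card E = k" by auto
  have "dim (span E) < CARD('m)"
    using dim_le_card'[of E] E Suc.prems by (auto simp: orthonormal_def)
  then have "span E \<noteq> UNIV" by (metis dim_UNIV dim_span less_irrefl DIM_cart DIM_real mult.right_neutral)
  then obtain x where "x \<notin> span E" by auto
  then obtain y where "y \<notin> E" "orthonormal (insert y E)"
    using orthonormal_extend[OF E(1)] by blast
  then show ?case
    using E by (intro exI[of _ "insert y E"]) (auto simp: orthonormal_def)
qed

lemma orthonormal_frame_iff:
  "orthonormal_frame h es \<longleftrightarrow> distinct es \<and> orthonormal (set es) \<and> card (set es) = CARD('m)"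
proof
  assume "orthonormal_frame h es"
  then have len: "length es = CARD('m)"
    and eq: "\<And>i j. i < length es \<Longrightarrow> j < length es \<Longrightarrow> h (es ! i) (es ! j) = (if i = j then 1 else 0)"
    by (auto simp: orthonormal_frame_def)
  have "distinct es"
    unfolding distinct_conv_nth using eq by (metis zero_neq_one)
  moreover have "orthonormal (set es)"
    using eq by (auto simp: orthonormal_def in_set_conv_nth)
  ultimately show "distinct es \<and> orthonormal (set es) \<and> card (set es) = CARD('m)"
    using len by (simp add: distinct_card)
next
  assume "distinct es \<and> orthonormal (set es) \<and> card (set es) = CARD('m)"
  then show "orthonormal_frame h es"
    by (auto simp: orthonormal_frame_def orthonormal_def distinct_card nth_eq_iff_index_eq)
qed

lemma orthonormal_frame_exists: "\<exists>es. orthonormal_frame h es"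
proof -
  obtain E where E: "orthonormal E" "card E = CARD('m)"
    using orthonormal_exists by blast
  moreover have "finite E" using E by (simp add: orthonormal_def)
  ultimately obtain es where "set es = E" "distinct es"
    using finite_distinct_list by blast
  then show ?thesis using E orthonormal_frame_iff by blast
qed

definition frame :: "(real ^ 'm) set \<Rightarrow> bool" where
  "frame E \<longleftrightarrow> orthonormal E \<and> card E = CARD('m)"

lemma frame_span: "frame E \<Longrightarrow> span E = UNIV"
  using orthonormal_independent card_eq_dim[of E UNIV] by (auto simp: frame_def orthonormal_def)

lemma frame_expand:
  assumes "frame E"
  shows "(\<Sum>e\<in>E. h x e *\<^sub>R e) = x"
proof -
  define z where "z = x - (\<Sum>e\<in>E. h x e *\<^sub>R e)"
  have E: "orthonormal E" using assms by (simp add: frame_def)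
  have "h z e = 0" if "e \<in> E" for e
    unfolding z_def h_diff_left h_orthonormal_sum[OF E that] by simp
  moreover have "linear (h z)" using h_bilinear by (auto simp: bilinear_def)
  moreover have "linear (\<lambda>x. 0 :: real)" by (rule linear_zero)
  ultimately have "h z v = 0" for v
    using linear_eq_on_span[of "h z" "\<lambda>x. 0" E v] frame_span[OF assms] by auto
  then have "z = 0" using h_pos by (metis less_irrefl)
  then show ?thesis by (simp add: z_def)
qed

text \<open>The covectors \<open>w [e, _]\<close> and the vectors \<open>J e\<close> form dual
  bases. This makes \<open>sum_wedge_contract\<close> applicable to contractions of
  \<open>w\<close>, and it exhibits the inverse of \<open>w\<close>.\<close>

lemma J_frame_expand:
  assumes "frame E"
  shows "(\<Sum>e\<in>E. w [e, x] *\<^sub>R J e) = x"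
proof -
  have "(\<Sum>e\<in>E. w [e, x] *\<^sub>R J e) = J (\<Sum>e\<in>E. h (- J x) e *\<^sub>R e)"
    by (simp add: linear_sum[OF J_linear] linear_scale[OF J_linear] h_uminus_left
        w_eq[of x, symmetric] w_swap[of x, symmetric] flip: w_swap)
  then show ?thesis
    by (simp add: frame_expand[OF assms] linear_neg[OF J_linear] J_J)
qed

section \<open>The operators \<open>\<L>\<close> and \<open>\<Lambda>\<close> at a point\<close>

abbreviation ip where "ip \<equiv> ext_inner h"

abbreviation \<L> where "\<L> \<equiv> wedge w"

abbreviation \<Lambda> where "\<Lambda> \<equiv> dual_lefschetz_pt w h"

text \<open>The very frame chosen inside \<open>ext_inner\<close>, so that \<open>ip\<close> unfolds
  to \<open>frame_inner\<close>.\<close>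

definition frame0 :: "(real ^ 'm) list" where
  "frame0 = (SOME es. orthonormal_frame h es)"

lemma frame0: "distinct frame0" "frame (set frame0)" "length frame0 = CARD('m)"
proof -
  have "orthonormal_frame h frame0"
    unfolding frame0_def using orthonormal_frame_exists by (rule someI_ex)
  then show "distinct frame0" "frame (set frame0)" "length frame0 = CARD('m)"
    by (auto simp: orthonormal_frame_iff frame_def) (simp add: distinct_card)
qed

lemma ip_eq: "ip \<alpha> \<beta> = frame_inner frame0 \<alpha> \<beta>"
  by (simp add: ext_inner_def frame_inner_def frame0(3) Let_def flip: frame0_def)

lemma ip_self_eq_0: "alternating \<alpha> \<Longrightarrow> ip \<alpha> \<alpha> = 0 \<Longrightarrow> \<alpha> = 0"
  unfolding ip_eq by (rule frame_inner_self_eq_0[OF _ frame_span[OF frame0(2)]])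

text \<open>The classical formula for \<open>\<Lambda>\<close> as contraction with the bivector dual
  to \<open>w\<close>, for a frame \<open>E\<close> left open.\<close>

definition contraction :: "(real ^ 'm) set \<Rightarrow> ((real ^ 'm) list \<Rightarrow> real) \<Rightarrow> (real ^ 'm) list \<Rightarrow> real" where
  "contraction E \<alpha> = fscale (1 / 2) (\<Sum>e\<in>E. contract (J e) (contract e \<alpha>))"

lemma alternating_contraction: "alternating \<alpha> \<Longrightarrow> alternating (contraction E \<alpha>)"
  unfolding contraction_def by (intro alternating_fscale alternating_sum alternating_contract)

lemma bilinear_slots:
  assumes "multilin \<alpha>"
  shows "bilinear (\<lambda>u v. \<alpha> (u # v # vs))"
  using multilin_linear[OF assms, of "[]"] multilin_linear[OF assms, of "[u]" for u]
  by (auto simp: bilinear_def)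

lemma frame_trace:
  assumes "frame E" "frame F" "bilinear B"
  shows "(\<Sum>e\<in>E. B e e) = (\<Sum>f\<in>F. B f (f :: real ^ 'm) :: real)"
proof -
  have fin: "finite F" "finite E" using assms by (auto simp: frame_def orthonormal_def)
  have "B e e = (\<Sum>f\<in>F. \<Sum>f'\<in>F. h e f * h e f' * B f f')" for e
    using bilinear_sum[OF assms(3), of "\<lambda>f. h e f *\<^sub>R f" F "\<lambda>f. h e f *\<^sub>R f" F]
    by (simp add: frame_expand[OF assms(2)] sum.cartesian_product bilinear_lmul[OF assms(3)]
        bilinear_rmul[OF assms(3)] mult_ac)
  then have "(\<Sum>e\<in>E. B e e) = (\<Sum>e\<in>E. \<Sum>f\<in>F. \<Sum>f'\<in>F. h e f * h e f' * B f f')"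
    by simp
  also have "\<dots> = (\<Sum>f\<in>F. \<Sum>f'\<in>F. (\<Sum>e\<in>E. h e f * h e f') * B f f')"
    by (subst sum.swap) (simp add: sum.swap[of _ E] sum_distrib_right)
  also have "\<dots> = (\<Sum>f\<in>F. \<Sum>f'\<in>F. h f f' * B f f')"
  proof -
    have "(\<Sum>e\<in>E. h e f * h e f') = h f f'" for f f'
      using h_sum_left[of "h f" "\<lambda>e. e" E f'] unfolding frame_expand[OF assms(1)]
      by (simp add: h_sym[of _ f])
    then show ?thesis by simp
  qed
  also have "\<dots> = (\<Sum>f\<in>F. \<Sum>f'\<in>F. if f' = f then B f f' else 0)"
    by (intro sum.cong refl) (use assms(2) in \<open>auto simp: frame_def orthonormal_def\<close>)
  also have "\<dots> = (\<Sum>f\<in>F. B f f)"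
    using fin by simp
  finally show ?thesis .
qed

lemma contraction_apply: "contraction E \<alpha> vs = (1 / 2) * (\<Sum>e\<in>E. \<alpha> (e # J e # vs))"
  by (simp add: contraction_def fscale_def sum_fun_apply contract_apply)

lemma contraction_frame_indep:
  assumes "frame E" "frame F" "multilin \<alpha>"
  shows "contraction E \<alpha> = contraction F \<alpha>"
proof
  fix vs
  have "bilinear (\<lambda>u v. \<alpha> (u # J v # vs))"
    using bilinear_slots[OF assms(3), of vs] linear_compose[OF J_linear]
    by (auto simp: bilinear_def o_def)
  then show "contraction E \<alpha> vs = contraction F \<alpha> vs"
    using frame_trace[OF assms(1,2)] by (simp add: contraction_apply)
qed

text \<open>In \<open>frame_inner_wedge_2\<close> the sum over \<open>v\<close> is the expansion of
  \<open>J u\<close> in the frame, so the double sum collapses to contractions with \<open>u\<close>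
  and \<open>J u\<close>.\<close>

lemma ip_contraction:
  assumes "alternating \<alpha>"
  shows "ip (contraction (set frame0) \<alpha>) \<gamma> = ip \<alpha> (\<L> \<gamma>)"
proof -
  let ?E = "set frame0"
  have "(\<Sum>v\<in>?E. w [u, v] * frame_inner frame0 (contract v (contract u \<alpha>)) \<gamma>) =
      frame_inner frame0 (contract (J u) (contract u \<alpha>)) \<gamma>" for u
    using contract_lincomb[OF alternating_multilin[OF alternating_contract[OF assms]], of "\<lambda>v. w [u, v]" "\<lambda>v. v" ?E u]
    by (simp add: w_eq frame_expand[OF frame0(2)] frame_inner_sum_left frame_inner_fscale_left)
  then show ?thesis
    unfolding ip_eq frame_inner_wedge_2[OF frame0(1) assms w] contraction_def
    by (simp add: frame_inner_fscale_left frame_inner_sum_left)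
qed

text \<open>An adjoint is unique, because the difference of two candidates is orthogonal to itself.
  The freedom in \<open>E\<close> is what makes \<open>\<Lambda>\<close> comparable between
  charts.\<close>

lemma \<Lambda>_eq:
  assumes "frame E" "alternating \<alpha>"
  shows "\<Lambda> \<alpha> = contraction E \<alpha>"
proof -
  have "\<Lambda> \<alpha> = contraction (set frame0) \<alpha>"
    unfolding dual_lefschetz_pt_def
  proof (rule the_equality)
    show "alternating (contraction (set frame0) \<alpha>) \<and>
        (\<forall>\<gamma>. alternating \<gamma> \<longrightarrow> ip (contraction (set frame0) \<alpha>) \<gamma> = ip \<alpha> (\<L> \<gamma>))"
      using assms(2) by (simp add: ip_contraction alternating_contraction)
    fix \<beta> assume \<beta>: "alternating \<beta> \<and> (\<forall>\<gamma>. alternating \<gamma> \<longrightarrow> ip \<beta> \<gamma> = ip \<alpha> (\<L> \<gamma>))"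
    let ?\<delta> = "\<beta> - contraction (set frame0) \<alpha>"
    have alt: "alternating ?\<delta>"
      using \<beta> assms(2) by (simp add: alternating_diff alternating_contraction)
    then have "ip ?\<delta> ?\<delta> = 0"
      using \<beta> ip_contraction[OF assms(2)] by (simp add: ip_eq frame_inner_diff_left)
    then show "\<beta> = contraction (set frame0) \<alpha>"
      using ip_self_eq_0[OF alt] by simp
  qed
  then show ?thesis
    using contraction_frame_indep[OF frame0(2) assms(1)] alternating_multilin[OF assms(2)] by simp
qed

lemma ip_\<Lambda>: "alternating \<alpha> \<Longrightarrow> ip (\<Lambda> \<alpha>) \<gamma> = ip \<alpha> (\<L> \<gamma>)"
  by (simp add: \<Lambda>_eq[OF frame0(2)] ip_contraction)

lemma \<Lambda>_add: "alternating \<alpha> \<Longrightarrow> alternating \<beta> \<Longrightarrow> \<Lambda> (\<alpha> + \<beta>) = \<Lambda> \<alpha> + \<Lambda> \<beta>"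
  and \<Lambda>_diff: "alternating \<alpha> \<Longrightarrow> alternating \<beta> \<Longrightarrow> \<Lambda> (\<alpha> - \<beta>) = \<Lambda> \<alpha> - \<Lambda> \<beta>"
  and \<Lambda>_fscale: "alternating \<alpha> \<Longrightarrow> \<Lambda> (fscale r \<alpha>) = fscale r (\<Lambda> \<alpha>)"
  and \<Lambda>_zero [simp]: "\<Lambda> 0 = 0"
  by (simp_all add: \<Lambda>_eq[OF frame0(2)] alternating_add alternating_diff alternating_fscale)
    (simp_all add: fun_eq_iff contraction_apply fun_apply fscale_def sum.distrib sum_subtractf
      algebra_simps sum_distrib_left)

lemma \<Lambda>_alt_forms: "\<alpha> \<in> alt_forms k \<Longrightarrow> \<Lambda> \<alpha> \<in> alt_forms (k - 2)"
  using alt_forms_contract[OF alt_forms_contract[of \<alpha> k]]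
  by (auto simp: \<Lambda>_eq[OF frame0(2)] alt_forms_alternating contraction_def
      intro!: alt_forms_fscale alt_forms_sum)

lemma \<L>_alt_forms: "\<alpha> \<in> alt_forms k \<Longrightarrow> \<L> \<alpha> \<in> alt_forms (k + 2)"
  using alt_forms_wedge[OF w] by (simp add: add.commute)

text \<open>The contraction of \<open>w \<and> \<gamma>\<close> with \<open>e\<close> and
  \<open>J e\<close> has four kinds of terms. Both contractions on \<open>w\<close> give the trace
  \<open>2n\<close>, both on \<open>\<gamma>\<close> give \<open>2 \<L> \<Lambda> \<gamma>\<close>,
  and each of the two mixed sums is a degree operator contributing \<open>-k\<close>. Half of the
  total is the claim.\<close>

lemma \<Lambda>_\<L>:
  assumes "\<gamma> \<in> alt_forms k"
  shows "\<Lambda> (\<L> \<gamma>) = \<L> (\<Lambda> \<gamma>) + fscale (real n - real_of_int k) \<gamma>"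
proof -
  let ?E = "set frame0"
  have alt: "alternating \<gamma>" using assms by (rule alt_forms_alternating)
  have altw: "alternating w" using w by (rule alt_forms_alternating)
  have w1: "contract e w \<in> alt_forms 1" for e
    using alt_forms_contract[OF w, of e] by simp
  have w0: "contract f (contract e w) \<in> alt_forms 0" for e f
    using alt_forms_contract[OF w1, of f e] by simp
  have g1: "grade_inv (contract e w) = - contract e w" for e
    using grade_inv_alt_forms[of "contract e w" 1] w1[of e] by (simp add: fscale_def fun_eq_iff fun_apply)
  have g2: "grade_inv w = w"
    using grade_inv_alt_forms[of w 2] w by (simp add: fscale_def fun_eq_iff)
  have step: "contract (J e) (contract e (\<L> \<gamma>)) =
      fscale (w [e, J e]) \<gamma> - wedge (contract e w) (contract (J e) \<gamma>)
      - wedge (- contract (J e) w) (contract e \<gamma>) + \<L> (contract (J e) (contract e \<gamma>))" for e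
    by (simp add: contract_wedge contract_add g1 g2 wedge_alt_forms_0[OF w0] wedge_uminus_left)
  have len: "real (length vs) * \<gamma> vs = real_of_int k * \<gamma> vs" for vs
    using alt_forms_length[OF assms, of vs] by fastforce
  have s1: "(\<Sum>e\<in>?E. wedge (contract e w) (contract (J e) \<gamma>)) vs = real_of_int k * \<gamma> vs" for vs
    unfolding len[symmetric]
    by (rule sum_wedge_contract[OF alt]) (use w1 J_frame_expand[OF frame0(2)] in auto)
  have s2: "(\<Sum>e\<in>?E. wedge (- contract (J e) w) (contract e \<gamma>)) vs = real_of_int k * \<gamma> vs" for vs
    unfolding len[symmetric]
  proof (rule sum_wedge_contract[OF alt])
    show "- contract (J e) w \<in> alt_forms 1" for e using w1 by (simp add: alt_forms_uminus)
    have "(- contract (J e) w) [v] = h v e" for e v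
      using w_swap[of "J e" v] by (simp add: fun_apply h_eq)
    then show "(\<Sum>e\<in>?E. (- contract (J e) w) [v] *\<^sub>R e) = v" for v
      by (simp add: frame_expand[OF frame0(2)])
  qed
  have s0: "(\<Sum>e\<in>?E. w [e, J e]) = 2 * real n"
  proof -
    have "(\<Sum>e\<in>?E. w [e, J e]) = (\<Sum>e\<in>?E. 1)"
      by (rule sum.cong) (use frame0(2) in \<open>auto simp: frame_def orthonormal_def simp flip: h_eq\<close>)
    then show ?thesis using frame0(2) card_m by (simp add: frame_def)
  qed
  have L: "(\<Sum>e\<in>?E. \<L> (contract (J e) (contract e \<gamma>))) vs = 2 * \<L> (\<Lambda> \<gamma>) vs" for vs
  proof -
    have "\<L> (sum f I) = (\<Sum>i\<in>I. \<L> (f i))" for f :: "real ^ 'm \<Rightarrow> _" and I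
      by (induction I rule: infinite_finite_induct) (simp_all add: wedge_add_right)
    then show ?thesis
      by (simp add: \<Lambda>_eq[OF frame0(2) alt] contraction_def wedge_fscale_right) (simp add: fscale_def)
  qed
  show ?thesis
  proof
    fix vs
    have "(\<Sum>e\<in>?E. contract (J e) (contract e (\<L> \<gamma>))) vs =
        (\<Sum>e\<in>?E. w [e, J e]) * \<gamma> vs - (\<Sum>e\<in>?E. wedge (contract e w) (contract (J e) \<gamma>)) vs
        - (\<Sum>e\<in>?E. wedge (- contract (J e) w) (contract e \<gamma>)) vs
        + (\<Sum>e\<in>?E. \<L> (contract (J e) (contract e \<gamma>))) vs"
      unfolding step sum_fun_apply
      by (simp add: fun_apply sum.distrib sum_subtractf fscale_def sum_distrib_right)
    moreover have "2 * \<Lambda> (\<L> \<gamma>) vs = (\<Sum>e\<in>?E. contract (J e) (contract e (\<L> \<gamma>))) vs"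
      by (simp add: \<Lambda>_eq[OF frame0(2) alternating_wedge[OF altw alt]] contraction_def)
        (simp add: fscale_def)
    ultimately show "\<Lambda> (\<L> \<gamma>) vs = (\<L> (\<Lambda> \<gamma>) + fscale (real n - real_of_int k) \<gamma>) vs"
      unfolding s0 s1 s2 L by (simp add: fun_apply fscale_def algebra_simps)
  qed
qed

section \<open>Powers of \<open>\<L>\<close>, and the inverse matrix of \<open>w\<close>\<close>

abbreviation Lpow where "Lpow r \<equiv> \<L> ^^ r"

lemma Lpow_alt_forms: "\<alpha> \<in> alt_forms k \<Longrightarrow> Lpow r \<alpha> \<in> alt_forms (k + 2 * int r)"
  by (induction r) (use \<L>_alt_forms in \<open>force simp: algebra_simps\<close>)+

lemma Lpow_add: "Lpow r (\<alpha> + \<beta>) = Lpow r \<alpha> + Lpow r \<beta>"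
  and Lpow_zero [simp]: "Lpow r 0 = 0"
  by (induction r) (simp_all add: wedge_add_right wedge_fscale_right)

text \<open>Commuting \<open>\<Lambda>\<close> past \<open>r + 1\<close> factors adds up the numbers
  \<open>n - k - 2 i\<close> for \<open>i = 0, ..., r\<close>, whose sum is
  \<open>(r + 1) (n - k - r)\<close>.\<close>

lemma \<Lambda>_Lpow_Suc:
  assumes "\<gamma> \<in> alt_forms k"
  shows "\<Lambda> (Lpow (Suc r) \<gamma>) = Lpow (Suc r) (\<Lambda> \<gamma>) +
    fscale ((real r + 1) * (real n - real_of_int k - real r)) (Lpow r \<gamma>)"
proof (induction r)
  case 0
  show ?case using \<Lambda>_\<L>[OF assms] by simp
next
  case (Suc r)
  have "\<Lambda> (\<L> (Lpow (Suc r) \<gamma>)) = \<L> (\<Lambda> (Lpow (Suc r) \<gamma>)) +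
      fscale (real n - real_of_int (k + 2 * int (Suc r))) (Lpow (Suc r) \<gamma>)"
    by (rule \<Lambda>_\<L>[OF Lpow_alt_forms[OF assms]])
  then show ?case
    unfolding Suc
    by (simp add: wedge_add_right wedge_fscale_right)
      (simp add: fun_eq_iff fun_apply fscale_def algebra_simps)
qed

text \<open>The inverse of the coordinate matrix of \<open>w\<close>, as \<open>poisson_w\<close>
  shows. The chosen frame is only a means to write it down; being an inverse, it does not depend on
  that choice.\<close>

definition poisson :: "real ^ 'm ^ 'm" where
  "poisson = (\<chi> b a. \<Sum>e\<in>set frame0. J e $ b * e $ a)"

lemma bilinear_axis_expand:
  assumes "bilinear B"
  shows "B u v = (\<Sum>a\<in>UNIV. \<Sum>b\<in>UNIV. u $ a * v $ b * B (axis a 1) (axis b 1 :: real ^ 'm) :: real)"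
proof -
  have u: "(\<Sum>a\<in>UNIV. u $ a *\<^sub>R axis a 1) = u" and v: "(\<Sum>a\<in>UNIV. v $ a *\<^sub>R axis a 1) = v"
    using basis_expansion[of u] basis_expansion[of v] by (simp_all add: scalar_mult_eq_scaleR)
  have "B u v = (\<Sum>x\<in>UNIV \<times> UNIV. case x of (a, b) \<Rightarrow> B (u $ a *\<^sub>R axis a 1) (v $ b *\<^sub>R axis b 1))"
    using bilinear_sum[OF assms, of "\<lambda>a. u $ a *\<^sub>R axis a 1" UNIV "\<lambda>b. v $ b *\<^sub>R axis b 1" UNIV]
    unfolding u v .
  then show ?thesis
    by (simp add: sum.cartesian_product bilinear_lmul[OF assms] bilinear_rmul[OF assms] mult_ac)
qed

lemma poisson_w: "poisson ** (\<chi> a c. w [axis a 1, axis c 1]) = mat 1"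
proof -
  have lin: "linear (\<lambda>z. w [z, v])" for v
    using multilin_linear[OF alternating_multilin[OF alt_forms_alternating[OF w]], of "[]" "[v]"] by simp
  have "(\<Sum>a\<in>UNIV. (\<Sum>e\<in>set frame0. J e $ b * e $ a) * w [axis a 1, v]) = v $ b" for v b
  proof -
    have w_expand: "w [e, v] = (\<Sum>a\<in>UNIV. e $ a * w [axis a 1, v])" for e
      using linear_sum[OF lin, of "\<lambda>a. e $ a *\<^sub>R axis a 1" UNIV v] basis_expansion[of e]
      by (simp add: scalar_mult_eq_scaleR linear_scale[OF lin])
    have step: "(\<Sum>a\<in>UNIV. J e $ b * e $ a * w [axis a 1, v]) = J e $ b * w [e, v]" for e
      unfolding w_expand[of e] by (simp add: sum_distrib_left mult.assoc)
    have "(\<Sum>a\<in>UNIV. (\<Sum>e\<in>set frame0. J e $ b * e $ a) * w [axis a 1, v]) =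
        (\<Sum>a\<in>UNIV. \<Sum>e\<in>set frame0. J e $ b * e $ a * w [axis a 1, v])"
      by (simp add: sum_distrib_right)
    also have "\<dots> = (\<Sum>e\<in>set frame0. J e $ b * w [e, v])"
      by (subst sum.swap) (simp only: step)
    also have "\<dots> = (\<Sum>e\<in>set frame0. w [e, v] *\<^sub>R J e) $ b"
      by (simp add: mult.commute)
    finally show ?thesis by (simp only: J_frame_expand[OF frame0(2)])
  qed
  then show ?thesis
    by (auto simp: vec_eq_iff poisson_def matrix_matrix_mult_def mat_def) (auto simp: axis_def)
qed

lemma \<Lambda>_poisson:
  assumes "alternating \<alpha>"
  shows "\<Lambda> \<alpha> vs = (1 / 2) * (\<Sum>a\<in>UNIV. \<Sum>b\<in>UNIV. poisson $ b $ a * \<alpha> (axis a 1 # axis b 1 # vs))"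
proof -
  have "\<alpha> (e # J e # vs) = (\<Sum>a\<in>UNIV. \<Sum>b\<in>UNIV. e $ a * J e $ b * \<alpha> (axis a 1 # axis b 1 # vs))" for e
    using bilinear_axis_expand[OF bilinear_slots[OF alternating_multilin[OF assms]]] .
  then have "(\<Sum>e\<in>set frame0. \<alpha> (e # J e # vs)) =
      (\<Sum>e\<in>set frame0. \<Sum>a\<in>UNIV. \<Sum>b\<in>UNIV. e $ a * J e $ b * \<alpha> (axis a 1 # axis b 1 # vs))"
    by simp
  also have "\<dots> = (\<Sum>a\<in>UNIV. \<Sum>b\<in>UNIV. \<Sum>e\<in>set frame0. e $ a * J e $ b * \<alpha> (axis a 1 # axis b 1 # vs))"
    by (subst sum.swap) (simp add: sum.swap[of _ "set frame0"])
  also have "\<dots> = (\<Sum>a\<in>UNIV. \<Sum>b\<in>UNIV. poisson $ b $ a * \<alpha> (axis a 1 # axis b 1 # vs))"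
    by (simp add: poisson_def sum_distrib_left sum_distrib_right mult_ac)
  finally show ?thesis
    by (simp add: \<Lambda>_eq[OF frame0(2) assms] contraction_apply)
qed

section \<open>Primitive elements\<close>

lemma ip_self_ge_0: "0 \<le> ip \<alpha> \<alpha>"
  unfolding ip_eq by (rule frame_inner_self_ge_0)

lemma fscale_eq_0: "fscale c \<alpha> = 0 \<Longrightarrow> c \<noteq> 0 \<Longrightarrow> \<alpha> = 0"
  by (auto simp: fscale_def fun_eq_iff fun_apply)

text \<open>The inner product of \<open>p\<close> with \<open>\<L> \<beta>\<close> is that of
  \<open>\<Lambda> p\<close> with \<open>\<beta>\<close>, so \<open>p\<close> is orthogonal to
  itself.\<close>

lemma primitive_\<L>_eq_0:
  assumes "alternating p" "\<Lambda> p = 0" "p = \<L> \<beta>"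
  shows "p = 0"
  using ip_\<Lambda>[OF assms(1), of \<beta>] assms ip_self_eq_0[OF assms(1)] by (simp add: ip_eq)

text \<open>Pairing \<open>\<Lambda> (\<L> \<beta>) = 0\<close> with \<open>\<beta>\<close> shows
  that the squared norm of \<open>\<Lambda> \<beta>\<close> plus \<open>n - j\<close> times that of
  \<open>\<beta>\<close> is zero, and \<open>n - j\<close> is positive.\<close>

lemma \<L>_inject_0:
  assumes "\<beta> \<in> alt_forms j" "j < int n" "\<L> \<beta> = 0"
  shows "\<beta> = 0"
proof -
  have alt: "alternating \<beta>" "alternating (\<Lambda> \<beta>)"
    using assms(1) \<Lambda>_alt_forms alt_forms_alternating by blast+
  have "0 = \<L> (\<Lambda> \<beta>) + fscale (real n - real_of_int j) \<beta>"
    using \<Lambda>_\<L>[OF assms(1)] assms(3) by simp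
  then have "0 = ip \<beta> (\<L> (\<Lambda> \<beta>) + fscale (real n - real_of_int j) \<beta>)"
    by (simp add: ip_eq)
  also have "\<dots> = ip (\<Lambda> \<beta>) (\<Lambda> \<beta>) + (real n - real_of_int j) * ip \<beta> \<beta>"
    by (simp add: ip_eq frame_inner_add_right frame_inner_fscale_right flip: ip_\<Lambda>[OF alt(1), unfolded ip_eq])
  finally have "(real n - real_of_int j) * ip \<beta> \<beta> \<le> 0"
    using ip_self_ge_0[of "\<Lambda> \<beta>"] by linarith
  moreover have "0 < real n - real_of_int j" using assms(2) by linarith
  ultimately have "ip \<beta> \<beta> = 0"
    using ip_self_ge_0[of \<beta>] by (simp add: mult_le_0_iff)
  then show ?thesis by (rule ip_self_eq_0[OF alt(1)])
qed

text \<open>In this degree the commutator of \<open>\<Lambda>\<close> and \<open>\<L>\<close> is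
  \<open>-1\<close>, so the squared norm of \<open>\<L> p\<close> is minus that of
  \<open>p\<close>.\<close>

lemma primitive_degree_Suc_n:
  assumes "p \<in> alt_forms (int n + 1)" "\<Lambda> p = 0"
  shows "p = 0"
proof -
  have alt: "alternating p" "alternating (\<L> p)"
    using assms(1) \<L>_alt_forms alt_forms_alternating by blast+
  have "ip (\<L> p) (\<L> p) = ip (\<Lambda> (\<L> p)) p"
    using ip_\<Lambda>[OF alt(2)] by simp
  also have "\<dots> = - ip p p"
    unfolding \<Lambda>_\<L>[OF assms(1)] using assms(2) by (simp add: ip_eq frame_inner_fscale_left)
  finally have "ip p p = 0"
    using ip_self_ge_0[of p] ip_self_ge_0[of "\<L> p"] by linarith
  then show ?thesis by (rule ip_self_eq_0[OF alt(1)])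
qed

text \<open>For \<open>r = n - k\<close> the factor in \<open>\<Lambda>_Lpow_Suc\<close> vanishes,
  so \<open>Lpow (Suc r) p\<close> is primitive as well as in the image of \<open>\<L>\<close>. The
  case \<open>m = 0\<close> is degree \<open>n + 1\<close>.\<close>

lemma Lpow_primitive:
  assumes "p \<in> alt_forms k" "\<Lambda> p = 0" "int m = int n - k + 1"
  shows "Lpow m p = 0"
proof (cases m)
  case 0
  then have "k = int n + 1" using assms(3) by simp
  then show ?thesis using primitive_degree_Suc_n assms(1,2) 0 by simp
next
  case (Suc r)
  have alt: "alternating (Lpow m p)"
    using Lpow_alt_forms[OF assms(1)] alt_forms_alternating by blast
  have "real n - real_of_int k - real r = 0"
    using assms(3) Suc by (simp add: algebra_simps)
  then have "\<Lambda> (Lpow m p) = 0"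
    using \<Lambda>_Lpow_Suc[OF assms(1), of r] Suc assms(2) by (simp add: fscale_def fun_eq_iff fun_apply)
  then show ?thesis
    using primitive_\<L>_eq_0[OF alt, of "Lpow r p"] Suc by simp
qed

text \<open>Below the critical exponent the factor in \<open>\<Lambda>_Lpow_Suc\<close> is positive,
  so \<open>\<Lambda>\<close> strips off one \<open>\<L>\<close> at a time.\<close>

lemma primitive_Lpow_inject:
  assumes "p \<in> alt_forms k" "\<Lambda> p = 0" "int m \<le> int n - k" "Lpow m p = 0"
  shows "p = 0"
  using assms(3,4)
proof (induction m)
  case 0
  then show ?case by simp
next
  case (Suc r)
  have "0 < real n - real_of_int k - real r" using Suc.prems(1) by linarith
  moreover have "fscale ((real r + 1) * (real n - real_of_int k - real r)) (Lpow r p) = 0"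
    using \<Lambda>_Lpow_Suc[OF assms(1), of r] Suc.prems(2) assms(2) by (simp del: funpow.simps)
  ultimately have "Lpow r p = 0"
    using fscale_eq_0[of "(real r + 1) * (real n - real_of_int k - real r)" "Lpow r p"] by simp
  then show ?case using Suc by simp
qed

section \<open>The projection to primitive elements\<close>

abbreviation \<Lambda>pow where "\<Lambda>pow r \<equiv> \<Lambda> ^^ r"

lemma \<Lambda>pow_alt_forms: "\<alpha> \<in> alt_forms k \<Longrightarrow> \<Lambda>pow r \<alpha> \<in> alt_forms (k - 2 * int r)"
  by (induction r) (use \<Lambda>_alt_forms in \<open>force simp: algebra_simps\<close>)+

lemma \<Lambda>_partial_projection:
  assumes "\<alpha> \<in> alt_forms k" "k \<le> int n + 1"
  shows "\<Lambda> (\<Sum>r\<le>R. fscale (proj_coeff n k r) (Lpow r (\<Lambda>pow r \<alpha>))) =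
    fscale (proj_coeff n k R) (Lpow R (\<Lambda>pow (Suc R) \<alpha>))"
proof (induction R)
  case 0
  show ?case by (simp add: \<Lambda>_fscale alt_forms_alternating[OF assms(1)])
next
  case (Suc R)
  let ?c = "proj_coeff n k"
  \<comment> \<open>The factor of \<open>\<Lambda>_Lpow_Suc\<close> for \<open>?g\<close>, whose
    degree is \<open>k - 2 (R + 1)\<close>. It is the denominator in \<open>proj_coeff\<close>, and
    it is positive since \<open>k \<le> n + 1\<close>.\<close>
  let ?b = "(real R + 1) * (real n - real_of_int k + real R + 2)"
  let ?g = "\<Lambda>pow (Suc R) \<alpha>"
  have LL: "Lpow r (\<Lambda>pow r \<alpha>) \<in> alt_forms k" for r
    using Lpow_alt_forms[OF \<Lambda>pow_alt_forms[OF assms(1), of r], of r] by simp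
  have alt: "alternating (\<Sum>r\<le>R. fscale (?c r) (Lpow r (\<Lambda>pow r \<alpha>)))"
    "alternating (Lpow (Suc R) ?g)"
    using LL alt_forms_alternating by (auto intro!: alternating_sum alternating_fscale simp del: funpow.simps)
  have "0 < real n - real_of_int k + real R + 2" using assms(2) by linarith
  then have b: "?b \<noteq> 0" by simp
  have "real n - real_of_int (k - 2 * int (Suc R)) - real R = real n - real_of_int k + real R + 2"
    by simp
  then have "\<Lambda> (Lpow (Suc R) ?g) = Lpow (Suc R) (\<Lambda> ?g) + fscale ?b (Lpow R ?g)"
    using \<Lambda>_Lpow_Suc[OF \<Lambda>pow_alt_forms[OF assms(1), of "Suc R"], of R] by metis
  then have "\<Lambda> (\<Sum>r\<le>Suc R. fscale (?c r) (Lpow r (\<Lambda>pow r \<alpha>))) =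
      fscale (?c R) (Lpow R ?g) + fscale (?c (Suc R)) (Lpow (Suc R) (\<Lambda> ?g) + fscale ?b (Lpow R ?g))"
    unfolding sum.atMost_Suc using alt
    by (simp only: \<Lambda>_add \<Lambda>_fscale alternating_fscale Suc)
  also have "\<dots> = fscale (?c (Suc R)) (Lpow (Suc R) (\<Lambda>pow (Suc (Suc R)) \<alpha>))"
    using b by (auto simp: fun_eq_iff fun_apply fscale_def field_simps simp del: funpow.simps mult_eq_0_iff) simp
  finally show ?case .
qed

text \<open>The bound \<open>nat k\<close> suffices because one further power of
  \<open>\<Lambda>\<close> lowers the degree below zero, which ends the telescoping.\<close>

definition projection :: "int \<Rightarrow> ((real ^ 'm) list \<Rightarrow> real) \<Rightarrow> (real ^ 'm) list \<Rightarrow> real" where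
  "projection k \<alpha> = (\<Sum>r\<le>nat k. fscale (proj_coeff n k r) (Lpow r (\<Lambda>pow r \<alpha>)))"

text \<open>The terms of \<open>projection\<close> other than \<open>\<alpha>\<close> itself, with
  the sign reversed and one factor \<open>\<L>\<close> split off.\<close>

definition coprojection :: "int \<Rightarrow> ((real ^ 'm) list \<Rightarrow> real) \<Rightarrow> (real ^ 'm) list \<Rightarrow> real" where
  "coprojection k \<alpha> = (\<Sum>r<nat k. fscale (- proj_coeff n k (Suc r)) (Lpow r (\<Lambda>pow (Suc r) \<alpha>)))"

lemma projection_alt_forms:
  assumes "\<alpha> \<in> alt_forms k"
  shows "projection k \<alpha> \<in> alt_forms k"
proof -
  have "Lpow r (\<Lambda>pow r \<alpha>) \<in> alt_forms k" for r
    using Lpow_alt_forms[OF \<Lambda>pow_alt_forms[OF assms, of r], of r] by simp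
  then show ?thesis
    unfolding projection_def by (intro alt_forms_sum alt_forms_fscale)
qed

lemma coprojection_alt_forms:
  assumes "\<alpha> \<in> alt_forms k"
  shows "coprojection k \<alpha> \<in> alt_forms (k - 2)"
proof -
  have "Lpow r (\<Lambda>pow (Suc r) \<alpha>) \<in> alt_forms (k - 2)" for r
    using Lpow_alt_forms[OF \<Lambda>pow_alt_forms[OF assms, of "Suc r"], of r] by simp
  then show ?thesis
    unfolding coprojection_def by (intro alt_forms_sum alt_forms_fscale)
qed

lemma \<Lambda>_projection:
  assumes "\<alpha> \<in> alt_forms k" "k \<le> int n + 1"
  shows "\<Lambda> (projection k \<alpha>) = 0"
proof -
  have "\<Lambda>pow (Suc (nat k)) \<alpha> = 0"
    by (rule alt_forms_negative[OF \<Lambda>pow_alt_forms[OF assms(1)]]) simp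
  then show ?thesis
    unfolding projection_def \<Lambda>_partial_projection[OF assms]
    by (simp del: funpow.simps) (simp add: fscale_def fun_eq_iff fun_apply)
qed

lemma projection_decomp: "\<alpha> = projection k \<alpha> + \<L> (coprojection k \<alpha>)"
proof -
  have s: "\<L> (sum f I) = (\<Sum>i\<in>I. \<L> (f i))" for f :: "nat \<Rightarrow> _" and I
    by (induction I rule: infinite_finite_induct) (simp_all add: wedge_add_right)
  have "\<L> (coprojection k \<alpha>) = - (\<Sum>r<nat k. fscale (proj_coeff n k (Suc r)) (Lpow (Suc r) (\<Lambda>pow (Suc r) \<alpha>)))"
    unfolding coprojection_def s wedge_fscale_right sum_negf[symmetric]
    by (simp add: fscale_def fun_eq_iff fun_apply sum_fun_apply)
  moreover have "projection k \<alpha> =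
      \<alpha> + (\<Sum>r<nat k. fscale (proj_coeff n k (Suc r)) (Lpow (Suc r) (\<Lambda>pow (Suc r) \<alpha>)))"
    unfolding projection_def lessThan_Suc_atMost[symmetric] sum.lessThan_Suc_shift
    by simp (simp add: fscale_def fun_eq_iff)
  ultimately show ?thesis by simp
qed

text \<open>Induction on the degree, with \<open>\<alpha> = p + \<L> \<beta>\<close>. One more
  factor \<open>\<L>\<close> kills \<open>p\<close> and leaves
  \<open>Lpow (m + 2) \<beta> = 0\<close>. Since \<open>m + 2 = n - (k - 2)\<close>, the induction
  hypothesis gives \<open>\<beta> = 0\<close>; then \<open>\<alpha>\<close> is primitive and
  \<open>primitive_Lpow_inject\<close> applies.\<close>

lemma hard_lefschetz_inject:
  assumes "\<alpha> \<in> alt_forms k" "int m = int n - k" "Lpow m \<alpha> = 0"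
  shows "\<alpha> = 0"
  using assms
proof (induction "nat k" arbitrary: k m \<alpha> rule: less_induct)
  case less
  define p \<beta> where "p = projection k \<alpha>" and "\<beta> = coprojection k \<alpha>"
  have p: "p \<in> alt_forms k" "\<Lambda> p = 0" and \<beta>: "\<beta> \<in> alt_forms (k - 2)" and dec: "\<alpha> = p + \<L> \<beta>"
    using less.prems(1,2) projection_alt_forms coprojection_alt_forms \<Lambda>_projection projection_decomp[of \<alpha> k]
    unfolding p_def \<beta>_def by auto
  have comm: "Lpow r (\<L> \<beta>) = Lpow (Suc r) \<beta>" for r by (simp add: funpow_swap1)
  have "Lpow (Suc m) p + Lpow (Suc (Suc m)) \<beta> = Lpow (Suc m) \<alpha>"
    unfolding dec Lpow_add comm ..
  also have "\<dots> = 0" using less.prems(3) by simp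
  also have "Lpow (Suc m) p = 0"
    by (rule Lpow_primitive[OF p]) (use less.prems(2) in simp)
  finally have L0: "Lpow (Suc (Suc m)) \<beta> = 0" by simp
  have "\<beta> = 0"
  proof (cases "k < 2")
    case True
    then show ?thesis using alt_forms_negative[OF \<beta>] by simp
  next
    case False
    show ?thesis by (rule less.hyps[OF _ \<beta> _ L0]) (use False less.prems(2) in auto)
  qed
  then have "\<alpha> = p" using dec by simp
  then show ?case
    using primitive_Lpow_inject[OF p, of m] less.prems by simp
qed

text \<open>Meant for \<open>\<alpha> = dB\<close> with \<open>B\<close> primitive of degree
  \<open>j\<close>. Decomposing twice gives \<open>\<alpha> = p + \<L> (q + \<L> \<gamma>)\<close>.
  The exponents are such that \<open>Lpow m\<close> kills \<open>p\<close> and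
  \<open>Lpow (m + 1)\<close> kills \<open>q\<close>, so \<open>Lpow (m + 2) \<gamma> = 0\<close>;
  in degree \<open>j - 3\<close> this is the hard Lefschetz exponent and forces
  \<open>\<gamma> = 0\<close>. Then \<open>\<Lambda> \<alpha>\<close> is a multiple of the primitive
  \<open>q\<close>.\<close>

lemma \<Lambda>_\<Lambda>_eq_0:
  assumes "\<alpha> \<in> alt_forms (j + 1)" "j \<le> int n" "int m = int n - j + 1" "Lpow m \<alpha> = 0"
  shows "\<Lambda> (\<Lambda> \<alpha>) = 0"
proof -
  define p \<beta> where "p = projection (j + 1) \<alpha>" and "\<beta> = coprojection (j + 1) \<alpha>"
  have p: "p \<in> alt_forms (j + 1)" "\<Lambda> p = 0" and \<beta>: "\<beta> \<in> alt_forms (j - 1)" and dec: "\<alpha> = p + \<L> \<beta>"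
    using assms projection_alt_forms coprojection_alt_forms[of \<alpha> "j + 1"] \<Lambda>_projection
      projection_decomp[of \<alpha> "j + 1"]
    unfolding p_def \<beta>_def by auto
  have comm: "Lpow r (\<L> \<beta>) = Lpow (Suc r) \<beta>" for r \<beta> by (simp add: funpow_swap1)
  have "Lpow (m - 1) p = 0"
    by (rule Lpow_primitive[OF p]) (use assms(2,3) in simp)
  then have "\<L> (Lpow (m - 1) p) = 0" by simp
  then have "Lpow m p = 0"
    using assms(2,3) by (cases m) auto
  then have L\<beta>: "Lpow (Suc m) \<beta> = 0"
    using assms(4) unfolding dec Lpow_add comm by simp
  define q \<gamma> where "q = projection (j - 1) \<beta>" and "\<gamma> = coprojection (j - 1) \<beta>"
  have q: "q \<in> alt_forms (j - 1)" "\<Lambda> q = 0" and \<gamma>: "\<gamma> \<in> alt_forms (j - 3)" and dec2: "\<beta> = q + \<L> \<gamma>"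
    using assms(2) \<beta> projection_alt_forms coprojection_alt_forms[of \<beta> "j - 1"] \<Lambda>_projection[of \<beta> "j - 1"]
      projection_decomp[of \<beta> "j - 1"]
    unfolding q_def \<gamma>_def by auto
  have "Lpow (Suc m) q = 0"
    by (rule Lpow_primitive[OF q]) (use assms(3) in simp)
  then have "Lpow (Suc (Suc m)) \<gamma> = 0"
    using L\<beta> unfolding dec2 Lpow_add comm by simp
  then have "\<gamma> = 0"
    using hard_lefschetz_inject[OF \<gamma>, of "Suc (Suc m)"] assms(3) by simp
  then have \<beta>q: "\<beta> = q" using dec2 by simp
  have "\<Lambda> \<alpha> = \<Lambda> (\<L> \<beta>)"
    using \<Lambda>_add[of p "\<L> \<beta>"] alt_forms_alternating[OF p(1)]
      alt_forms_alternating[OF \<L>_alt_forms[OF \<beta>]] by (simp add: dec p(2))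
  also have "\<dots> = fscale (real n - real_of_int (j - 1)) q"
    using \<Lambda>_\<L>[OF \<beta>] q(2) by (simp add: \<beta>q)
  finally show ?thesis
    using q by (simp add: \<Lambda>_fscale alt_forms_alternating) (simp add: fscale_def fun_eq_iff fun_apply)
qed

end

section \<open>Smooth functions on subsets of a half space\<close>

lemma Ck_on_cong:
  assumes "open S" "\<And>x. x \<in> S \<Longrightarrow> f x = g x" "Ck_on k f S"
  shows "Ck_on k g S"
  using assms(2,3)
proof (induction k arbitrary: f g)
  case 0
  then show ?case using continuous_on_eq by (metis Ck_on.simps(1))
next
  case (Suc k)
  have d: "g differentiable (at x)" if "x \<in> S" for x
    using Suc.prems that assms(1) has_derivative_transform_within_open[of f _ x UNIV S g]
    unfolding differentiable_def by (metis Suc.prems(1) Ck_on.simps(2) differentiable_def)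
  have "frechet_derivative f (at x) = frechet_derivative g (at x)" if "x \<in> S" for x
    using Suc.prems that assms(1) by (intro frechet_derivative_transform_within_open[of f x S]) auto
  then show ?case
    using Suc d by (auto simp del: Ck_on.simps(1) intro: Suc.IH[rotated])
qed

lemma Ck_on_subset: "Ck_on k f S \<Longrightarrow> T \<subseteq> S \<Longrightarrow> Ck_on k f T"
  by (induction k arbitrary: f) (auto intro: continuous_on_subset)

lemma Ck_on_Suc: "Ck_on (Suc k) f S \<Longrightarrow> Ck_on k f S"
proof (induction k arbitrary: f)
  case 0
  then show ?case
    by (auto intro!: continuous_at_imp_continuous_on differentiable_imp_continuous_within)
next
  case (Suc k)
  then show ?case unfolding Ck_on.simps(2)[of "Suc k"] Ck_on.simps(2)[of k] by blast
qed

lemma Ck_on_const: "Ck_on k (\<lambda>x. c) S"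
  by (induction k arbitrary: c) auto

lemma frechet_derivative_eqI:
  "(f has_derivative f') (at x) \<Longrightarrow> frechet_derivative f (at x) = f'"
  by (rule frechet_derivative_at[symmetric])

lemma Ck_on_SucI:
  assumes "open S" "\<And>x. x \<in> S \<Longrightarrow> (f has_derivative f' x) (at x)" "\<And>v. Ck_on k (\<lambda>x. f' x v) S"
  shows "Ck_on (Suc k) f S"
  unfolding Ck_on.simps
proof (intro conjI allI ballI)
  show "f differentiable (at x)" if "x \<in> S" for x
    using assms(2)[OF that] by (rule differentiableI)
  show "Ck_on k (\<lambda>x. frechet_derivative f (at x) v) S" for v
    by (rule Ck_on_cong[OF assms(1) _ assms(3)[of v]]) (simp add: frechet_derivative_eqI[OF assms(2)])
qed

lemma Ck_on_SucD:
  assumes "Ck_on (Suc k) f S"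
  shows "x \<in> S \<Longrightarrow> (f has_derivative frechet_derivative f (at x)) (at x)"
    and "Ck_on k (\<lambda>x. frechet_derivative f (at x) v) S"
  using assms by (auto simp: frechet_derivative_works)

lemma Ck_on_add: "open S \<Longrightarrow> Ck_on k f S \<Longrightarrow> Ck_on k g S \<Longrightarrow> Ck_on k (\<lambda>x. f x + g x) S"
proof (induction k arbitrary: f g)
  case 0
  then show ?case by (auto intro: continuous_on_add)
next
  case (Suc k)
  show ?case
    by (rule Ck_on_SucI[OF Suc.prems(1) has_derivative_add])
      (use Suc in \<open>auto intro!: Ck_on_SucD simp del: Ck_on.simps\<close>)
qed

lemma Ck_on_mult:
  fixes f g :: "'v::euclidean_space \<Rightarrow> real"
  shows "open S \<Longrightarrow> Ck_on k f S \<Longrightarrow> Ck_on k g S \<Longrightarrow> Ck_on k (\<lambda>x. f x * g x) S"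
proof (induction k arbitrary: f g)
  case 0
  then show ?case by (auto intro: continuous_on_mult)
next
  case (Suc k)
  show ?case
    by (rule Ck_on_SucI[OF Suc.prems(1) has_derivative_mult])
      (use Suc in \<open>auto intro!: Ck_on_SucD Ck_on_add Suc.IH dest: Ck_on_Suc simp del: Ck_on.simps\<close>)
qed

lemma Ck_on_inverse:
  fixes f :: "'v::euclidean_space \<Rightarrow> real"
  assumes "open S" "\<And>x. x \<in> S \<Longrightarrow> f x \<noteq> 0"
  shows "Ck_on k f S \<Longrightarrow> Ck_on k (\<lambda>x. inverse (f x)) S"
proof (induction k)
  case 0
  then show ?case using assms by (auto intro: continuous_on_inverse)
next
  case (Suc k)
  have inv: "Ck_on k (\<lambda>x. inverse (f x)) S"
    using Suc Ck_on_Suc by blast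
  have "((\<lambda>x. inverse (f x)) has_derivative
      (\<lambda>v. - (inverse (f x) * frechet_derivative f (at x) v * inverse (f x)))) (at x)" if "x \<in> S" for x
    using Deriv.has_derivative_inverse[OF assms(2)[OF that] Ck_on_SucD(1)[OF Suc.prems that]] .
  moreover have "Ck_on k (\<lambda>x. -1 * (inverse (f x) * frechet_derivative f (at x) v * inverse (f x))) S" for v
    by (intro Ck_on_mult assms Ck_on_const inv Ck_on_SucD(2)[OF Suc.prems])
  ultimately show ?case
    by (intro Ck_on_SucI[OF assms(1)]) (auto simp del: Ck_on.simps)
qed

lemma Ck_on_bounded_linear:
  assumes "open S" "bounded_linear g"
  shows "Ck_on k f S \<Longrightarrow> Ck_on k (\<lambda>x. g (f x)) S"
proof (induction k arbitrary: f)
  case 0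
  then show ?case using assms(2) by (auto intro: bounded_linear.continuous_on)
next
  case (Suc k)
  show ?case
    by (rule Ck_on_SucI[OF assms(1) bounded_linear.has_derivative[OF assms(2)]])
      (use Suc in \<open>auto intro!: Ck_on_SucD simp del: Ck_on.simps\<close>)
qed

section \<open>Smoothness by local extension\<close>

lemma smooth_onI:
  assumes "\<And>x. x \<in> S \<Longrightarrow>
    \<exists>U F. open U \<and> x \<in> U \<and> (\<forall>k. Ck_on k F U) \<and> (\<forall>y\<in>S \<inter> U. F y = f y)"
  shows "smooth_on S f"
  using assms unfolding smooth_on_def by blast

lemma smooth_on_cong: "(\<And>x. x \<in> S \<Longrightarrow> f x = g x) \<Longrightarrow> smooth_on S f = smooth_on S g"
  unfolding smooth_on_def by simp

lemma smooth_on_const: "smooth_on S (\<lambda>x. c)"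
  by (rule smooth_onI, rule exI[of _ UNIV], rule exI[of _ "\<lambda>x. c"]) (auto simp: Ck_on_const)

lemma smooth_on_binop:
  fixes f g :: "'v::euclidean_space \<Rightarrow> 'w::real_normed_vector"
  assumes "\<And>k U (F :: 'v \<Rightarrow> 'w) G. open U \<Longrightarrow> Ck_on k F U \<Longrightarrow> Ck_on k G U \<Longrightarrow> Ck_on k (\<lambda>x. bop (F x) (G x)) U"
    and "smooth_on S f" "smooth_on S g"
  shows "smooth_on S (\<lambda>x. bop (f x) (g x))"
proof (rule smooth_onI)
  fix x assume "x \<in> S"
  obtain U F where U: "open U" "x \<in> U" "\<And>k. Ck_on k F U" "\<And>y. y \<in> S \<Longrightarrow> y \<in> U \<Longrightarrow> F y = f y"
    using assms(2) \<open>x \<in> S\<close> unfolding smooth_on_def by (metis Int_iff)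
  obtain V G where V: "open V" "x \<in> V" "\<And>k. Ck_on k G V" "\<And>y. y \<in> S \<Longrightarrow> y \<in> V \<Longrightarrow> G y = g y"
    using assms(3) \<open>x \<in> S\<close> unfolding smooth_on_def by (metis Int_iff)
  have "Ck_on k (\<lambda>x. bop (F x) (G x)) (U \<inter> V)" for k
    using U(1,3) V(1,3) by (intro assms(1)) (auto intro: Ck_on_subset)
  then show "\<exists>U F. open U \<and> x \<in> U \<and> (\<forall>k. Ck_on k F U) \<and> (\<forall>y\<in>S \<inter> U. F y = bop (f y) (g y))"
    using U V by (intro exI[of _ "U \<inter> V"] exI[of _ "\<lambda>x. bop (F x) (G x)"]) auto
qed

lemma smooth_on_add: "smooth_on S f \<Longrightarrow> smooth_on S g \<Longrightarrow> smooth_on S (\<lambda>x. f x + g x)"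
  by (rule smooth_on_binop[where bop = "(+)"]) (auto intro: Ck_on_add)

lemma smooth_on_mult: "smooth_on S f \<Longrightarrow> smooth_on S g \<Longrightarrow> smooth_on S (\<lambda>x. f x * g x :: real)"
  by (rule smooth_on_binop[where bop = "(*)"]) (auto intro: Ck_on_mult)

lemma smooth_on_sum: "(\<And>i. i \<in> I \<Longrightarrow> smooth_on S (f i)) \<Longrightarrow> smooth_on S (\<lambda>x. \<Sum>i\<in>I. f i x)"
  by (induction I rule: infinite_finite_induct) (auto intro: smooth_on_add smooth_on_const)

lemma smooth_on_prod: "(\<And>i. i \<in> I \<Longrightarrow> smooth_on S (f i)) \<Longrightarrow> smooth_on S (\<lambda>x. \<Prod>i\<in>I. f i x :: real)"
  by (induction I rule: infinite_finite_induct) (auto intro: smooth_on_mult smooth_on_const)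

lemma smooth_on_inverse:
  fixes f :: "'v::euclidean_space \<Rightarrow> real"
  assumes "smooth_on S f" "\<And>x. x \<in> S \<Longrightarrow> f x \<noteq> 0"
  shows "smooth_on S (\<lambda>x. inverse (f x))"
proof (rule smooth_onI)
  fix x assume x: "x \<in> S"
  obtain U F where U: "open U" "x \<in> U" "\<And>k. Ck_on k F U" "\<And>y. y \<in> S \<Longrightarrow> y \<in> U \<Longrightarrow> F y = f y"
    using assms(1) x unfolding smooth_on_def by (metis Int_iff)
  \<comment> \<open>The extension may vanish outside \<open>S\<close>, so the neighbourhood shrinks
    to the points where it does not.\<close>
  let ?V = "U \<inter> F -` (- {0})"
  have "open ?V"
    using U(1) U(3)[of 0] by (intro continuous_open_preimage) auto
  moreover have "Ck_on k (\<lambda>x. inverse (F x)) ?V" for k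
    using \<open>open ?V\<close> U(3) by (intro Ck_on_inverse) (auto intro: Ck_on_subset)
  ultimately show "\<exists>U G. open U \<and> x \<in> U \<and> (\<forall>k. Ck_on k G U) \<and> (\<forall>y\<in>S \<inter> U. G y = inverse (f y))"
    using U x assms(2) by (intro exI[of _ ?V] exI[of _ "\<lambda>x. inverse (F x)"]) auto
qed

lemma smooth_on_det:
  fixes M :: "'v::euclidean_space \<Rightarrow> real ^ 'm ^ 'm::finite"
  assumes "\<And>i j. smooth_on S (\<lambda>x. M x $ i $ j)"
  shows "smooth_on S (\<lambda>x. det (M x))"
  unfolding det_def by (intro smooth_on_sum smooth_on_mult smooth_on_const smooth_on_prod assms)

text \<open>By Cramer's rule the entries of the inverse are quotients of determinants in the entries
  of \<open>M\<close>. Nothing is assumed about the dependence of \<open>P\<close> on the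
  point.\<close>

lemma smooth_on_left_inverse:
  fixes M P :: "'v::euclidean_space \<Rightarrow> real ^ 'm ^ 'm::finite"
  assumes M: "\<And>i j. smooth_on S (\<lambda>x. M x $ i $ j)" and PM: "\<And>x. x \<in> S \<Longrightarrow> P x ** M x = mat 1"
  shows "smooth_on S (\<lambda>x. P x $ i $ j)"
proof -
  \<comment> \<open>Row \<open>i\<close> of \<open>P x\<close> solves the linear system with matrix
    \<open>transpose (M x)\<close> and right-hand side the \<open>i\<close>-th unit vector;
    \<open>C x\<close> is the Cramer matrix for its \<open>j\<close>-th entry.\<close>
  define C where "C x = (\<chi> r c. if c = j then axis i 1 $ r else transpose (M x) $ r $ c)" for x
  have det: "det (transpose (M x)) \<noteq> 0" and eq: "P x $ i $ j = det (C x) * inverse (det (transpose (M x)))"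
    if "x \<in> S" for x
  proof -
    have "invertible (M x)" using PM[OF that] matrix_left_right_inverse unfolding invertible_def by blast
    then show det: "det (transpose (M x)) \<noteq> 0" by (simp add: invertible_det_nz det_transpose)
    have "transpose (M x) ** transpose (P x) = mat 1"
      using PM[OF that] by (metis matrix_transpose_mul transpose_mat)
    then have "transpose (M x) *v (transpose (P x) *v axis i 1) = axis i 1"
      by (metis matrix_vector_mul_assoc matrix_vector_mul_lid)
    moreover have "transpose (P x) *v axis i 1 = P x $ i"
      by (simp add: vec_eq_iff matrix_vector_mult_basis column_def transpose_def)
    ultimately show "P x $ i $ j = det (C x) * inverse (det (transpose (M x)))"
      using cramer[OF det, of "P x $ i" "axis i 1"] unfolding C_def by (simp add: divide_inverse)
  qed
  have sT: "smooth_on S (\<lambda>x. transpose (M x) $ r $ c)" for r c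
    using M by (simp add: transpose_def)
  have sC: "smooth_on S (\<lambda>x. C x $ r $ c)" for r c
    by (cases "c = j") (simp_all add: C_def smooth_on_const sT)
  have "smooth_on S (\<lambda>x. det (C x) * inverse (det (transpose (M x))))"
    by (intro smooth_on_mult smooth_on_inverse smooth_on_det sC sT det)
  then show ?thesis using eq by (subst smooth_on_cong[OF eq]) auto
qed

section \<open>One-sided derivatives in a half space\<close>

lemma at_within_openin:
  assumes "openin (top_of_set T) S" "x \<in> S"
  shows "at x within S = at x within T"
proof -
  obtain U where U: "open U" "S = T \<inter> U" using assms(1) by (auto simp: openin_open)
  then show ?thesis using assms(2) by (intro at_within_nhd[of x U]) auto
qed

text \<open>Moving from \<open>x\<close> in the positive direction of a basis vector never decreases
  the boundary coordinate, so every basis direction can be tested inside the half space.\<close>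

lemma half_space_derivative_unique:
  fixes f :: "real ^ 'm::finite \<Rightarrow> 'w::real_normed_vector"
  assumes "openin (top_of_set half_space) S" "x \<in> S"
    and "(f has_derivative f') (at x within S)" "(f has_derivative f'') (at x within S)"
  shows "f' = f''"
proof (rule frechet_derivative_unique_within)
  have at: "at x within S = at x within half_space"
    using at_within_openin[OF assms(1,2)] .
  show "(f has_derivative f') (at x within half_space)" "(f has_derivative f'') (at x within half_space)"
    using assms(3,4) at by simp_all
  have x: "0 \<le> x $ bdry_coord"
    using assms(1,2) openin_imp_subset by (fastforce simp: half_space_def)
  fix i :: "real ^ 'm" and e :: real assume "i \<in> Basis" "0 < e"
  then have "0 \<le> i $ bdry_coord" by (auto simp: Basis_vec_def axis_def)
  then have "x + (e / 2) *\<^sub>R i \<in> half_space"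
    using x \<open>0 < e\<close> by (simp add: half_space_def)
  then show "\<exists>d. 0 < \<bar>d\<bar> \<and> \<bar>d\<bar> < e \<and> x + d *\<^sub>R i \<in> half_space"
    using \<open>0 < e\<close> by (intro exI[of _ "e / 2"]) auto
qed

lemma frechet_derivative_half_space:
  fixes f :: "real ^ 'm::finite \<Rightarrow> 'w::real_normed_vector"
  assumes "openin (top_of_set half_space) S" "x \<in> S" "(f has_derivative f') (at x within S)"
  shows "frechet_derivative f (at x within S) = f'"
proof (rule half_space_derivative_unique[OF assms(1,2) _ assms(3)])
  show "(f has_derivative frechet_derivative f (at x within S)) (at x within S)"
    using assms(3) differentiableI frechet_derivative_works by blast
qed

lemma extension_has_derivative:
  assumes "x \<in> S" "open U" "x \<in> U" "Ck_on (Suc 0) F U" "\<And>y. y \<in> S \<Longrightarrow> y \<in> U \<Longrightarrow> F y = f y"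
  shows "(f has_derivative frechet_derivative F (at x)) (at x within S)"
proof -
  have "(F has_derivative frechet_derivative F (at x)) (at x within S)"
    using Ck_on_SucD(1)[OF assms(4,3)] has_derivative_at_withinI by blast
  moreover obtain d where "0 < d" "ball x d \<subseteq> U" using assms(2,3) openE by blast
  ultimately show ?thesis
    using assms(1,5) by (elim has_derivative_transform_within) (auto simp: subset_eq dist_commute)
qed

lemma smooth_on_has_derivative:
  assumes "smooth_on S f" "x \<in> S"
  shows "(f has_derivative frechet_derivative f (at x within S)) (at x within S)"
proof -
  obtain U F where U: "open U" "x \<in> U" "\<And>k. Ck_on k F U" "\<And>y. y \<in> S \<Longrightarrow> y \<in> U \<Longrightarrow> F y = f y"
    using assms unfolding smooth_on_def by (metis Int_iff)
  show ?thesis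
    using extension_has_derivative[OF assms(2) U(1,2,3,4)] differentiableI frechet_derivative_works by blast
qed

text \<open>The derivative of a local extension is a local extension of the one-sided
  derivative.\<close>

lemma smooth_on_frechet_derivative:
  fixes f :: "real ^ 'm::finite \<Rightarrow> 'w::real_normed_vector"
  assumes "openin (top_of_set half_space) S" "smooth_on S f"
  shows "smooth_on S (\<lambda>x. frechet_derivative f (at x within S) v)"
proof (rule smooth_onI)
  fix x assume "x \<in> S"
  obtain U F where U: "open U" "x \<in> U" "\<And>k. Ck_on k F U" "\<And>y. y \<in> S \<Longrightarrow> y \<in> U \<Longrightarrow> F y = f y"
    using assms(2) \<open>x \<in> S\<close> unfolding smooth_on_def by (metis Int_iff)
  have "frechet_derivative f (at y within S) = frechet_derivative F (at y)" if "y \<in> S \<inter> U" for y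
    using that by (intro frechet_derivative_half_space[OF assms(1)] extension_has_derivative[OF _ U(1) _ U(3,4)]) auto
  moreover have "Ck_on k (\<lambda>x. frechet_derivative F (at x) v) U" for k
    using Ck_on_SucD(2)[OF U(3)] .
  ultimately show "\<exists>U F. open U \<and> x \<in> U \<and> (\<forall>k. Ck_on k F U) \<and>
      (\<forall>y\<in>S \<inter> U. F y = frechet_derivative f (at y within S) v)"
    using U(1,2) by (intro exI[of _ U] exI[of _ "\<lambda>x. frechet_derivative F (at x) v"]) auto
qed

section \<open>Symmetry of second derivatives\<close>

lemma second_difference:
  fixes f :: "'v::euclidean_space \<Rightarrow> real"
  assumes "Ck_on (Suc (Suc 0)) f U" "ball x r \<subseteq> U" "0 < t" "t * (norm u + norm v) < r"
  shows "\<exists>y. dist y x \<le> t * (norm u + norm v) \<and>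
    f (x + t *\<^sub>R u + t *\<^sub>R v) - f (x + t *\<^sub>R u) - f (x + t *\<^sub>R v) + f x =
      t * t * frechet_derivative (\<lambda>z. frechet_derivative f (at z) u) (at y) v"
proof -
  let ?fu = "\<lambda>z. frechet_derivative f (at z) u"
  have near: "dist (x + a *\<^sub>R u + b *\<^sub>R v) x \<le> t * (norm u + norm v)"
    if "0 \<le> a" "a \<le> t" "0 \<le> b" "b \<le> t" for a b
  proof -
    have "norm (a *\<^sub>R u + b *\<^sub>R v) \<le> a * norm u + b * norm v"
      using that norm_triangle_ineq[of "a *\<^sub>R u" "b *\<^sub>R v"] by simp
    also have "\<dots> \<le> t * norm u + t * norm v"
      using that by (intro add_mono mult_right_mono) auto
    finally show ?thesis by (simp add: dist_norm algebra_simps)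
  qed
  have inU: "x + a *\<^sub>R u + b *\<^sub>R v \<in> U" if "0 \<le> a" "a \<le> t" "0 \<le> b" "b \<le> t" for a b
    using near[OF that] assms(2,4) by (auto simp: subset_eq dist_commute)
  have line: "((\<lambda>s. F (p + s *\<^sub>R d)) has_real_derivative frechet_derivative F (at (p + s *\<^sub>R d)) d) (at s)"
    if "(F has_derivative frechet_derivative F (at (p + s *\<^sub>R d))) (at (p + s *\<^sub>R d))" for F :: "'v \<Rightarrow> real" and p d s
  proof -
    have "((\<lambda>s. p + s *\<^sub>R d) has_derivative (\<lambda>h. h *\<^sub>R d)) (at s)"
      by (auto intro!: derivative_eq_intros)
    note chain = has_derivative_compose[OF this that]
    have "(\<lambda>h. frechet_derivative F (at (p + s *\<^sub>R d)) (h *\<^sub>R d)) = (*) (frechet_derivative F (at (p + s *\<^sub>R d)) d)"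
      by (rule ext) (simp only: linear_scale[OF has_derivative_linear[OF that]] real_scaleR_def mult.commute)
    then show ?thesis
      using chain by (simp only: has_field_derivative_def)
  qed
  \<comment> \<open>The mean value theorem is applied in direction \<open>u\<close> to the
    difference of \<open>f\<close> in direction \<open>v\<close>, and afterwards in direction
    \<open>v\<close> to the derivative along \<open>u\<close>.\<close>
  have "\<exists>a. 0 < a \<and> a < t \<and> (f (x + t *\<^sub>R v + t *\<^sub>R u) - f (x + t *\<^sub>R u)) - (f (x + t *\<^sub>R v + 0 *\<^sub>R u) - f (x + 0 *\<^sub>R u))
      = (t - 0) * (?fu (x + t *\<^sub>R v + a *\<^sub>R u) - ?fu (x + a *\<^sub>R u))"
  proof (rule MVT2[OF assms(3)])
    fix s assume s: "0 \<le> s" "s \<le> t"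
    have "x + t *\<^sub>R v + s *\<^sub>R u \<in> U" "x + s *\<^sub>R u \<in> U"
      using inU[of s t] inU[of s 0] s assms(3) by (simp_all add: algebra_simps)
    then show "((\<lambda>s. f (x + t *\<^sub>R v + s *\<^sub>R u) - f (x + s *\<^sub>R u)) has_real_derivative
        ?fu (x + t *\<^sub>R v + s *\<^sub>R u) - ?fu (x + s *\<^sub>R u)) (at s)"
      by (intro DERIV_diff line Ck_on_SucD(1)[OF assms(1)])
  qed
  then obtain a where a: "0 < a" "a < t"
    and eq1: "(f (x + t *\<^sub>R v + t *\<^sub>R u) - f (x + t *\<^sub>R u)) - (f (x + t *\<^sub>R v) - f x)
      = t * (?fu (x + t *\<^sub>R v + a *\<^sub>R u) - ?fu (x + a *\<^sub>R u))"
    by auto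
  have "\<exists>b. 0 < b \<and> b < t \<and> ?fu (x + a *\<^sub>R u + t *\<^sub>R v) - ?fu (x + a *\<^sub>R u + 0 *\<^sub>R v)
      = (t - 0) * frechet_derivative ?fu (at (x + a *\<^sub>R u + b *\<^sub>R v)) v"
  proof (rule MVT2[OF assms(3)])
    fix s assume s: "0 \<le> s" "s \<le> t"
    then have "x + a *\<^sub>R u + s *\<^sub>R v \<in> U" using inU a by simp
    then show "((\<lambda>s. ?fu (x + a *\<^sub>R u + s *\<^sub>R v)) has_real_derivative
        frechet_derivative ?fu (at (x + a *\<^sub>R u + s *\<^sub>R v)) v) (at s)"
      by (intro line Ck_on_SucD(1)[OF Ck_on_SucD(2)[OF assms(1)]])
  qed
  then obtain b where b: "0 < b" "b < t"
    and eq2: "?fu (x + a *\<^sub>R u + t *\<^sub>R v) - ?fu (x + a *\<^sub>R u)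
      = t * frechet_derivative ?fu (at (x + a *\<^sub>R u + b *\<^sub>R v)) v"
    by auto
  have "x + t *\<^sub>R v + t *\<^sub>R u = x + t *\<^sub>R u + t *\<^sub>R v" "x + t *\<^sub>R v + a *\<^sub>R u = x + a *\<^sub>R u + t *\<^sub>R v"
    by (simp_all add: algebra_simps)
  then have "f (x + t *\<^sub>R u + t *\<^sub>R v) - f (x + t *\<^sub>R u) - f (x + t *\<^sub>R v) + f x =
      t * t * frechet_derivative ?fu (at (x + a *\<^sub>R u + b *\<^sub>R v)) v"
    using eq1 eq2 by (simp add: algebra_simps)
  then show ?thesis
    using near[of a b] a b by (intro exI[of _ "x + a *\<^sub>R u + b *\<^sub>R v"]) auto
qed

text \<open>The second difference is symmetric in \<open>u\<close> and \<open>v\<close>. Hence the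
  two mixed derivatives agree at some points \<open>y\<close> and \<open>z\<close> arbitrarily near
  \<open>x\<close>, which contradicts continuity if they differ at \<open>x\<close>.\<close>

lemma second_derivative_symmetric_real:
  fixes f :: "'v::euclidean_space \<Rightarrow> real"
  assumes "open U" "x \<in> U" "Ck_on (Suc (Suc 0)) f U"
  shows "frechet_derivative (\<lambda>z. frechet_derivative f (at z) u) (at x) v =
    frechet_derivative (\<lambda>z. frechet_derivative f (at z) v) (at x) u"
proof (rule ccontr)
  define P where "P u v y = frechet_derivative (\<lambda>z. frechet_derivative f (at z) u) (at y) v" for u v y
  have cont: "continuous_on U (P u v)" for u v
    using Ck_on_SucD(2)[OF Ck_on_SucD(2)[OF assms(3)]] by (simp add: P_def)
  assume "\<not> ?thesis"
  then have e: "0 < \<bar>P u v x - P v u x\<bar> / 2" (is "0 < ?e") by (simp add: P_def)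
  obtain d1 where d1: "0 < d1" "\<And>y. y \<in> U \<Longrightarrow> dist y x < d1 \<Longrightarrow> dist (P u v y) (P u v x) < ?e"
    using cont[of u v] assms(2) e unfolding continuous_on_iff by blast
  obtain d2 where d2: "0 < d2" "\<And>y. y \<in> U \<Longrightarrow> dist y x < d2 \<Longrightarrow> dist (P v u y) (P v u x) < ?e"
    using cont[of v u] assms(2) e unfolding continuous_on_iff by blast
  obtain r where r: "0 < r" "ball x r \<subseteq> U" using assms(1,2) openE by blast
  define m where "m = min r (min d1 d2)"
  have m: "0 < m" "m \<le> r" "m \<le> d1" "m \<le> d2" using d1 d2 r by (auto simp: m_def)
  \<comment> \<open>Chosen such that \<open>t * (norm u + norm v)\<close> is at most
    \<open>m / 2\<close>; the summand \<open>1\<close> keeps the denominator positive.\<close>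
  define t where "t = m / (2 * (norm u + norm v + 1))"
  have t: "0 < t" using m by (simp add: t_def add_nonneg_pos)
  have "t * (norm u + norm v) \<le> t * (norm u + norm v + 1)" using t by simp
  also have "\<dots> = m / 2" by (simp add: t_def add_nonneg_pos divide_simps) (smt (verit) norm_ge_zero)
  finally have tm: "t * (norm u + norm v) < m" using m by simp
  obtain y where y: "dist y x \<le> t * (norm u + norm v)"
    "f (x + t *\<^sub>R u + t *\<^sub>R v) - f (x + t *\<^sub>R u) - f (x + t *\<^sub>R v) + f x = t * t * P u v y"
    using second_difference[OF assms(3) r(2) t, of u v] tm m unfolding P_def by auto
  obtain z where z: "dist z x \<le> t * (norm v + norm u)"
    "f (x + t *\<^sub>R v + t *\<^sub>R u) - f (x + t *\<^sub>R v) - f (x + t *\<^sub>R u) + f x = t * t * P v u z"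
    using second_difference[OF assms(3) r(2) t, of v u] tm m unfolding P_def by (auto simp: add.commute)
  have xuv: "x + t *\<^sub>R v + t *\<^sub>R u = x + t *\<^sub>R u + t *\<^sub>R v" by (simp add: algebra_simps)
  have "t * t * P u v y = t * t * P v u z" using y(2) z(2) unfolding xuv by linarith
  then have eq: "P u v y = P v u z" using t by simp
  have y': "dist y x < m" and z': "dist z x < m" using y(1) z(1) tm by (simp_all add: add.commute)
  then have "y \<in> U" "z \<in> U" using r m by (auto simp: subset_eq dist_commute)
  then have "dist (P u v y) (P u v x) < ?e" "dist (P v u z) (P v u x) < ?e"
    using d1(2)[of y] d2(2)[of z] y' z' m by auto
  moreover have "dist (P u v x) (P v u x) \<le> dist (P u v y) (P u v x) + dist (P v u z) (P v u x)"
    unfolding eq by (metis dist_commute dist_triangle)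
  ultimately show False by (simp add: dist_real_def)
qed

lemma second_derivative_symmetric:
  fixes f :: "'v::euclidean_space \<Rightarrow> real ^ 'm::finite"
  assumes "open U" "x \<in> U" "Ck_on (Suc (Suc 0)) f U"
  shows "frechet_derivative (\<lambda>z. frechet_derivative f (at z) u) (at x) v =
    frechet_derivative (\<lambda>z. frechet_derivative f (at z) v) (at x) u"
proof (rule vec_eq_iff[THEN iffD2], rule allI)
  fix i
  let ?g = "\<lambda>z. f z $ i"
  have bl: "bounded_linear (\<lambda>y :: real ^ 'm. y $ i)" by (rule bounded_linear_vec_nth)
  have g: "Ck_on (Suc (Suc 0)) ?g U" by (rule Ck_on_bounded_linear[OF assms(1) bl assms(3)])
  have 1: "frechet_derivative ?g (at z) w = frechet_derivative f (at z) w $ i" if "z \<in> U" for z w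
    using frechet_derivative_eqI[OF bounded_linear.has_derivative[OF bl Ck_on_SucD(1)[OF assms(3) that]]]
    by simp
  have 2: "frechet_derivative (\<lambda>z. frechet_derivative ?g (at z) w) (at x) w' =
      frechet_derivative (\<lambda>z. frechet_derivative f (at z) w) (at x) w' $ i" for w w'
  proof -
    have "((\<lambda>z. frechet_derivative f (at z) w $ i) has_derivative
        (\<lambda>w'. frechet_derivative (\<lambda>z. frechet_derivative f (at z) w) (at x) w' $ i)) (at x)"
      by (rule bounded_linear.has_derivative[OF bl Ck_on_SucD(1)[OF Ck_on_SucD(2)[OF assms(3)] assms(2)]])
    then have "((\<lambda>z. frechet_derivative ?g (at z) w) has_derivative
        (\<lambda>w'. frechet_derivative (\<lambda>z. frechet_derivative f (at z) w) (at x) w' $ i)) (at x)"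
      by (rule has_derivative_transform_within_open[OF _ assms(1,2)]) (simp add: 1)
    from frechet_derivative_eqI[OF this] show ?thesis by simp
  qed
  show "frechet_derivative (\<lambda>z. frechet_derivative f (at z) u) (at x) v $ i =
      frechet_derivative (\<lambda>z. frechet_derivative f (at z) v) (at x) u $ i"
    unfolding 2[symmetric] by (rule second_derivative_symmetric_real[OF assms(1,2) g])
qed

text \<open>The second derivative is that of a smooth extension, so it is symmetric at boundary
  points too.\<close>

lemma smooth_on_second_derivative:
  fixes f :: "real ^ 'm::finite \<Rightarrow> real ^ 'k::finite"
  assumes "openin (top_of_set half_space) S" "smooth_on S f" "x \<in> S"
  obtains B where "\<And>v. ((\<lambda>z. frechet_derivative f (at z within S) v) has_derivative (\<lambda>u. B u v)) (at x within S)"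
    "\<And>u v. B u v = B v u"
proof -
  obtain U F where U: "open U" "x \<in> U" "\<And>k. Ck_on k F U" "\<And>y. y \<in> S \<Longrightarrow> y \<in> U \<Longrightarrow> F y = f y"
    using assms(2,3) unfolding smooth_on_def by (metis Int_iff)
  define B where "B u v = frechet_derivative (\<lambda>z. frechet_derivative F (at z) v) (at x) u" for u v
  show ?thesis
  proof (rule that)
    show "B u v = B v u" for u v
      unfolding B_def by (rule second_derivative_symmetric[OF U(1,2,3)])
    show "((\<lambda>z. frechet_derivative f (at z within S) v) has_derivative (\<lambda>u. B u v)) (at x within S)" for v
      unfolding B_def
    proof (rule extension_has_derivative[OF assms(3) U(1,2)])
      show "Ck_on (Suc 0) (\<lambda>z. frechet_derivative F (at z) v) U" by (rule Ck_on_SucD(2)[OF U(3)])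
      show "frechet_derivative F (at y) v = frechet_derivative f (at y within S) v" if "y \<in> S" "y \<in> U" for y
        using frechet_derivative_half_space[OF assms(1) that(1) extension_has_derivative[OF that(1) U(1) that(2) U(3,4)]]
        by simp
    qed
  qed
qed

section \<open>Antisymmetrized derivatives\<close>

text \<open>With \<open>D u\<close> the derivative of a form in direction \<open>u\<close>, this is
  its exterior derivative at a point, freed from charts.\<close>

definition alt_sum :: "('v \<Rightarrow> 'v list \<Rightarrow> real) \<Rightarrow> 'v list \<Rightarrow> real" where
  "alt_sum D vs = (\<Sum>i<length vs. (-1) ^ i * D (vs ! i) (nths vs (- {i})))"

lemma alt_sum_Nil [simp]: "alt_sum D [] = 0"
  by (simp add: alt_sum_def)

text \<open>Cartan's formula for a constant vector field \<open>v\<close>, which makes induction on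
  the argument list possible for \<open>d\<close>.\<close>

lemma alt_sum_Cons: "alt_sum D (v # vs) = D v vs - alt_sum (\<lambda>u. contract v (D u)) vs"
proof -
  have "nths (v # vs) (- {0}) = vs" "nths (v # vs) (- {Suc i}) = v # nths vs (- {i})" for i
    by (auto simp: nths_Cons nths_all intro!: arg_cong[of _ _ "nths vs"])
  then show ?thesis
    by (simp add: alt_sum_def sum.lessThan_Suc_shift contract_apply sum_negf del: sum.lessThan_Suc)
qed

lemma alt_sum_add: "alt_sum (\<lambda>u. D u + E u) = alt_sum D + alt_sum E"
  and alt_sum_uminus: "alt_sum (\<lambda>u. - D u) = - alt_sum D"
  and alt_sum_fscale: "alt_sum (\<lambda>u. fscale r (D u)) = fscale r (alt_sum D)"
  by (simp_all add: fun_eq_iff alt_sum_def fun_apply fscale_def sum_negf sum.distrib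
      sum_distrib_left algebra_simps)

lemma contract_alt_sum: "contract v (alt_sum D) = D v - alt_sum (\<lambda>u. contract v (D u))"
  by (simp add: fun_eq_iff fun_apply contract_apply alt_sum_Cons)

lemma alt_sum_grade_inv: "alt_sum (\<lambda>u. grade_inv (D u)) = - grade_inv (alt_sum D)"
proof -
  have "length (nths vs (- {i})) = length vs - 1" if "i < length vs" for vs :: "'a list" and i
  proof -
    have "{j. j < length vs \<and> j \<in> - {i}} = {..<length vs} - {i}" by auto
    then show ?thesis using that by (simp add: length_nths)
  qed
  moreover have "(-1 :: real) ^ length vs = - ((-1) ^ (length vs - 1))" if "i < length vs" for i and vs :: "'a list"
    using that by (cases vs) auto
  ultimately show ?thesis
    by (auto simp: fun_eq_iff alt_sum_def fun_apply grade_inv_def sum_distrib_left mult_ac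
        intro!: sum.cong simp flip: sum_negf)
qed

text \<open>The half of the Leibniz rule in which the second factor is differentiated; the sign
  comes from moving the direction of differentiation past \<open>\<alpha>\<close>.\<close>

lemma alt_sum_wedge_right: "alt_sum (\<lambda>u. wedge \<alpha> (D u)) vs = wedge (grade_inv \<alpha>) (alt_sum D) vs"
proof (induction vs arbitrary: \<alpha> D)
  case Nil
  then show ?case by simp
next
  case (Cons v vs)
  have "alt_sum (\<lambda>u. wedge \<alpha> (D u)) (v # vs) = wedge \<alpha> (D v) vs -
     (alt_sum (\<lambda>u. wedge (contract v \<alpha>) (D u)) vs +
      alt_sum (\<lambda>u. wedge (grade_inv \<alpha>) (contract v (D u))) vs)"
    by (simp add: alt_sum_Cons contract_wedge alt_sum_add fun_apply)
  then show ?case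
    by (simp add: Cons.IH wedge_Cons contract_grade_inv contract_alt_sum wedge_diff_right
        wedge_uminus_left) (simp add: fun_apply)
qed

lemma alt_sum_wedge_left: "alt_sum (\<lambda>u. wedge (D u) \<gamma>) vs = wedge (alt_sum D) \<gamma> vs"
proof (induction vs arbitrary: \<gamma> D)
  case Nil
  then show ?case by simp
next
  case (Cons v vs)
  have "alt_sum (\<lambda>u. wedge (D u) \<gamma>) (v # vs) = wedge (D v) \<gamma> vs -
     (alt_sum (\<lambda>u. wedge (contract v (D u)) \<gamma>) vs +
      alt_sum (\<lambda>u. wedge (grade_inv (D u)) (contract v \<gamma>)) vs)"
    by (simp add: alt_sum_Cons contract_wedge alt_sum_add fun_apply)
  then show ?case
    by (simp add: Cons.IH wedge_Cons alt_sum_grade_inv contract_alt_sum wedge_diff_left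
        wedge_uminus_left) (simp add: fun_apply)
qed

definition linear_family :: "('v::real_vector \<Rightarrow> 'v list \<Rightarrow> real) \<Rightarrow> bool" where
  "linear_family D \<longleftrightarrow> (\<forall>ws. linear (\<lambda>u. D u ws))"

lemma linear_family_contract: "linear_family D \<Longrightarrow> linear_family (\<lambda>u. contract v (D u))"
  by (simp add: linear_family_def contract_apply)

lemma multilin_alt_sum:
  assumes "linear_family D" "\<And>u. multilin (D u)"
  shows "multilin (alt_sum D)"
proof -
  have "linear (\<lambda>x. alt_sum D (us @ x # vs))" for us vs
    using assms
  proof (induction us arbitrary: D)
    case Nil
    have c: "contract (x + y) (D u) = contract x (D u) + contract y (D u)"
      "contract (r *\<^sub>R x) (D u) = fscale r (contract x (D u))" for x y r u
      using linear_contract[OF Nil.prems(2)] by auto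
    have l: "D (x + y) vs = D x vs + D y vs" "D (r *\<^sub>R x) vs = r * D x vs" for x y r
      using Nil.prems(1) by (auto simp: linear_family_def linear_iff)
    show ?case
      unfolding linear_iff append_Nil alt_sum_Cons c alt_sum_add alt_sum_fscale l
      by (simp add: fun_apply fscale_def algebra_simps)
  next
    case (Cons u us)
    have "linear (\<lambda>x. D u (us @ x # vs))" using Cons.prems(2) multilin_linear by blast
    moreover have "linear (\<lambda>x. alt_sum (\<lambda>v. contract u (D v)) (us @ x # vs))"
      by (intro Cons.IH linear_family_contract multilin_contract Cons.prems)
    ultimately show ?case
      unfolding append_Cons alt_sum_Cons by (rule linear_compose_sub)
  qed
  then show ?thesis by (simp add: multilin_def)
qed

lemma alternating_alt_sum:
  assumes "linear_family D" "\<And>u. alternating (D u)"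
  shows "alternating (alt_sum D)"
proof (rule alternatingI)
  show "multilin (alt_sum D)"
    using assms alternating_multilin by (intro multilin_alt_sum) auto
  show "alt_sum D (us @ x # x # vs) = 0" for us x vs
    using assms(2)
  proof (induction us arbitrary: D)
    case Nil
    then show ?case
      using alternating_adjacent[OF Nil, of _ "[]"]
      by (simp add: alt_sum_Cons contract_contract_self) (simp add: alt_sum_def fun_apply contract_apply)
  next
    case (Cons u us)
    then show ?case
      by (simp add: alt_sum_Cons alternating_adjacent alternating_contract)
  qed
qed

lemma alt_sum_alt_forms:
  assumes "linear_family D" "\<And>u. D u \<in> alt_forms k"
  shows "alt_sum D \<in> alt_forms (k + 1)"
proof (rule alt_formsI)
  show "alternating (alt_sum D)"
    using assms alternating_alt_sum alt_forms_alternating by blast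
  show "alt_sum D vs = 0" if len: "int (length vs) \<noteq> k + 1" for vs
  proof -
    have "D (vs ! i) (nths vs (- {i})) = 0" if "i < length vs" for i
    proof -
      have "{j. j < length vs \<and> j \<in> - {i}} = {..<length vs} - {i}" by auto
      then have "length (nths vs (- {i})) = length vs - 1" using that by (simp add: length_nths)
      then show ?thesis using len that by (intro alt_forms_length[OF assms(2)]) auto
    qed
    then show ?thesis by (simp add: alt_sum_def)
  qed
qed

section \<open>Antisymmetrization and changes of coordinates\<close>

lemma alt_sum_map: "alt_sum D (map T vs) = alt_sum (\<lambda>u ws. D (T u) (map T ws)) vs"
  by (simp add: alt_sum_def nths_map)

text \<open>The derivative of \<open>\<alpha> (T v\<^sub>1, \<dots>, T v\<^sub>k)\<close> when \<open>T\<close> varies with derivative \<open>b\<close>.\<close>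

fun slot_deriv ::
  "('v list \<Rightarrow> real) \<Rightarrow> ('v \<Rightarrow> 'v) \<Rightarrow> ('v \<Rightarrow> 'v) \<Rightarrow> 'v list \<Rightarrow> real" where
  "slot_deriv \<alpha> T b [] = 0"
| "slot_deriv \<alpha> T b (v # vs) = \<alpha> (b v # map T vs) + slot_deriv (contract (T v) \<alpha>) T b vs"

text \<open>The sign \<open>(-1) ^ i\<close> is what it takes to move \<open>B v (vs ! i)\<close>
  from the front into slot \<open>i\<close>.\<close>

lemma alt_sum_contract_symmetric:
  assumes "alternating \<alpha>" and sym: "\<And>u v. B u v = B v u"
  shows "alt_sum (\<lambda>u ws. \<alpha> (B u v # map T ws)) vs = slot_deriv \<alpha> T (B v) vs"
  using assms(1)
proof (induction vs arbitrary: \<alpha>)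
  case Nil
  then show ?case by simp
next
  case (Cons w vs)
  have "contract w (\<lambda>ws. \<alpha> (B u v # map T ws)) = - (\<lambda>ws. contract (T w) \<alpha> (B u v # map T ws))" for u
    using alternating_swap[OF Cons.prems, of "[]" "B u v" "T w"]
    by (simp add: fun_eq_iff fun_apply contract_apply)
  then show ?case
    using Cons.IH[OF alternating_contract[OF Cons.prems], of "T w"]
    by (simp add: alt_sum_Cons alt_sum_uminus sym[of w v]) (simp add: fun_apply)
qed

text \<open>For the head \<open>v\<close>, the terms with \<open>B u v\<close> in the first slot add
  up to \<open>slot_deriv \<alpha> T (B v)\<close> by the preceding lemma. This cancels the
  contribution with direction \<open>v\<close>, and what remains is the same sum for
  \<open>contract (T v) \<alpha>\<close>.\<close>

lemma alt_sum_slot_deriv: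
  assumes "alternating \<alpha>" and sym: "\<And>u v. B u v = B v u"
  shows "alt_sum (\<lambda>u. slot_deriv \<alpha> T (B u)) vs = 0"
  using assms(1)
proof (induction vs arbitrary: \<alpha>)
  case Nil
  then show ?case by simp
next
  case (Cons v vs)
  have "contract v (slot_deriv \<alpha> T (B u)) = (\<lambda>ws. \<alpha> (B u v # map T ws)) + slot_deriv (contract (T v) \<alpha>) T (B u)" for u
    by (simp add: fun_eq_iff fun_apply contract_apply)
  then show ?case
    using Cons.IH[OF alternating_contract[OF Cons.prems], of "T v"] alt_sum_contract_symmetric[where B = B and T = T and v = v and vs = vs, OF Cons.prems sym]
    by (simp add: alt_sum_Cons alt_sum_add) (simp add: fun_apply)
qed

text \<open>Expanding \<open>a y\<close> in the standard basis reduces this to the product rule,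
  since \<open>f\<close> is then only differentiated at fixed vectors.\<close>

lemma has_derivative_linear_slot:
  fixes f :: "'x::real_normed_vector \<Rightarrow> real ^ 'm::finite \<Rightarrow> real"
  assumes lin: "\<And>y. y \<in> S \<Longrightarrow> linear (f y)" "\<And>u. linear (f' u)"
    and f: "\<And>z. ((\<lambda>y. f y z) has_derivative (\<lambda>u. f' u z)) (at x within S)"
    and a: "(a has_derivative a') (at x within S)" and x: "x \<in> S"
  shows "((\<lambda>y. f y (a y)) has_derivative (\<lambda>u. f' u (a x) + f x (a' u))) (at x within S)"
proof -
  have expand: "l z = (\<Sum>b\<in>Basis. (z \<bullet> b) * l b)" if "linear l" for l :: "real ^ 'm \<Rightarrow> real" and z
    using linear_sum[OF that, of "\<lambda>b. (z \<bullet> b) *\<^sub>R b" Basis]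
    by (simp add: euclidean_representation linear_scale[OF that])
  have "((\<lambda>y. \<Sum>b\<in>Basis. (a y \<bullet> b) * f y b) has_derivative
      (\<lambda>u. \<Sum>b\<in>Basis. (a x \<bullet> b) * f' u b + (a' u \<bullet> b) * f x b)) (at x within S)"
    by (intro has_derivative_sum has_derivative_mult f has_derivative_inner_left a)
  moreover have "(\<Sum>b\<in>Basis. (a x \<bullet> b) * f' u b + (a' u \<bullet> b) * f x b) = f' u (a x) + f x (a' u)" for u
    unfolding sum.distrib expand[OF lin(2), symmetric] expand[OF lin(1)[OF x], symmetric] ..
  ultimately have "((\<lambda>y. \<Sum>b\<in>Basis. (a y \<bullet> b) * f y b) has_derivative
      (\<lambda>u. f' u (a x) + f x (a' u))) (at x within S)"
    by simp
  then show ?thesis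
    by (rule has_derivative_transform[OF x, rotated]) (rule expand[OF lin(1)])
qed

text \<open>The head of the list is contracted into the form. The induction hypothesis then concerns
  a form whose derivative has the extra term \<open>contract (B u v) (f x)\<close>.\<close>

lemma has_derivative_multilinear_map:
  fixes f :: "'x::real_normed_vector \<Rightarrow> (real ^ 'm::finite) list \<Rightarrow> real"
  assumes "\<And>y. y \<in> S \<Longrightarrow> multilin (f y)" "\<And>u. multilin (f' u)"
    and "\<And>ws. ((\<lambda>y. f y ws) has_derivative (\<lambda>u. f' u ws)) (at x within S)"
    and T: "\<And>v. ((\<lambda>y. T y v) has_derivative (\<lambda>u. B u v)) (at x within S)" and x: "x \<in> S"
  shows "((\<lambda>y. f y (map (T y) vs)) has_derivative
    (\<lambda>u. f' u (map (T x) vs) + slot_deriv (f x) (T x) (B u) vs)) (at x within S)"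
  using assms(1-3)
proof (induction vs arbitrary: f f')
  case Nil
  then show ?case by simp
next
  case (Cons v vs)
  let ?f = "\<lambda>y. contract (T y v) (f y)"
  let ?f' = "\<lambda>u. contract (T x v) (f' u) + contract (B u v) (f x)"
  have "((\<lambda>y. ?f y (map (T y) vs)) has_derivative
    (\<lambda>u. ?f' u (map (T x) vs) + slot_deriv (?f x) (T x) (B u) vs)) (at x within S)"
  proof (rule Cons.IH)
    show "multilin (?f y)" if "y \<in> S" for y
      using Cons.prems(1)[OF that] by (rule multilin_contract)
    show "multilin (?f' u)" for u
      by (intro multilin_add multilin_contract Cons.prems(1,2) x)
    show "((\<lambda>y. ?f y ws) has_derivative (\<lambda>u. ?f' u ws)) (at x within S)" for ws
      unfolding contract_apply fun_apply
    proof (rule has_derivative_linear_slot[where f = "\<lambda>y z. f y (z # ws)" and f' = "\<lambda>u z. f' u (z # ws)"])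
      show "linear (\<lambda>z. f y (z # ws))" if "y \<in> S" for y
        using multilin_linear[where us = "[]", OF Cons.prems(1)[OF that]] by simp
      show "linear (\<lambda>z. f' u (z # ws))" for u
        using multilin_linear[where us = "[]", OF Cons.prems(2)] by simp
    qed (use Cons.prems T x in auto)
  qed
  then show ?case
    by (simp add: contract_apply fun_apply add.assoc)
qed

section \<open>Forms on a manifold with boundary\<close>

locale atlas_manifold =
  fixes X :: "'a topology" and A :: "('a, 'm::finite) atlas"
  assumes manifold: "manifold_with_boundary X A"
begin

section \<open>Charts and spaces of forms\<close>

lemma chart_img_openin: "c \<in> A \<Longrightarrow> openin (top_of_set half_space) (chart_img c)"
  and chart_dom_openin: "c \<in> A \<Longrightarrow> openin X (chart_dom c)"
  and chart_homeomorphic: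
    "c \<in> A \<Longrightarrow> homeomorphic_map (subtopology X (chart_dom c)) (top_of_set (chart_img c)) (snd c)"
  and transition_smooth: "c \<in> A \<Longrightarrow> c' \<in> A \<Longrightarrow>
    smooth_on (snd c ` (chart_dom c \<inter> chart_dom c')) (snd c' \<circ> chart_inv c)"
  using manifold by (auto simp: manifold_with_boundary_def)

lemma chart_inj: "c \<in> A \<Longrightarrow> inj_on (snd c) (chart_dom c)"
  using homeomorphic_imp_injective_map[OF chart_homeomorphic[of c]] openin_subset[OF chart_dom_openin[of c]]
  by (simp add: Int_absorb1)

lemma chart_inv_chart: "c \<in> A \<Longrightarrow> p \<in> chart_dom c \<Longrightarrow> chart_inv c (snd c p) = p"
  using chart_inj by simp

lemma overlap_openin:
  assumes "c \<in> A" "c' \<in> A"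
  shows "openin (top_of_set half_space) (snd c ` (chart_dom c \<inter> chart_dom c'))"
proof -
  have "openin (subtopology X (chart_dom c)) (chart_dom c \<inter> chart_dom c')"
    using chart_dom_openin[OF assms(1)] chart_dom_openin[OF assms(2)]
    by (auto simp: openin_open_subtopology openin_Int)
  then have "openin (top_of_set (chart_img c)) (snd c ` (chart_dom c \<inter> chart_dom c'))"
    using homeomorphic_imp_open_map[OF chart_homeomorphic[OF assms(1)]] by (simp add: open_map_def)
  then show ?thesis using openin_trans chart_img_openin[OF assms(1)] by blast
qed

lemma OmegaD:
  assumes "\<eta> \<in> Omega A k"
  shows "\<not> (c \<in> A \<and> p \<in> chart_dom c) \<Longrightarrow> \<eta> p c = 0"
    and "c \<in> A \<Longrightarrow> p \<in> chart_dom c \<Longrightarrow> \<eta> p c \<in> alt_forms k"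
    and "c \<in> A \<Longrightarrow> c' \<in> A \<Longrightarrow> p \<in> chart_dom c \<Longrightarrow> p \<in> chart_dom c' \<Longrightarrow>
      \<eta> p c' (map (transition_deriv c c' p) vs) = \<eta> p c vs"
    and "c \<in> A \<Longrightarrow> smooth_on (chart_img c) (\<lambda>x. \<eta> (chart_inv c x) c vs)"
  using assms unfolding Omega_def by blast+

lemma OmegaI:
  assumes "\<And>p c. \<not> (c \<in> A \<and> p \<in> chart_dom c) \<Longrightarrow> \<eta> p c = 0"
    and "\<And>p c. c \<in> A \<Longrightarrow> p \<in> chart_dom c \<Longrightarrow> \<eta> p c \<in> alt_forms k"
    and "\<And>p c c' vs. c \<in> A \<Longrightarrow> c' \<in> A \<Longrightarrow> p \<in> chart_dom c \<Longrightarrow> p \<in> chart_dom c' \<Longrightarrow>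
      \<eta> p c' (map (transition_deriv c c' p) vs) = \<eta> p c vs"
    and "\<And>c vs. c \<in> A \<Longrightarrow> smooth_on (chart_img c) (\<lambda>x. \<eta> (chart_inv c x) c vs)"
  shows "\<eta> \<in> Omega A k"
  using assms unfolding Omega_def by blast

lemma Omega_eqI:
  assumes "\<eta> \<in> Omega A k" "\<zeta> \<in> Omega A l"
    and "\<And>p c. c \<in> A \<Longrightarrow> p \<in> chart_dom c \<Longrightarrow> \<eta> p c = \<zeta> p c"
  shows "\<eta> = \<zeta>"
  using assms(3) OmegaD(1)[OF assms(1)] OmegaD(1)[OF assms(2)] by (intro ext) metis

lemma Omega_zero: "0 \<in> Omega A k"
  by (rule OmegaI) (simp_all add: zero_fun_apply smooth_on_const)

lemma Omega_add:
  assumes "\<eta> \<in> Omega A k" "\<zeta> \<in> Omega A k"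
  shows "\<eta> + \<zeta> \<in> Omega A k"
  using OmegaD[OF assms(1)] OmegaD[OF assms(2)]
  by (intro OmegaI) (simp_all add: fun_apply alt_forms_add smooth_on_add)

lemma Omega_sum: "(\<And>i. i \<in> I \<Longrightarrow> f i \<in> Omega A k) \<Longrightarrow> sum f I \<in> Omega A k"
  by (induction I rule: infinite_finite_induct) (auto intro: Omega_add Omega_zero)

lemma fun_scale_apply: "fun_scale f \<eta> p c = fscale (f p) (\<eta> p c)"
  by (simp add: fun_scale_def fscale_def fun_eq_iff)

lemma Omega_fun_scale:
  assumes "smooth_function A f" "\<eta> \<in> Omega A k"
  shows "fun_scale f \<eta> \<in> Omega A k"
proof (rule OmegaI)
  show "smooth_on (chart_img c) (\<lambda>x. fun_scale f \<eta> (chart_inv c x) c vs)" if "c \<in> A" for c vs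
    using smooth_on_mult[of "chart_img c" "f \<circ> chart_inv c" "\<lambda>x. \<eta> (chart_inv c x) c vs"]
      assms(1) that OmegaD(4)[OF assms(2) that]
    by (simp add: smooth_function_def fun_scale_def o_def)
qed (use OmegaD[OF assms(2)] in \<open>simp_all add: fun_scale_apply alt_forms_fscale\<close>,
     simp_all add: fscale_def fun_eq_iff fun_apply)

lemma smooth_function_const: "smooth_function A (\<lambda>_. r)"
  by (simp add: smooth_function_def o_def smooth_on_const)

lemma Omega_diff:
  assumes "\<eta> \<in> Omega A k" "\<zeta> \<in> Omega A k"
  shows "\<eta> - \<zeta> \<in> Omega A k"
proof -
  have "\<eta> - \<zeta> = \<eta> + fun_scale (\<lambda>_. -1) \<zeta>"
    by (simp add: fun_eq_iff fun_apply fun_scale_def)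
  then show ?thesis
    using Omega_add[OF assms(1) Omega_fun_scale[OF smooth_function_const assms(2)]] by (simp only:)
qed

section \<open>Coordinate derivatives and the exterior derivative\<close>

abbreviation cderiv ::
  "('a, 'm) chart \<Rightarrow> 'a \<Rightarrow> ('a, 'm) form \<Rightarrow> real ^ 'm \<Rightarrow> (real ^ 'm) list \<Rightarrow> real" where
  "cderiv c p \<eta> u ws \<equiv>
     frechet_derivative (\<lambda>x. \<eta> (chart_inv c x) c ws) (at (snd c p) within chart_img c) u"

lemma has_derivative_cderiv:
  assumes "\<eta> \<in> Omega A k" "c \<in> A" "p \<in> chart_dom c"
  shows "((\<lambda>x. \<eta> (chart_inv c x) c ws) has_derivative (\<lambda>u. cderiv c p \<eta> u ws))
    (at (snd c p) within chart_img c)"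
  using smooth_on_has_derivative[OF OmegaD(4)[OF assms(1,2)], of "snd c p"] assms(3) by simp

lemma cderiv_eqI:
  assumes "c \<in> A" "p \<in> chart_dom c"
    and "((\<lambda>x. \<eta> (chart_inv c x) c ws) has_derivative f') (at (snd c p) within chart_img c)"
  shows "cderiv c p \<eta> u ws = f' u"
  using frechet_derivative_half_space[OF chart_img_openin[OF assms(1)] _ assms(3)] assms(2) by simp

lemma linear_family_cderiv:
  assumes "\<eta> \<in> Omega A k" "c \<in> A" "p \<in> chart_dom c"
  shows "linear_family (cderiv c p \<eta>)"
  using has_derivative_linear[OF has_derivative_cderiv[OF assms]] by (simp add: linear_family_def)

text \<open>The identities that characterize an alternating form of degree \<open>k\<close> are
  linear in the form, so they pass to the derivative by uniqueness of one-sided derivatives.\<close>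

lemma cderiv_alt_forms:
  assumes "\<eta> \<in> Omega A k" "c \<in> A" "p \<in> chart_dom c"
  shows "cderiv c p \<eta> u \<in> alt_forms k"
proof -
  note hd = has_derivative_cderiv[OF assms]
  have alt: "\<eta> (chart_inv c x) c \<in> alt_forms k" if "x \<in> chart_img c" for x
    using OmegaD(2)[OF assms(1,2)] that inv_into_into by metis
  have zero: "cderiv c p \<eta> u ws = 0" if "\<And>x. x \<in> chart_img c \<Longrightarrow> \<eta> (chart_inv c x) c ws = 0" for ws
  proof (rule cderiv_eqI[OF assms(2,3)])
    show "((\<lambda>x. \<eta> (chart_inv c x) c ws) has_derivative (\<lambda>_. 0)) (at (snd c p) within chart_img c)"
      by (rule has_derivative_transform[OF _ _ has_derivative_const[of 0]]) (use assms(3) that in auto)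
  qed
  have lin: "linear (\<lambda>z. \<eta> (chart_inv c x) c (us @ z # vs))" if "x \<in> chart_img c" for x us vs
    using multilin_linear[OF alternating_multilin[OF alt_forms_alternating[OF alt[OF that]]]] .
  have "linear (\<lambda>z. cderiv c p \<eta> u (us @ z # vs))" for us vs
  proof (rule linearI)
    fix y z r
    show "cderiv c p \<eta> u (us @ (y + z) # vs) = cderiv c p \<eta> u (us @ y # vs) + cderiv c p \<eta> u (us @ z # vs)"
      by (rule cderiv_eqI[OF assms(2,3)],
          rule has_derivative_transform[OF _ _ has_derivative_add[OF hd hd]])
        (use assms(3) linear_add[OF lin] in auto)
    show "cderiv c p \<eta> u (us @ (r *\<^sub>R z) # vs) = r *\<^sub>R cderiv c p \<eta> u (us @ z # vs)"
      by (rule cderiv_eqI[OF assms(2,3)],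
          rule has_derivative_transform[OF _ _ has_derivative_scaleR_right[OF hd]])
        (use assms(3) linear_scale[OF lin] in auto)
  qed
  then have "multilin (cderiv c p \<eta> u)" by (simp add: multilin_def)
  moreover have "cderiv c p \<eta> u (us @ z # z # vs) = 0" for us vs z
    using alt alternating_adjacent alt_forms_alternating by (intro zero) blast
  moreover have "cderiv c p \<eta> u vs = 0" if "int (length vs) \<noteq> k" for vs
    using alt alt_forms_length that by (intro zero) blast
  ultimately show ?thesis by (intro alt_formsI alternatingI)
qed

lemma ext_d_eq: "c \<in> A \<Longrightarrow> p \<in> chart_dom c \<Longrightarrow> ext_d A \<eta> p c = alt_sum (cderiv c p \<eta>)"
  by (simp add: ext_d_def alt_sum_def fun_eq_iff)

text \<open>
  In the chain rule for a change of charts the second derivatives of the coordinate change drop out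
  under antisymmetrization.
\<close>

lemma ext_d_natural:
  assumes "\<eta> \<in> Omega A k" "c \<in> A" "c' \<in> A" "p \<in> chart_dom c" "p \<in> chart_dom c'"
  shows "ext_d A \<eta> p c' (map (transition_deriv c c' p) vs) = ext_d A \<eta> p c vs"
proof -
  define S where "S = snd c ` (chart_dom c \<inter> chart_dom c')"
  define \<phi> where "\<phi> = snd c' \<circ> chart_inv c"
  define T where "T y = frechet_derivative \<phi> (at y within S)" for y
  let ?x = "snd c p" and ?T = "transition_deriv c c' p"
  have T: "transition_deriv c c' (chart_inv c y) = T y" if "y \<in> S" for y
    using that chart_inv_chart[OF assms(2)] by (auto simp: transition_deriv_def T_def \<phi>_def S_def)
  have xS: "?x \<in> S" using assms(4,5) by (simp add: S_def)
  then have Tx: "T ?x = ?T" using T[OF xS] chart_inv_chart[OF assms(2,4)] by simp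
  have S_open: "openin (top_of_set half_space) S"
    unfolding S_def by (rule overlap_openin[OF assms(2,3)])
  have \<phi>_smooth: "smooth_on S \<phi>"
    unfolding S_def \<phi>_def by (rule transition_smooth[OF assms(2,3)])
  obtain B where B: "\<And>v. ((\<lambda>z. T z v) has_derivative (\<lambda>u. B u v)) (at ?x within S)"
    and B_sym: "\<And>u v. B u v = B v u"
    using smooth_on_second_derivative[OF S_open \<phi>_smooth xS] unfolding T_def by metis
  have \<phi>_chart: "chart_inv c' (\<phi> y) = chart_inv c y" "\<phi> y \<in> chart_img c'"
    "chart_inv c y \<in> chart_dom c" "chart_inv c y \<in> chart_dom c'" if "y \<in> S" for y
    using that chart_inv_chart[OF assms(2)] chart_inv_chart[OF assms(3)] by (auto simp: S_def \<phi>_def)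
  have \<phi>x: "\<phi> ?x = snd c' p" using chart_inv_chart[OF assms(2,4)] by (simp add: \<phi>_def)
  \<comment> \<open>In chart \<open>c\<close> the form reads \<open>?f y (map (T y) ws)\<close>.
    Differentiating \<open>?f\<close> gives the transformed first derivatives, differentiating
    \<open>T\<close> gives \<open>slot_deriv\<close> with the symmetric \<open>B\<close>.\<close>
  let ?f = "\<lambda>y. \<eta> (chart_inv c' (\<phi> y)) c'"
  let ?f' = "\<lambda>u. cderiv c' p \<eta> (?T u)"
  have multi: "multilin (?f y)" if "y \<in> S" for y
    using OmegaD(2)[OF assms(1,3)] \<phi>_chart[OF that] alternating_multilin alt_forms_alternating by metis
  have d\<phi>: "(\<phi> has_derivative ?T) (at ?x within S)"
    using smooth_on_has_derivative[OF \<phi>_smooth xS] Tx by (simp add: T_def)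
  have hd: "((\<lambda>y. ?f y ws) has_derivative (\<lambda>u. ?f' u ws)) (at ?x within S)" for ws
  proof (rule has_derivative_in_compose[OF d\<phi>])
    have "((\<lambda>z. \<eta> (chart_inv c' z) c' ws) has_derivative (\<lambda>u. cderiv c' p \<eta> u ws)) (at (\<phi> ?x) within chart_img c')"
      unfolding \<phi>x by (rule has_derivative_cderiv[OF assms(1,3,5)])
    then show "((\<lambda>z. \<eta> (chart_inv c' z) c' ws) has_derivative (\<lambda>u. cderiv c' p \<eta> u ws)) (at (\<phi> ?x) within \<phi> ` S)"
      by (rule has_derivative_subset) (use \<phi>_chart in auto)
  qed
  have hd2: "((\<lambda>y. ?f y (map (T y) ws)) has_derivative
      (\<lambda>u. ?f' u (map (T ?x) ws) + slot_deriv (?f ?x) (T ?x) (B u) ws)) (at ?x within S)" for ws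
    by (rule has_derivative_multilinear_map[OF multi _ hd B xS], assumption)
      (rule alternating_multilin[OF alt_forms_alternating[OF cderiv_alt_forms[OF assms(1,3,5)]]])
  \<comment> \<open>\<open>ext_d\<close> differentiates within the chart image, the coordinate
    change within the overlap. Both are relatively open in the half space, so the derivatives are
    the same.\<close>
  have at: "at ?x within chart_img c = at ?x within S"
    using at_within_openin[OF chart_img_openin[OF assms(2)]] at_within_openin[OF S_open xS] assms(4) by simp
  have fx: "?f ?x = \<eta> p c'" using chart_inv_chart[OF assms(3,5)] by (simp add: \<phi>x)
  have cd: "cderiv c p \<eta> u = (\<lambda>ws. ?f' u (map ?T ws)) + slot_deriv (\<eta> p c') ?T (B u)" for u
  proof
    fix ws
    have "cderiv c p \<eta> u ws = ?f' u (map (T ?x) ws) + slot_deriv (?f ?x) (T ?x) (B u) ws"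
    proof (rule cderiv_eqI[OF assms(2,4)])
      show "((\<lambda>x. \<eta> (chart_inv c x) c ws) has_derivative
        (\<lambda>u. ?f' u (map (T ?x) ws) + slot_deriv (?f ?x) (T ?x) (B u) ws)) (at ?x within chart_img c)"
        unfolding at
      proof (rule has_derivative_transform[OF xS _ hd2])
        fix y assume y: "y \<in> S"
        show "\<eta> (chart_inv c y) c ws = ?f y (map (T y) ws)"
          using OmegaD(3)[OF assms(1,2,3) \<phi>_chart(3,4)[OF y]] T[OF y] \<phi>_chart(1)[OF y] by simp
      qed
    qed
    then show "cderiv c p \<eta> u ws = ((\<lambda>ws. ?f' u (map ?T ws)) + slot_deriv (\<eta> p c') ?T (B u)) ws"
      by (simp only: fun_apply Tx fx)
  qed
  have alt: "alternating (\<eta> p c')"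
    using OmegaD(2)[OF assms(1,3,5)] alt_forms_alternating by blast
  show ?thesis
    unfolding ext_d_eq[OF assms(2,4)] ext_d_eq[OF assms(3,5)] alt_sum_map cd alt_sum_add fun_apply
      alt_sum_slot_deriv[where B = B, OF alt B_sym]
    by simp
qed

lemma Omega_ext_d:
  assumes "\<eta> \<in> Omega A k"
  shows "ext_d A \<eta> \<in> Omega A (k + 1)"
proof (rule OmegaI)
  fix c p assume "\<not> (c \<in> A \<and> p \<in> chart_dom c)"
  then show "ext_d A \<eta> p c = 0" by (auto simp: ext_d_def fun_eq_iff fun_apply)
next
  fix c p assume "c \<in> A" "p \<in> chart_dom c"
  then show "ext_d A \<eta> p c \<in> alt_forms (k + 1)"
    unfolding ext_d_eq[OF \<open>c \<in> A\<close> \<open>p \<in> chart_dom c\<close>]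
    by (intro alt_sum_alt_forms linear_family_cderiv[OF assms] cderiv_alt_forms[OF assms])
next
  fix c vs assume c: "c \<in> A"
  have "smooth_on (chart_img c) (\<lambda>x. \<Sum>i<length vs. (-1) ^ i *
      frechet_derivative (\<lambda>x. \<eta> (chart_inv c x) c (nths vs (- {i}))) (at x within chart_img c) (vs ! i))"
    by (intro smooth_on_sum smooth_on_mult smooth_on_const
        smooth_on_frechet_derivative[OF chart_img_openin[OF c]] OmegaD(4)[OF assms c])
  then show "smooth_on (chart_img c) (\<lambda>x. ext_d A \<eta> (chart_inv c x) c vs)"
    by (rule smooth_on_cong[THEN iffD1, rotated])
      (use c in \<open>auto simp: ext_d_def inv_into_into f_inv_into_f chart_inv_chart\<close>)
qed (use ext_d_natural[OF assms] in blast)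

lemma ext_d_add:
  assumes "\<eta> \<in> Omega A k" "\<zeta> \<in> Omega A k"
  shows "ext_d A (\<eta> + \<zeta>) = ext_d A \<eta> + ext_d A \<zeta>"
proof (rule Omega_eqI)
  show "ext_d A (\<eta> + \<zeta>) \<in> Omega A (k + 1)" "ext_d A \<eta> + ext_d A \<zeta> \<in> Omega A (k + 1)"
    using assms by (auto intro: Omega_ext_d Omega_add)
  fix p c assume c: "c \<in> A" "p \<in> chart_dom c"
  have "cderiv c p (\<eta> + \<zeta>) u = cderiv c p \<eta> u + cderiv c p \<zeta> u" for u
  proof
    show "cderiv c p (\<eta> + \<zeta>) u ws = (cderiv c p \<eta> u + cderiv c p \<zeta> u) ws" for ws
      unfolding fun_apply
      by (rule cderiv_eqI[OF c, of "\<eta> + \<zeta>", unfolded fun_apply])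
        (rule has_derivative_add[OF has_derivative_cderiv[OF assms(1) c] has_derivative_cderiv[OF assms(2) c]])
  qed
  then have cd: "cderiv c p (\<eta> + \<zeta>) = (\<lambda>u. cderiv c p \<eta> u + cderiv c p \<zeta> u)"
    by (rule ext)
  have "ext_d A (\<eta> + \<zeta>) p c = alt_sum (\<lambda>u. cderiv c p \<eta> u + cderiv c p \<zeta> u)"
    unfolding ext_d_eq[OF c] by (rule arg_cong[OF cd])
  also have "\<dots> = ext_d A \<eta> p c + ext_d A \<zeta> p c"
    by (simp only: ext_d_eq[OF c] alt_sum_add)
  finally show "ext_d A (\<eta> + \<zeta>) p c = (ext_d A \<eta> + ext_d A \<zeta>) p c"
    by (simp only: plus_fun_apply[of "ext_d A \<eta>"] plus_fun_apply[of "ext_d A \<eta> p"])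
qed

lemma ext_d_zero: "ext_d A 0 = 0"
  using ext_d_add[OF Omega_zero Omega_zero] by simp

end

section \<open>Symplectic manifolds with boundary\<close>

locale symplectic_manifold = atlas_manifold X A
  for X :: "'a topology" and A :: "('a, 'm::finite) atlas" +
  fixes \<omega> :: "('a, 'm) form" and J :: "('a, 'm) endo" and g :: "('a, 'm) metric" and n :: nat
  assumes symplectic: "symplectic_form A \<omega>"
    and compatible: "compatible_triple A \<omega> J g"
    and dim: "CARD('m) = 2 * n"
begin

lemma hermitian:
  assumes "c \<in> A" "p \<in> chart_dom c"
  shows "hermitian_space (\<omega> p c) (g p c) (J p c) n"
proof (rule hermitian_space.intro)
  show "\<omega> p c \<in> alt_forms 2"
    using symplectic assms OmegaD(2) by (auto simp: symplectic_form_def)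
  show "bilinear (g p c)" "g p c u v = g p c v u" "u \<noteq> 0 \<Longrightarrow> 0 < g p c u u" for u v
    using compatible assms unfolding compatible_triple_def riemannian_metric_def by blast+
  show "linear (J p c)" "J p c (J p c u) = - u" for u
    using compatible assms unfolding compatible_triple_def almost_complex_def by blast+
  show "g p c u v = \<omega> p c [u, J p c v]" for u v
    using compatible assms unfolding compatible_triple_def by blast
  show "CARD('m) = 2 * n" by (rule dim)
qed

section \<open>The operators \<open>L\<close> and \<open>\<Lambda>\<close> on forms\<close>

lemma \<omega>_Omega: "\<omega> \<in> Omega A 2" and d\<omega>: "ext_d A \<omega> = 0"
  using symplectic by (auto simp: symplectic_form_def)

abbreviation lef where "lef \<equiv> lefschetz \<omega>"

abbreviation dlef where "dlef \<equiv> dual_lefschetz A \<omega> g"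

lemma lef_apply: "lef \<eta> p c = wedge (\<omega> p c) (\<eta> p c)"
  by (simp add: lefschetz_def)

lemma dlef_apply: "c \<in> A \<Longrightarrow> p \<in> chart_dom c \<Longrightarrow> dlef \<eta> p c = dual_lefschetz_pt (\<omega> p c) (g p c) (\<eta> p c)"
  by (simp add: dual_lefschetz_def)

lemma lef_add: "lef (\<eta> + \<zeta>) = lef \<eta> + lef \<zeta>"
  and lef_fun_scale: "lef (fun_scale f \<eta>) = fun_scale f (lef \<eta>)"
  by (intro ext, simp add: lef_apply fun_apply wedge_add_right fun_scale_apply wedge_fscale_right)+

lemma fun_scale_add: "fun_scale f (\<eta> + \<zeta>) = fun_scale f \<eta> + fun_scale f \<zeta>"
  by (simp add: fun_scale_def fun_eq_iff fun_apply algebra_simps)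

lemma Omega_lef:
  assumes "\<eta> \<in> Omega A k"
  shows "lef \<eta> \<in> Omega A (k + 2)"
proof (rule OmegaI)
  note w = OmegaD[OF \<omega>_Omega] and e = OmegaD[OF assms]
  show "lef \<eta> p c = 0" if "\<not> (c \<in> A \<and> p \<in> chart_dom c)" for p c
    using w(1)[OF that] by (simp add: lef_apply)
  show "lef \<eta> p c \<in> alt_forms (k + 2)" if "c \<in> A" "p \<in> chart_dom c" for p c
    using alt_forms_wedge[OF w(2) e(2), OF that that] by (simp add: lef_apply add.commute)
  show "lef \<eta> p c' (map (transition_deriv c c' p) vs) = lef \<eta> p c vs"
    if "c \<in> A" "c' \<in> A" "p \<in> chart_dom c" "p \<in> chart_dom c'" for p c c' vs
    using w(3)[OF that] e(3)[OF that] by (simp add: lef_apply wedge_map)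
  show "smooth_on (chart_img c) (\<lambda>x. lef \<eta> (chart_inv c x) c vs)" if "c \<in> A" for c vs
    unfolding lef_apply wedge_def
    by (intro smooth_on_sum smooth_on_mult smooth_on_const w(4) e(4) that)
qed

text \<open>The derivative of a coordinate change is an isometry that intertwines the almost complex
  structures. It carries an orthonormal frame of one chart to one of the other, and
  \<open>\<Lambda>\<close> can be computed in either frame.\<close>

lemma dlef_natural:
  assumes "\<eta> \<in> Omega A k" "c \<in> A" "c' \<in> A" "p \<in> chart_dom c" "p \<in> chart_dom c'"
  shows "dlef \<eta> p c' (map (transition_deriv c c' p) vs) = dlef \<eta> p c vs"
proof -
  let ?T = "transition_deriv c c' p"
  interpret H: hermitian_space "\<omega> p c" "g p c" "J p c" n by (rule hermitian[OF assms(2,4)])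
  interpret H': hermitian_space "\<omega> p c'" "g p c'" "J p c'" n by (rule hermitian[OF assms(3,5)])
  have g: "g p c' (?T u) (?T v) = g p c u v" for u v
    using compatible assms(2-) unfolding compatible_triple_def riemannian_metric_def by blast
  have J: "J p c' (?T u) = ?T (J p c u)" for u
    using compatible assms(2-) unfolding compatible_triple_def almost_complex_def by blast
  define E where "E = set H.frame0"
  have E: "H.frame E" by (simp add: E_def H.frame0)
  have on: "g p c e f = (if e = f then 1 else 0)" if "e \<in> E" "f \<in> E" for e f
    using E that by (auto simp: H.frame_def H.orthonormal_def)
  have inj: "inj_on ?T E"
  proof (rule inj_onI)
    fix e f assume ef: "e \<in> E" "f \<in> E" "?T e = ?T f"
    then have "g p c e f = g p c e e" by (metis g)
    then show "e = f" using on[OF ef(1,2)] on[OF ef(1,1)] by (auto split: if_splits)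
  qed
  have fin: "finite E" by (simp add: E_def)
  have E': "H'.frame (?T ` E)"
    using E inj fin on g inj_on_eq_iff[OF inj]
    by (auto simp: H.frame_def H'.frame_def H'.orthonormal_def card_image)
  have "H'.contraction (?T ` E) (\<eta> p c') (map ?T vs) = H.contraction E (\<eta> p c) vs"
  proof -
    have "\<eta> p c' (?T e # J p c' (?T e) # map ?T vs) = \<eta> p c (e # J p c e # vs)" for e
      using OmegaD(3)[OF assms, of "e # J p c e # vs"] by (simp add: J)
    then show ?thesis
      by (simp add: H.contraction_apply H'.contraction_apply sum.reindex[OF inj])
  qed
  moreover have "alternating (\<eta> p c)" "alternating (\<eta> p c')"
    using OmegaD(2)[OF assms(1)] assms(2-) alt_forms_alternating by blast+
  ultimately show ?thesis
    using H.\<Lambda>_eq[OF E] H'.\<Lambda>_eq[OF E'] assms(2-) by (simp add: dlef_apply)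
qed

lemma Omega_dlef:
  assumes "\<eta> \<in> Omega A k"
  shows "dlef \<eta> \<in> Omega A (k - 2)"
proof (rule OmegaI)
  note e = OmegaD[OF assms]
  show "dlef \<eta> p c = 0" if "\<not> (c \<in> A \<and> p \<in> chart_dom c)" for p c
    using that by (auto simp: dual_lefschetz_def)
  show "dlef \<eta> p c \<in> alt_forms (k - 2)" if "c \<in> A" "p \<in> chart_dom c" for p c
    using hermitian_space.\<Lambda>_alt_forms[OF hermitian[OF that] e(2)[OF that]] that by (simp add: dlef_apply)
  show "smooth_on (chart_img c) (\<lambda>x. dlef \<eta> (chart_inv c x) c vs)" if c: "c \<in> A" for c vs
  proof -
    \<comment> \<open>\<open>P\<close> stems from frames picked independently at each point, so its
      smoothness is not visible from the definition; it follows because \<open>P\<close> inverts the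
      smooth coordinate matrix of \<open>\<omega>\<close>.\<close>
    define P where "P x = hermitian_space.poisson (g (chart_inv c x) c) (J (chart_inv c x) c)" for x
    have PW: "P x ** (\<chi> a b. \<omega> (chart_inv c x) c [axis a 1, axis b 1]) = mat 1" if "x \<in> chart_img c" for x
      using hermitian_space.poisson_w[OF hermitian[OF c]] inv_into_into[OF that] by (simp add: P_def)
    have P: "smooth_on (chart_img c) (\<lambda>x. P x $ i $ j)" for i j
      by (rule smooth_on_left_inverse[OF _ PW]) (simp add: OmegaD(4)[OF \<omega>_Omega c])
    have "smooth_on (chart_img c) (\<lambda>x. (1 / 2) * (\<Sum>a\<in>UNIV. \<Sum>b\<in>UNIV.
        P x $ b $ a * \<eta> (chart_inv c x) c (axis a 1 # axis b 1 # vs)))"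
      by (intro smooth_on_mult smooth_on_const smooth_on_sum P e(4) c)
    then show ?thesis
    proof (rule smooth_on_cong[THEN iffD1, rotated])
      fix x assume "x \<in> chart_img c"
      then have p: "chart_inv c x \<in> chart_dom c" by (rule inv_into_into)
      show "(1 / 2) * (\<Sum>a\<in>UNIV. \<Sum>b\<in>UNIV.
          P x $ b $ a * \<eta> (chart_inv c x) c (axis a 1 # axis b 1 # vs)) = dlef \<eta> (chart_inv c x) c vs"
        unfolding P_def dlef_apply[OF c p]
        using hermitian_space.\<Lambda>_poisson[OF hermitian[OF c p] alt_forms_alternating[OF e(2)[OF c p]]]
        by simp
    qed
  qed
qed (use dlef_natural[OF assms] in blast)

lemma lef_pow_apply: "(lef ^^ r) \<eta> p c = (wedge (\<omega> p c) ^^ r) (\<eta> p c)"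
  by (induction r) (simp_all add: lef_apply)

lemma dlef_pow_apply:
  "c \<in> A \<Longrightarrow> p \<in> chart_dom c \<Longrightarrow>
    (dlef ^^ r) \<eta> p c = (dual_lefschetz_pt (\<omega> p c) (g p c) ^^ r) (\<eta> p c)"
  by (induction r) (simp_all add: dlef_apply)

lemma Omega_lef_pow: "\<eta> \<in> Omega A k \<Longrightarrow> (lef ^^ r) \<eta> \<in> Omega A (k + 2 * int r)"
  by (induction r) (use Omega_lef in \<open>force simp: algebra_simps\<close>)+

lemma Omega_dlef_pow: "\<eta> \<in> Omega A k \<Longrightarrow> (dlef ^^ r) \<eta> \<in> Omega A (k - 2 * int r)"
  by (induction r) (use Omega_dlef in \<open>force simp: algebra_simps\<close>)+

text \<open>The Leibniz rule, in which the first term vanishes as \<open>\<omega>\<close> is closed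
  and the second has no sign as \<open>\<omega>\<close> has even degree.\<close>

lemma ext_d_lef:
  assumes "\<eta> \<in> Omega A k"
  shows "ext_d A (lef \<eta>) = lef (ext_d A \<eta>)"
proof (rule Omega_eqI)
  show "ext_d A (lef \<eta>) \<in> Omega A (k + 2 + 1)" "lef (ext_d A \<eta>) \<in> Omega A (k + 1 + 2)"
    by (rule Omega_ext_d[OF Omega_lef[OF assms]], rule Omega_lef[OF Omega_ext_d[OF assms]])
  fix p c assume c: "c \<in> A" "p \<in> chart_dom c"
  have inv: "chart_inv c (snd c p) = p" using chart_inv_chart[OF c] .
  have "cderiv c p (lef \<eta>) u = wedge (cderiv c p \<omega> u) (\<eta> p c) + wedge (\<omega> p c) (cderiv c p \<eta> u)" for u
  proof
    fix vs
    show "cderiv c p (lef \<eta>) u vs = (wedge (cderiv c p \<omega> u) (\<eta> p c) + wedge (\<omega> p c) (cderiv c p \<eta> u)) vs"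
    proof (rule cderiv_eqI[OF c])
      have "((\<lambda>x. \<Sum>I\<in>Pow {..<length vs}. (-1) ^ card {(i, j). i \<in> I \<and> j < i \<and> j \<notin> I} *
            \<omega> (chart_inv c x) c (nths vs I) * \<eta> (chart_inv c x) c (nths vs (- I))) has_derivative
          (\<lambda>u. \<Sum>I\<in>Pow {..<length vs}.
            ((-1) ^ card {(i, j). i \<in> I \<and> j < i \<and> j \<notin> I} * \<omega> (chart_inv c (snd c p)) c (nths vs I)) * cderiv c p \<eta> u (nths vs (- I)) +
            ((-1) ^ card {(i, j). i \<in> I \<and> j < i \<and> j \<notin> I} * cderiv c p \<omega> u (nths vs I)) * \<eta> (chart_inv c (snd c p)) c (nths vs (- I))))
          (at (snd c p) within chart_img c)"
        by (intro has_derivative_sum has_derivative_mult has_derivative_mult_right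
            has_derivative_cderiv[OF assms c] has_derivative_cderiv[OF \<omega>_Omega c])
      then show "((\<lambda>x. lef \<eta> (chart_inv c x) c vs) has_derivative
          (\<lambda>u. (wedge (cderiv c p \<omega> u) (\<eta> p c) + wedge (\<omega> p c) (cderiv c p \<eta> u)) vs))
          (at (snd c p) within chart_img c)"
        unfolding lef_apply wedge_def fun_apply inv sum.distrib by (simp add: add.commute)
    qed
  qed
  then have "cderiv c p (lef \<eta>) = (\<lambda>u. wedge (cderiv c p \<omega> u) (\<eta> p c) + wedge (\<omega> p c) (cderiv c p \<eta> u))"
    by (rule ext)
  then have "ext_d A (lef \<eta>) p c = alt_sum (\<lambda>u. wedge (cderiv c p \<omega> u) (\<eta> p c)) +
      alt_sum (\<lambda>u. wedge (\<omega> p c) (cderiv c p \<eta> u))"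
    by (simp only: ext_d_eq[OF c] alt_sum_add)
  also have "\<dots> = wedge (alt_sum (cderiv c p \<omega>)) (\<eta> p c) + wedge (grade_inv (\<omega> p c)) (alt_sum (cderiv c p \<eta>))"
    by (intro ext) (simp add: fun_apply alt_sum_wedge_left alt_sum_wedge_right)
  also have "alt_sum (cderiv c p \<omega>) = 0"
    using d\<omega> by (simp add: zero_fun_apply flip: ext_d_eq[OF c])
  also have "grade_inv (\<omega> p c) = \<omega> p c"
    using grade_inv_alt_forms[of "\<omega> p c" 2] OmegaD(2)[OF \<omega>_Omega c] by (simp add: fscale_def fun_eq_iff)
  finally show "ext_d A (lef \<eta>) p c = lef (ext_d A \<eta>) p c"
    by (simp add: lef_apply ext_d_eq[OF c])
qed

lemma ext_d_lef_pow: "\<eta> \<in> Omega A k \<Longrightarrow> ext_d A ((lef ^^ r) \<eta>) = (lef ^^ r) (ext_d A \<eta>)"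
  by (induction r) (simp_all add: ext_d_lef[OF Omega_lef_pow])

text \<open>The formula for \<open>projection\<close> in terms of operators on forms. Membership in
  \<open>Omega\<close> is inherited from these operators, all pointwise properties from
  \<open>projection\<close>.\<close>

definition prim_part :: "int \<Rightarrow> ('a, 'm) form \<Rightarrow> ('a, 'm) form" where
  "prim_part k \<eta> = (\<Sum>r\<le>nat k. fun_scale (\<lambda>_. proj_coeff n k r) ((lef ^^ r) ((dlef ^^ r) \<eta>)))"

definition coprim_part :: "int \<Rightarrow> ('a, 'm) form \<Rightarrow> ('a, 'm) form" where
  "coprim_part k \<eta> =
     (\<Sum>r<nat k. fun_scale (\<lambda>_. - proj_coeff n k (Suc r)) ((lef ^^ r) ((dlef ^^ Suc r) \<eta>)))"

lemma Omega_prim_part: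
  assumes "\<eta> \<in> Omega A k"
  shows "prim_part k \<eta> \<in> Omega A k"
proof -
  have "(lef ^^ r) ((dlef ^^ r) \<eta>) \<in> Omega A k" for r
    using Omega_lef_pow[OF Omega_dlef_pow[OF assms, of r], of r] by simp
  then show ?thesis
    unfolding prim_part_def by (intro Omega_sum Omega_fun_scale smooth_function_const)
qed

lemma Omega_coprim_part:
  assumes "\<eta> \<in> Omega A k"
  shows "coprim_part k \<eta> \<in> Omega A (k - 2)"
proof -
  have "(lef ^^ r) ((dlef ^^ Suc r) \<eta>) \<in> Omega A (k - 2)" for r
    using Omega_lef_pow[OF Omega_dlef_pow[OF assms, of "Suc r"], of r] by simp
  then show ?thesis
    unfolding coprim_part_def by (intro Omega_sum Omega_fun_scale smooth_function_const)
qed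

lemma prim_part_apply:
  assumes "c \<in> A" "p \<in> chart_dom c"
  shows "prim_part k \<eta> p c = hermitian_space.projection (\<omega> p c) (g p c) n k (\<eta> p c)"
  unfolding prim_part_def hermitian_space.projection_def[OF hermitian[OF assms]] sum_fun_apply
  by (simp only: fun_scale_apply lef_pow_apply dlef_pow_apply[OF assms])

lemma coprim_part_apply:
  assumes "c \<in> A" "p \<in> chart_dom c"
  shows "coprim_part k \<eta> p c = hermitian_space.coprojection (\<omega> p c) (g p c) n k (\<eta> p c)"
  unfolding coprim_part_def hermitian_space.coprojection_def[OF hermitian[OF assms]] sum_fun_apply
  by (simp only: fun_scale_apply lef_pow_apply dlef_pow_apply[OF assms])

section \<open>Primitive forms and the decomposition of their derivatives\<close>

lemma primitive_formsI:
  assumes "\<eta> \<in> Omega A k"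
    and "\<And>p c. c \<in> A \<Longrightarrow> p \<in> chart_dom c \<Longrightarrow> dual_lefschetz_pt (\<omega> p c) (g p c) (\<eta> p c) = 0"
  shows "\<eta> \<in> primitive_forms A \<omega> g k"
proof -
  have "dlef \<eta> p c = 0" for p c
    by (cases "c \<in> A \<and> p \<in> chart_dom c") (use assms(2) in \<open>auto simp: dual_lefschetz_def\<close>)
  then have "dlef \<eta> = 0" by (simp add: fun_eq_iff zero_fun_apply)
  then show ?thesis using assms(1) by (simp add: primitive_forms_def)
qed

lemma primitive_formsD:
  assumes "\<eta> \<in> primitive_forms A \<omega> g k"
  shows "\<eta> \<in> Omega A k" and "dlef \<eta> = 0"
    and "c \<in> A \<Longrightarrow> p \<in> chart_dom c \<Longrightarrow> dual_lefschetz_pt (\<omega> p c) (g p c) (\<eta> p c) = 0"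
  using assms by (auto simp: primitive_forms_def zero_fun_apply simp flip: dlef_apply)

lemma primitive_prim_part:
  assumes "\<eta> \<in> Omega A k" "k \<le> int n + 1"
  shows "prim_part k \<eta> \<in> primitive_forms A \<omega> g k"
proof (rule primitive_formsI[OF Omega_prim_part[OF assms(1)]])
  fix p c assume c: "c \<in> A" "p \<in> chart_dom c"
  show "dual_lefschetz_pt (\<omega> p c) (g p c) (prim_part k \<eta> p c) = 0"
    unfolding prim_part_apply[OF c]
    by (rule hermitian_space.\<Lambda>_projection[OF hermitian[OF c] OmegaD(2)[OF assms(1) c] assms(2)])
qed

lemma prim_part_decomp:
  assumes "\<eta> \<in> Omega A k"
  shows "\<eta> = prim_part k \<eta> + lef (coprim_part k \<eta>)"
proof (rule Omega_eqI[OF assms])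
  show "prim_part k \<eta> + lef (coprim_part k \<eta>) \<in> Omega A k"
    using Omega_add[OF Omega_prim_part[OF assms] Omega_lef[OF Omega_coprim_part[OF assms], simplified]] .
  fix p c assume c: "c \<in> A" "p \<in> chart_dom c"
  show "\<eta> p c = (prim_part k \<eta> + lef (coprim_part k \<eta>)) p c"
    using hermitian_space.projection_decomp[OF hermitian[OF c], of "\<eta> p c" k]
    by (simp add: fun_apply lef_apply prim_part_apply[OF c] coprim_part_apply[OF c])
qed

text \<open>The difference of the primitive parts is itself primitive and lies in the image of
  \<open>L\<close>.\<close>

lemma primitive_lef_unique:
  assumes "B \<in> primitive_forms A \<omega> g k" "B' \<in> primitive_forms A \<omega> g k"
    and "B + lef \<beta> = B' + lef \<beta>'"
  shows "B = B'"
proof (rule Omega_eqI)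
  show "B \<in> Omega A k" "B' \<in> Omega A k" using assms primitive_formsD by blast+
  fix p c assume c: "c \<in> A" "p \<in> chart_dom c"
  interpret hermitian_space "\<omega> p c" "g p c" "J p c" n by (rule hermitian[OF c])
  have alt: "alternating (B p c)" "alternating (B' p c)"
    using assms primitive_formsD(1) OmegaD(2) c alt_forms_alternating by blast+
  have "B p c + \<L> (\<beta> p c) = B' p c + \<L> (\<beta>' p c)"
    using fun_cong[OF fun_cong[OF assms(3), of p], of c] by (simp add: fun_apply lef_apply)
  then have "B p c - B' p c = \<L> (\<beta>' p c - \<beta> p c)"
    by (simp add: wedge_diff_right algebra_simps)
  moreover have "\<Lambda> (B p c - B' p c) = 0"
    using primitive_formsD(3)[OF assms(1) c] primitive_formsD(3)[OF assms(2) c] by (simp add: \<Lambda>_diff alt)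
  ultimately have "B p c - B' p c = 0"
    using primitive_\<L>_eq_0 alternating_diff[OF alt] by blast
  then show "B p c = B' p c" by simp
qed

lemma prim_proj_eq:
  assumes "\<eta> \<in> Omega A k" "k \<le> int n + 1"
  shows "prim_proj A \<omega> g k \<eta> = prim_part k \<eta>"
  unfolding prim_proj_def
proof (rule the_equality)
  show "prim_part k \<eta> \<in> primitive_forms A \<omega> g k \<and> (\<exists>\<beta>\<in>Omega A (k - 2). \<eta> = prim_part k \<eta> + lef \<beta>)"
    using primitive_prim_part[OF assms] Omega_coprim_part[OF assms(1)] prim_part_decomp[OF assms(1)] by blast
  show "p = prim_part k \<eta>" if "p \<in> primitive_forms A \<omega> g k \<and> (\<exists>\<beta>\<in>Omega A (k - 2). \<eta> = p + lef \<beta>)" for p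
    using primitive_lef_unique[of p k "prim_part k \<eta>"] primitive_prim_part[OF assms]
      prim_part_decomp[OF assms(1)] that by metis
qed

lemma d_decomposition_exists:
  assumes B: "B \<in> primitive_forms A \<omega> g j" and j: "j \<le> int n"
  shows "\<exists>B1 B2. d_decomposition A \<omega> g j B B1 B2"
proof -
  \<comment> \<open>Applying \<open>\<Lambda>\<close> to \<open>dB = B1 + L B2\<close> with
    primitive \<open>B1\<close> and \<open>B2\<close> gives
    \<open>\<Lambda> (dB) = (n - (j - 1)) B2\<close>, which leaves no other choice for
    \<open>B2\<close>.\<close>
  define r where "r = 1 / (real n - real_of_int j + 1)"
  define B2 where "B2 = fun_scale (\<lambda>_. r) (dlef (ext_d A B))"
  define B1 where "B1 = ext_d A B - lef B2"
  have BO: "B \<in> Omega A j" by (rule primitive_formsD(1)[OF B])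
  have dB: "ext_d A B \<in> Omega A (j + 1)" by (rule Omega_ext_d[OF BO])
  have B2O: "B2 \<in> Omega A (j - 1)"
    using Omega_dlef[OF dB] unfolding B2_def by (intro Omega_fun_scale smooth_function_const) simp
  have B1O: "B1 \<in> Omega A (j + 1)"
    unfolding B1_def using Omega_lef[OF B2O] by (intro Omega_diff dB) (simp add: add.commute)
  \<comment> \<open>The power of \<open>L\<close> that kills primitive forms of degree
    \<open>j\<close>. Carried over to \<open>dB\<close> it becomes the hypothesis of
    \<open>\<Lambda>_\<Lambda>_eq_0\<close>.\<close>
  obtain m where m: "int m = int n - j + 1" using j by (metis add_nonneg_nonneg diff_ge_0_iff_ge nonneg_int_cases zero_le_one)
  have "(lef ^^ m) B = 0"
  proof (rule Omega_eqI[OF Omega_lef_pow[OF BO] Omega_zero])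
    fix p c assume c: "c \<in> A" "p \<in> chart_dom c"
    show "(lef ^^ m) B p c = 0 p c"
      using hermitian_space.Lpow_primitive[OF hermitian[OF c] OmegaD(2)[OF BO c] primitive_formsD(3)[OF B c] m]
      by (simp add: lef_pow_apply zero_fun_apply)
  qed
  then have LdB: "(lef ^^ m) (ext_d A B) = 0"
    using ext_d_lef_pow[OF BO, of m] ext_d_zero by simp
  have pt: "dual_lefschetz_pt (\<omega> p c) (g p c) (B1 p c) = 0 \<and>
      dual_lefschetz_pt (\<omega> p c) (g p c) (B2 p c) = 0" if c: "c \<in> A" "p \<in> chart_dom c" for p c
  proof -
    interpret hermitian_space "\<omega> p c" "g p c" "J p c" n by (rule hermitian[OF c])
    let ?\<alpha> = "ext_d A B p c"
    have \<alpha>: "?\<alpha> \<in> alt_forms (j + 1)" by (rule OmegaD(2)[OF dB c])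
    have b2: "B2 p c = fscale r (\<Lambda> ?\<alpha>)"
      by (simp add: B2_def fun_scale_apply dlef_apply[OF c])
    have "Lpow m ?\<alpha> = 0"
      using LdB by (simp add: zero_fun_apply flip: lef_pow_apply)
    then have "\<Lambda> (\<Lambda> ?\<alpha>) = 0" by (rule \<Lambda>_\<Lambda>_eq_0[OF \<alpha> j m])
    then have b2_prim: "\<Lambda> (B2 p c) = 0"
      using \<Lambda>_alt_forms[OF \<alpha>] by (simp add: b2 \<Lambda>_fscale alt_forms_alternating)
        (simp add: fscale_def fun_eq_iff fun_apply)
    have "real n - real_of_int j + 1 \<noteq> 0" using j by linarith
    then have r: "(real n - real_of_int (j - 1)) * r = 1" by (simp add: r_def)
    have b2_alt: "B2 p c \<in> alt_forms (j - 1)" by (rule OmegaD(2)[OF B2O c])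
    have "\<Lambda> (\<L> (B2 p c)) = fscale (real n - real_of_int (j - 1)) (fscale r (\<Lambda> ?\<alpha>))"
      using \<Lambda>_\<L>[OF b2_alt] b2_prim by (simp add: b2)
    also have "\<dots> = \<Lambda> ?\<alpha>"
      using r by (simp add: fscale_def fun_eq_iff flip: mult.assoc)
    finally have "\<Lambda> (\<L> (B2 p c)) = \<Lambda> ?\<alpha>" .
    then have "\<Lambda> (B1 p c) = 0"
      using alt_forms_alternating[OF \<alpha>] alt_forms_alternating[OF \<L>_alt_forms[OF b2_alt]]
      by (simp add: B1_def fun_apply lef_apply \<Lambda>_diff)
    then show ?thesis using b2_prim by simp
  qed
  \<comment> \<open>Here \<open>j = n\<close>, and a primitive form of degree \<open>n + 1\<close>
    is zero.\<close>
  have "B1 = 0" if "2 * j = int CARD('m)"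
  proof (rule Omega_eqI[OF B1O Omega_zero])
    fix p c assume c: "c \<in> A" "p \<in> chart_dom c"
    have "j = int n" using that dim by simp
    then show "B1 p c = 0 p c"
      using hermitian_space.primitive_degree_Suc_n[OF hermitian[OF c]] OmegaD(2)[OF B1O c] pt[OF c]
      by (simp add: zero_fun_apply)
  qed
  then have "d_decomposition A \<omega> g j B B1 B2"
    unfolding d_decomposition_def using pt B1O B2O by (auto intro!: primitive_formsI simp: B1_def)
  then show ?thesis by blast
qed

text \<open>\<open>B1\<close> is determined as a primitive part; then so is \<open>B2\<close>,
  because \<open>L\<close> is injective in degree \<open>j - 1 < n\<close>.\<close>

lemma d_decomposition_unique:
  assumes "d_decomposition A \<omega> g j B B1 B2" "d_decomposition A \<omega> g j B B1' B2'" "j \<le> int n"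
  shows "B1 = B1'" and "B2 = B2'"
proof -
  have eq: "B1 + lef B2 = B1' + lef B2'"
    using assms unfolding d_decomposition_def by simp
  show B1: "B1 = B1'"
    by (rule primitive_lef_unique[OF _ _ eq]) (use assms in \<open>auto simp: d_decomposition_def\<close>)
  have B2: "B2 \<in> Omega A (j - 1)" "B2' \<in> Omega A (j - 1)"
    using assms primitive_formsD(1) unfolding d_decomposition_def by blast+
  show "B2 = B2'"
  proof (rule Omega_eqI[OF B2])
    fix p c assume c: "c \<in> A" "p \<in> chart_dom c"
    interpret hermitian_space "\<omega> p c" "g p c" "J p c" n by (rule hermitian[OF c])
    have "\<L> (B2 p c) = \<L> (B2' p c)"
      using eq B1 by (simp flip: lef_apply)
    then have "\<L> (B2 p c - B2' p c) = 0" by (simp add: wedge_diff_right)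
    then have "B2 p c - B2' p c = 0"
      by (rule \<L>_inject_0[OF alt_forms_diff[OF OmegaD(2)[OF B2(1) c] OmegaD(2)[OF B2(2) c]], rotated])
        (use assms(3) in simp)
    then show "B2 p c = B2' p c" by simp
  qed
qed

lemma d_decomposition_d_plus_d_minus:
  assumes "B \<in> primitive_forms A \<omega> g j" "j \<le> int n"
  shows "d_decomposition A \<omega> g j B (d_plus A \<omega> g j B) (d_minus A \<omega> g j B)"
proof -
  obtain B1 B2 where B: "d_decomposition A \<omega> g j B B1 B2"
    using d_decomposition_exists[OF assms] by blast
  have "d_plus A \<omega> g j B = B1"
    unfolding d_plus_def by (rule the_equality) (use B d_decomposition_unique[OF _ B assms(2)] in blast)+
  moreover have "d_minus A \<omega> g j B = B2"
    unfolding d_minus_def by (rule the_equality) (use B d_decomposition_unique[OF _ B assms(2)] in blast)+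
  ultimately show ?thesis using B by simp
qed

lemma primitive_fun_scale:
  assumes "smooth_function A f" "B \<in> primitive_forms A \<omega> g k"
  shows "fun_scale f B \<in> primitive_forms A \<omega> g k"
proof (rule primitive_formsI[OF Omega_fun_scale[OF assms(1) primitive_formsD(1)[OF assms(2)]]])
  fix p c assume c: "c \<in> A" "p \<in> chart_dom c"
  interpret hermitian_space "\<omega> p c" "g p c" "J p c" n by (rule hermitian[OF c])
  show "\<Lambda> (fun_scale f B p c) = 0"
    using primitive_formsD(3)[OF assms(2) c] alt_forms_alternating[OF OmegaD(2)[OF primitive_formsD(1)[OF assms(2)] c]]
    by (simp add: fun_scale_apply \<Lambda>_fscale) (simp add: fscale_def fun_eq_iff fun_apply)
qed

lemma form_inner_primitive_prim_part:
  assumes u: "u \<in> primitive_forms A \<omega> g k" and "\<zeta> = \<zeta>' + lef \<beta>"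
  shows "form_inner A g u \<zeta> = form_inner A g u \<zeta>'" and "form_inner A g \<zeta> u = form_inner A g \<zeta>' u"
proof -
  have uO: "u \<in> Omega A k" by (rule primitive_formsD(1)[OF u])
  \<comment> \<open>Stated for all \<open>p\<close> and \<open>c\<close>, since
    \<open>form_inner\<close> evaluates in an unspecified chart; where \<open>c\<close> is not a
    chart around \<open>p\<close>, the form \<open>u\<close> is zero by convention.\<close>
  have "ext_inner (g p c) (u p c) (\<zeta> p c) = ext_inner (g p c) (u p c) (\<zeta>' p c)" for p c
  proof (cases "c \<in> A \<and> p \<in> chart_dom c")
    case True
    then interpret hermitian_space "\<omega> p c" "g p c" "J p c" n by (intro hermitian) auto
    have "ip (u p c) (\<L> (\<beta> p c)) = ip (\<Lambda> (u p c)) (\<beta> p c)"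
      using alt_forms_alternating[OF OmegaD(2)[OF uO]] True by (simp add: ip_\<Lambda>)
    also have "\<dots> = 0"
      using primitive_formsD(3)[OF u] True by (simp add: ip_eq)
    finally show ?thesis
      by (simp add: assms(2) fun_apply lef_apply ip_eq frame_inner_add_right)
  next
    case False
    then show ?thesis using OmegaD(1)[OF uO False] by (simp add: ext_inner_def Let_def fun_apply)
  qed
  moreover have "ext_inner h \<alpha> \<beta> = ext_inner h \<beta> \<alpha>" for h and \<alpha> \<beta> :: "(real ^ 'm) list \<Rightarrow> real"
    by (simp add: ext_inner_def Let_def mult.commute)
  ultimately show "form_inner A g u \<zeta> = form_inner A g u \<zeta>'" "form_inner A g \<zeta> u = form_inner A g \<zeta>' u"
    by (auto simp: form_inner_def Let_def fun_eq_iff) 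
qed

lemma form_inner_fun_scale_left: "form_inner A g (fun_scale (\<lambda>_. r) \<eta>) \<zeta> p = r * form_inner A g \<eta> \<zeta> p"
  and form_inner_fun_scale_right: "form_inner A g \<eta> (fun_scale (\<lambda>_. r) \<zeta>) p = r * form_inner A g \<eta> \<zeta> p"
  by (simp_all add: form_inner_def ext_inner_def Let_def fun_scale_def sum_distrib_left mult_ac)

lemma L2_inner_fun_scale_left: "L2_inner X A g (fun_scale (\<lambda>_. r) \<eta>) \<zeta> = r * L2_inner X A g \<eta> \<zeta>"
  and L2_inner_fun_scale_right: "L2_inner X A g \<eta> (fun_scale (\<lambda>_. r) \<zeta>) = r * L2_inner X A g \<eta> \<zeta>"
  by (simp_all add: L2_inner_def form_inner_fun_scale_left form_inner_fun_scale_right)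

text \<open>One term of \<open>d_Lambda\<close> vanishes since \<open>\<Lambda> u = 0\<close>. In
  the other, \<open>\<Lambda>\<close> kills the component \<open>\<partial>\<^sub>+u\<close> and
  acts on \<open>L (\<partial>\<^sub>-u)\<close> as the commutator \<open>n - j\<close>, because
  \<open>\<partial>\<^sub>-u\<close> is primitive of degree \<open>j\<close>.\<close>

lemma d_Lambda_primitive:
  assumes "u \<in> primitive_forms A \<omega> g (j + 1)" "j + 1 \<le> int n"
  shows "d_Lambda A \<omega> g u = fun_scale (\<lambda>_. - (real n - real_of_int j)) (d_minus A \<omega> g (j + 1) u)"
proof -
  define B1 B2 where "B1 = d_plus A \<omega> g (j + 1) u" and "B2 = d_minus A \<omega> g (j + 1) u"
  have dec: "d_decomposition A \<omega> g (j + 1) u B1 B2"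
    unfolding B1_def B2_def by (rule d_decomposition_d_plus_d_minus[OF assms])
  then have B1: "B1 \<in> primitive_forms A \<omega> g (j + 2)" and B2: "B2 \<in> primitive_forms A \<omega> g j"
    and du: "ext_d A u = B1 + lef B2"
    by (simp_all add: d_decomposition_def add.assoc)
  have B1O: "B1 \<in> Omega A (j + 2)" and B2O: "B2 \<in> Omega A j"
    using B1 B2 primitive_formsD(1) by blast+
  have "dlef (ext_d A u) = fun_scale (\<lambda>_. real n - real_of_int j) B2"
  proof (rule Omega_eqI)
    show "dlef (ext_d A u) \<in> Omega A (j + 1 + 1 - 2)"
      by (intro Omega_dlef Omega_ext_d primitive_formsD(1)[OF assms(1)])
    show "fun_scale (\<lambda>_. real n - real_of_int j) B2 \<in> Omega A j"
      by (intro Omega_fun_scale smooth_function_const B2O)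
    fix p c assume c: "c \<in> A" "p \<in> chart_dom c"
    interpret hermitian_space "\<omega> p c" "g p c" "J p c" n by (rule hermitian[OF c])
    have b1: "alternating (B1 p c)" "\<Lambda> (B1 p c) = 0"
      using alt_forms_alternating[OF OmegaD(2)[OF B1O c]] primitive_formsD(3)[OF B1 c] by auto
    have b2: "B2 p c \<in> alt_forms j" "\<Lambda> (B2 p c) = 0"
      using OmegaD(2)[OF B2O c] primitive_formsD(3)[OF B2 c] by auto
    show "dlef (ext_d A u) p c = fun_scale (\<lambda>_. real n - real_of_int j) B2 p c"
      using \<Lambda>_add[OF b1(1) alt_forms_alternating[OF \<L>_alt_forms[OF b2(1)]]] \<Lambda>_\<L>[OF b2(1)] b1(2) b2(2)
      by (simp add: dlef_apply[OF c] du fun_apply lef_apply fun_scale_apply)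
  qed
  then show ?thesis
    unfolding d_Lambda_def primitive_formsD(2)[OF assms(1)] ext_d_zero B2_def[symmetric]
    by (simp add: fun_eq_iff fun_apply fun_scale_def left_diff_distrib)
qed

section \<open>The primitive projection and the boundary conditions\<close>

lemma prim_proj_D:
  assumes \<rho>: "smooth_function A \<rho>" and k: "k < int n" and \<eta>: "\<eta> \<in> Omega_D A \<rho> k"
  shows "prim_proj A \<omega> g k \<eta> \<in> P_Dplus A \<omega> g \<rho> k"
proof -
  have \<eta>O: "\<eta> \<in> Omega A k" and zero: "zero_on_boundary A (ext_d A (fun_scale \<rho> \<eta>))"
    using \<eta> by (auto simp: Omega_D_def)
  define B \<beta> where "B = prim_part k \<eta>" and "\<beta> = coprim_part k \<eta>"
  have B: "B \<in> primitive_forms A \<omega> g k" and \<beta>: "\<beta> \<in> Omega A (k - 2)" and dec: "\<eta> = B + lef \<beta>"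
    unfolding B_def \<beta>_def
    using primitive_prim_part[OF \<eta>O] Omega_coprim_part[OF \<eta>O] prim_part_decomp[OF \<eta>O] k by auto
  have \<rho>B: "fun_scale \<rho> B \<in> primitive_forms A \<omega> g k" by (rule primitive_fun_scale[OF \<rho> B])
  have \<rho>\<beta>: "fun_scale \<rho> \<beta> \<in> Omega A (k - 2)" by (rule Omega_fun_scale[OF \<rho> \<beta>])
  define B1 B2 where "B1 = d_plus A \<omega> g k (fun_scale \<rho> B)" and "B2 = d_minus A \<omega> g k (fun_scale \<rho> B)"
  have "d_decomposition A \<omega> g k (fun_scale \<rho> B) B1 B2"
    unfolding B1_def B2_def using d_decomposition_d_plus_d_minus[OF \<rho>B] k by simp
  then have B1: "B1 \<in> primitive_forms A \<omega> g (k + 1)" and d\<rho>B: "ext_d A (fun_scale \<rho> B) = B1 + lef B2"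
    by (auto simp: d_decomposition_def)
  have "ext_d A (fun_scale \<rho> \<eta>) = ext_d A (fun_scale \<rho> B) + ext_d A (lef (fun_scale \<rho> \<beta>))"
    unfolding dec fun_scale_add lef_fun_scale[symmetric]
    by (rule ext_d_add[OF primitive_formsD(1)[OF \<rho>B]]) (use Omega_lef[OF \<rho>\<beta>] in simp)
  also have "\<dots> = B1 + lef (B2 + ext_d A (fun_scale \<rho> \<beta>))"
    by (simp add: d\<rho>B ext_d_lef[OF \<rho>\<beta>] lef_add add.assoc)
  finally have d\<rho>\<eta>: "ext_d A (fun_scale \<rho> \<eta>) = B1 + lef (B2 + ext_d A (fun_scale \<rho> \<beta>))" .
  have "B1 p c = 0" if p: "p \<in> mfd_boundary A" for p c
  proof (cases "c \<in> A \<and> p \<in> chart_dom c")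
    case True
    then have c: "c \<in> A" "p \<in> chart_dom c" by auto
    interpret hermitian_space "\<omega> p c" "g p c" "J p c" n by (rule hermitian[OF c])
    let ?\<gamma> = "(B2 + ext_d A (fun_scale \<rho> \<beta>)) p c"
    have "(B1 + lef (B2 + ext_d A (fun_scale \<rho> \<beta>))) p = 0"
      using zero p unfolding zero_on_boundary_def d\<rho>\<eta> by blast
    then have "(B1 + lef (B2 + ext_d A (fun_scale \<rho> \<beta>))) p c = 0"
      by (simp add: zero_fun_apply)
    then have "B1 p c + \<L> ?\<gamma> = 0"
      by (simp add: fun_apply lef_apply)
    then have "B1 p c = \<L> (- ?\<gamma>)"
      by (simp add: wedge_uminus_right eq_neg_iff_add_eq_0)
    then show "B1 p c = 0"
      by (rule primitive_\<L>_eq_0[rotated 2])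
        (use alt_forms_alternating[OF OmegaD(2)[OF primitive_formsD(1)[OF B1] c]]
          primitive_formsD(3)[OF B1 c] in auto)
  next
    case False
    then show ?thesis using OmegaD(1)[OF primitive_formsD(1)[OF B1]] by blast
  qed
  then have "zero_on_boundary A B1"
    by (auto simp: zero_on_boundary_def fun_eq_iff zero_fun_apply)
  then show ?thesis
    using B k by (simp add: P_Dplus_def prim_proj_eq[OF \<eta>O] B1_def B_def)
qed

text \<open>
  Formal adjoints are not known to be unique here, hence also not to be linear. As \<open>\<partial>\<^sub>-u\<close> is primitive,
  it has the same inner product with \<open>\<rho> \<pi>(\<eta>)\<close> as with \<open>\<rho> \<eta>\<close>; so a formal adjoint of \<open>\<partial>\<^sub>-\<close> may take
  at \<open>\<rho> \<pi>(\<eta>)\<close> the value that is determined by the given adjoint \<open>S\<close> of \<open>d\<^sup>\<Lambda>\<close> at \<open>\<rho> \<eta>\<close>.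
\<close>

lemma prim_proj_JD:
  assumes \<rho>: "smooth_function A \<rho>" and k: "k < int n" and \<eta>: "\<eta> \<in> Omega_JD X A \<omega> g \<rho> k"
  shows "prim_proj A \<omega> g k \<eta> \<in> P_Nminus X A \<omega> g \<rho> k"
proof -
  obtain S where \<eta>O: "\<eta> \<in> Omega A k"
    and S: "is_formal_adjoint X A g (Omega A (k + 1)) (Omega A k) (d_Lambda A \<omega> g) S"
    and zero: "zero_on_boundary A (S (fun_scale \<rho> \<eta>))"
    using \<eta> by (auto simp: Omega_JD_def)
  define B \<beta> where "B = prim_part k \<eta>" and "\<beta> = coprim_part k \<eta>"
  have B: "B \<in> primitive_forms A \<omega> g k" and \<beta>: "\<beta> \<in> Omega A (k - 2)" and dec: "\<eta> = B + lef \<beta>"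
    unfolding B_def \<beta>_def
    using primitive_prim_part[OF \<eta>O] Omega_coprim_part[OF \<eta>O] prim_part_decomp[OF \<eta>O] k by auto
  have \<rho>\<eta>: "fun_scale \<rho> \<eta> \<in> Omega A k" by (rule Omega_fun_scale[OF \<rho> \<eta>O])
  have \<rho>dec: "fun_scale \<rho> \<eta> = fun_scale \<rho> B + lef (fun_scale \<rho> \<beta>)"
    unfolding dec fun_scale_add lef_fun_scale ..
  \<comment> \<open>The reciprocal of the factor between \<open>d_Lambda\<close> and
    \<open>d_minus\<close> on primitive forms of degree \<open>k + 1\<close>.\<close>
  define s where "s = - (1 / (real n - real_of_int k))"
  have s: "s * (- (real n - real_of_int k)) = 1"
  proof -
    have "real n - real_of_int k > 0" using k by linarith
    then show ?thesis by (simp add: s_def field_simps)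
  qed
  define lift where "lift C = (if C = fun_scale \<rho> B then fun_scale \<rho> \<eta> else C)" for C
  define S' where "S' C = fun_scale (\<lambda>_. s) (prim_part (k + 1) (S (lift C)))" for C
  have lift: "lift C \<in> Omega A k" if "C \<in> primitive_forms A \<omega> g k" for C
    using that \<rho>\<eta> primitive_formsD(1) by (auto simp: lift_def)
  have SO: "S (lift C) \<in> Omega A (k + 1)" if "C \<in> primitive_forms A \<omega> g k" for C
    using S lift[OF that] by (auto simp: is_formal_adjoint_def)
  have "is_formal_adjoint X A g (primitive_forms A \<omega> g (k + 1)) (primitive_forms A \<omega> g k)
      (d_minus A \<omega> g (k + 1)) S'"
    unfolding is_formal_adjoint_def
  proof (intro conjI ballI impI)
    fix C assume C: "C \<in> primitive_forms A \<omega> g k"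
    show "S' C \<in> primitive_forms A \<omega> g (k + 1)"
      unfolding S'_def using k
      by (intro primitive_fun_scale smooth_function_const primitive_prim_part SO[OF C]) simp
    fix u assume u: "u \<in> primitive_forms A \<omega> g (k + 1)" and supp: "interior_supported X A u"
    let ?u = "d_minus A \<omega> g (k + 1) u"
    have du: "?u \<in> primitive_forms A \<omega> g k"
      using d_decomposition_d_plus_d_minus[OF u] k by (simp add: d_decomposition_def)
    have "form_inner A g ?u C = form_inner A g ?u (lift C)"
      using form_inner_primitive_prim_part(1)[OF du \<rho>dec] by (simp add: lift_def)
    then have "L2_inner X A g ?u C = L2_inner X A g ?u (lift C)"
      by (simp add: L2_inner_def)
    also have "\<dots> = s * L2_inner X A g (d_Lambda A \<omega> g u) (lift C)"
    proof -
      have "L2_inner X A g (d_Lambda A \<omega> g u) (lift C) = - (real n - real_of_int k) * L2_inner X A g ?u (lift C)"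
        using k by (simp only: d_Lambda_primitive[OF u] L2_inner_fun_scale_left)
      then show ?thesis using s by (simp flip: mult.assoc)
    qed
    also have "L2_inner X A g (d_Lambda A \<omega> g u) (lift C) = L2_inner X A g u (S (lift C))"
      using S u supp lift[OF C] primitive_formsD(1) unfolding is_formal_adjoint_def by blast
    also have "\<dots> = L2_inner X A g u (prim_part (k + 1) (S (lift C)))"
      using form_inner_primitive_prim_part(1)[OF u prim_part_decomp[OF SO[OF C]]] by (simp add: L2_inner_def)
    also have "s * \<dots> = L2_inner X A g u (S' C)"
      unfolding S'_def by (simp add: L2_inner_fun_scale_right)
    finally show "L2_inner X A g ?u C = L2_inner X A g u (S' C)" .
  qed
  moreover have "zero_on_boundary A (S' (fun_scale \<rho> B))"
    unfolding zero_on_boundary_def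
  proof (intro ballI ext)
    fix p c assume p: "p \<in> mfd_boundary A"
    have \<rho>B: "fun_scale \<rho> B \<in> primitive_forms A \<omega> g k" by (rule primitive_fun_scale[OF \<rho> B])
    have S0: "S (fun_scale \<rho> \<eta>) p c = 0"
      using zero p by (simp add: zero_on_boundary_def zero_fun_apply)
    have "prim_part (k + 1) (S (fun_scale \<rho> \<eta>)) p c = 0"
    proof (cases "c \<in> A \<and> p \<in> chart_dom c")
      case True
      then have c: "c \<in> A" "p \<in> chart_dom c" by auto
      interpret hermitian_space "\<omega> p c" "g p c" "J p c" n by (rule hermitian[OF c])
      \<comment> \<open>\<open>prim_part\<close> acts pointwise, so it is enough that
        \<open>projection\<close> maps zero to zero: its value there is primitive and, by the
        decomposition of zero, in the image of \<open>\<L>\<close>.\<close>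
      let ?z = "(0 :: (real ^ 'm) list \<Rightarrow> real)"
      have "projection (k + 1) ?z + \<L> (coprojection (k + 1) ?z) = 0"
        using projection_decomp[of ?z "k + 1"] by simp
      then have "projection (k + 1) ?z = \<L> (- coprojection (k + 1) ?z)"
        by (simp add: wedge_uminus_right eq_neg_iff_add_eq_0)
      moreover have "alternating (projection (k + 1) ?z)" "\<Lambda> (projection (k + 1) ?z) = 0"
        using projection_alt_forms[of ?z "k + 1"] \<Lambda>_projection[of ?z "k + 1"] k alt_forms_alternating
        by auto
      ultimately have "projection (k + 1) ?z = 0" using primitive_\<L>_eq_0 by blast
      then show ?thesis by (simp add: prim_part_apply[OF c] S0)
    next
      case False
      have "prim_part (k + 1) (S (fun_scale \<rho> \<eta>)) \<in> Omega A (k + 1)"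
        using Omega_prim_part SO[OF \<rho>B] by (simp add: lift_def)
      then show ?thesis using OmegaD(1) False by blast
    qed
    then show "S' (fun_scale \<rho> B) p c vs = 0 c vs" for vs
      by (simp add: S'_def lift_def fun_scale_apply) (simp add: fscale_def fun_apply)
  qed
  ultimately show ?thesis
    using B k by (auto simp: P_Nminus_def prim_proj_eq[OF \<eta>O] B_def)
qed

end

theorem lemma3p11:
  fixes X :: "'a topology"
    and A :: "('a, 'm::finite) atlas"
    and \<omega> :: "('a, 'm) form"
    and J :: "('a, 'm) endo"
    and g :: "('a, 'm) metric"
    and \<rho> :: "'a \<Rightarrow> real"
    and n k :: nat
  assumes "manifold_with_boundary X A"
    and "compact_space X"
    and "CARD('m) = 2 * n"
    and "symplectic_form A \<omega>"
    and "compatible_triple A \<omega> J g"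
    and "boundary_defining X A g \<rho>"
    and "k < n"
  shows "prim_proj A \<omega> g (int k) \<in> Omega_D A \<rho> (int k) \<rightarrow> P_Dplus A \<omega> g \<rho> (int k) \<and>
         prim_proj A \<omega> g (int k) \<in> Omega_JD X A \<omega> g \<rho> (int k) \<rightarrow> P_Nminus X A \<omega> g \<rho> (int k)"
proof -
  interpret symplectic_manifold X A \<omega> J g n
    by unfold_locales (use assms in auto)
  have "smooth_function A \<rho>" using assms(6) by (simp add: boundary_defining_def)
  then show ?thesis
    using prim_proj_D[of \<rho> "int k"] prim_proj_JD[of \<rho> "int k"] assms(7) by auto
qed

end
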